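(* Let $k\le n$ be positive integers. Then $R_{n,k}^{(q)}\cong F[\mathcal{OP}_{n,k}]$ as ungraded $H_n(q)$-modules.
   Context: Let $q$ be a formal parameter and $F = \mathbb{Q}(q)$. The Hecke algebra $H_n(q)$ is the $F$-algebra generated by $T_1,\dots,T_{n-1}$ subject to $(T_i+1)(T_i-q)=0$ for $1\le i\le n-1$; $T_iT_j=T_jT_i$ for $|i-j|>1$; $T_iT_{i+1}T_i=T_{i+1}T_iT_{i+1}$ for $1\le i\le n-2$. Ordered set partitions: a $k$-block ordered set partition of size $n$ is a sequence $(B_1\mid\cdots\mid B_k)$ of $k$ nonempty pairwise disjoint subsets of $[n]=\{1,\dots,n\}$ with union $[n]$; $\mathcal{OP}_{n,k}$ is the set of these. $F[\mathcal{OP}_{n,k}]$ is the $F$-vector space with basis $\mathcal{OP}_{n,k}$, and $H_n(q)$ acts on it as follows. For $\sigma\in\mathcal{OP}_{n,k}$, let $s_i(\sigma)$ be obtained by interchanging $i$ and $i+1$ in $\sigma$. Then $T_i.\sigma = q\,s_i(\sigma)+(q-1)\sigma$ if $i+1$ appears in a block to the left of the block containing $i$; $T_i.\sigma = s_i(\sigma)$ if $i+1$ appears in a block to the right of the block containing $i$; $T_i.\sigma = q\sigma$ if $i$ and $i+1$ appear in the same block. Action on polynomials: for $1\le i\le n-1$, let $s_i$ act on $F[x_1,\dots,x_n]$ by swapping $x_i$ and $x_{i+1}$. Put $\partial_i.f := \frac{f - s_i.f}{x_i-x_{i+1}}$, $\pi_i.f := \partial_i.(x_i f)$, and $\overline{\pi}_i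 := \pi_i - 1$. The generator $T_i$ acts by $T_i.f := q\, (s_i.f) + (1-q)\, (\overline{\pi}_i.f)$; these operators satisfy the relations of $H_n(q)$. Hall-Littlewood polynomials: for $d \ge 1$ and $1 \le i \le n$, $P_d(x_1,\dots,x_i;q)$ is defined by $\sum_{d\ge 0} (1-q)P_d(x_1,\dots,x_i;q)\, t^d = \prod_{j=1}^i \frac{1-q x_j t}{1-x_j t}$. Let $e_d(x_1,\dots,x_n)$ be the elementary symmetric polynomial of degree $d$. For positive integers $k\le n$, define the ideal $$I_{n,k}^{(q)} := \langle P_k(x_1;q), P_k(x_1,x_2;q),\dots,P_k(x_1,\dots,x_n;q),\ e_n(x_1,\dots,x_n), e_{n-1}(x_1,\dots,x_n),\dots,e_{n-k+1}(x_1,\dots,x_n)\rangle \subseteq F[x_1,\dots,x_n]$$ and $R_{n,k}^{(q)} := F[x_1,\dots,x_n]/I_{n,k}^{(q)}$. The ideal $I_{n,k}^{(q)}$ is stable under the $H_n(q)$-action, so $R_{n,k}^{(q)}$ is an $H_n(q)$-module. *)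

theory Defs
  imports
    "HOL-Library.Poly_Mapping"
    "HOL-Combinatorics.Transposition"
    "HOL-Computational_Algebra.Fraction_Field"
    "HOL-Computational_Algebra.Polynomial"
    "HOL-Computational_Algebra.Formal_Power_Series"
    "HOL-Algebra.Module"
    "HOL-Algebra.QuotRing"
begin

section \<open>The ground field\<close>

type_synonym ratfun = "rat poly fract"

definition qvar :: ratfun where
  "qvar = Fraction_Field.Fract [:0, 1:] 1"

definition scale :: "ratfun \<Rightarrow> ('b \<Rightarrow>\<^sub>0 ratfun) \<Rightarrow> ('b \<Rightarrow>\<^sub>0 ratfun)" where
  "scale c v = Poly_Mapping.map (\<lambda>a. c * a) v"


section \<open>Left modules over a not necessarily commutative ring\<close>

text \<open>
  The locale \<open>Module.module\<close> requires a commutative ring of scalars; the record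
  type \<open>module\<close> is reused here, but its components \<open>mult\<close> and \<open>one\<close> play no role.
\<close>

locale left_module = R?: ring R + M?: abelian_group M for R (structure) and M (structure) +
  assumes smult_closed:
      "\<lbrakk>a \<in> carrier R; x \<in> carrier M\<rbrakk> \<Longrightarrow> a \<odot>\<^bsub>M\<^esub> x \<in> carrier M"
    and smult_l_distr:
      "\<lbrakk>a \<in> carrier R; b \<in> carrier R; x \<in> carrier M\<rbrakk> \<Longrightarrow>
        (a \<oplus>\<^bsub>R\<^esub> b) \<odot>\<^bsub>M\<^esub> x = (a \<odot>\<^bsub>M\<^esub> x) \<oplus>\<^bsub>M\<^esub> (b \<odot>\<^bsub>M\<^esub> x)"
    and smult_r_distr:
      "\<lbrakk>a \<in> carrier R; x \<in> carrier M; y \<in> carrier M\<rbrakk> \<Longrightarrow>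
        a \<odot>\<^bsub>M\<^esub> (x \<oplus>\<^bsub>M\<^esub> y) = (a \<odot>\<^bsub>M\<^esub> x) \<oplus>\<^bsub>M\<^esub> (a \<odot>\<^bsub>M\<^esub> y)"
    and smult_assoc:
      "\<lbrakk>a \<in> carrier R; b \<in> carrier R; x \<in> carrier M\<rbrakk> \<Longrightarrow>
        (a \<otimes>\<^bsub>R\<^esub> b) \<odot>\<^bsub>M\<^esub> x = a \<odot>\<^bsub>M\<^esub> (b \<odot>\<^bsub>M\<^esub> x)"
    and smult_one:
      "x \<in> carrier M \<Longrightarrow> \<one>\<^bsub>R\<^esub> \<odot>\<^bsub>M\<^esub> x = x"

definition left_module_iso_map ::
  "('r, 's) ring_scheme \<Rightarrow> ('r, 'a, 't) module_scheme \<Rightarrow> ('r, 'b, 'u) module_scheme \<Rightarrow>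
     ('a \<Rightarrow> 'b) \<Rightarrow> bool" where
  "left_module_iso_map R M N \<phi> \<longleftrightarrow>
     bij_betw \<phi> (carrier M) (carrier N) \<and>
     (\<forall>x\<in>carrier M. \<forall>y\<in>carrier M. \<phi> (x \<oplus>\<^bsub>M\<^esub> y) = \<phi> x \<oplus>\<^bsub>N\<^esub> \<phi> y) \<and>
     (\<forall>a\<in>carrier R. \<forall>x\<in>carrier M. \<phi> (a \<odot>\<^bsub>M\<^esub> x) = a \<odot>\<^bsub>N\<^esub> \<phi> x)"

definition left_module_isomorphic ::
  "('r, 's) ring_scheme \<Rightarrow> ('r, 'a, 't) module_scheme \<Rightarrow> ('r, 'b, 'u) module_scheme \<Rightarrow> bool"
where
  "left_module_isomorphic R M N \<longleftrightarrow>
     left_module R M \<and> left_module R N \<and> (\<exists>\<phi>. left_module_iso_map R M N \<phi>)"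

text \<open>
  The scalar multiplication on cosets follows the pattern of \<^const>\<open>rcoset_mult\<close>:
  for a submodule \<open>N\<close> it sends \<open>N + x\<close> to \<open>N + a x\<close>.
\<close>

definition quotient_module ::
  "('r, 'a, 't) module_scheme \<Rightarrow> 'a set \<Rightarrow> ('r, 'a set) module" where
  "quotient_module M N =
     \<lparr>carrier = carrier (M Quot N), mult = mult (M Quot N), one = one (M Quot N),
      zero = zero (M Quot N), add = add (M Quot N),
      smult = (\<lambda>a C. \<Union>x\<in>C. N +>\<^bsub>M\<^esub> (a \<odot>\<^bsub>M\<^esub> x))\<rparr>"


section \<open>The Hecke algebra\<close>

text \<open>
  The type of words is the free monoid on the letters \<open>1, 2, \<dots>\<close>, written additively so
  that the convolution product of \<open>word \<Rightarrow>\<^sub>0 ratfun\<close> is the product of the free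
  associative algebra.
\<close>

datatype word = Word (letters: "nat list")

instantiation word :: monoid_add
begin

definition zero_word :: word where
  "0 = Word []"

definition plus_word :: "word \<Rightarrow> word \<Rightarrow> word" where
  "u + v = Word (letters u @ letters v)"

instance
  by standard (simp_all add: zero_word_def plus_word_def)

end

definition free_algebra :: "nat \<Rightarrow> (word \<Rightarrow>\<^sub>0 ratfun) ring" where
  "free_algebra n =
     \<lparr>carrier = {a. \<forall>w\<in>Poly_Mapping.keys a. set (letters w) \<subseteq> {1..<n}},
      mult = (*), one = 1, zero = 0, add = (+)\<rparr>"

definition gen :: "nat \<Rightarrow> (word \<Rightarrow>\<^sub>0 ratfun)" where
  "gen i = Poly_Mapping.single (Word [i]) 1"

definition hecke_relators :: "nat \<Rightarrow> (word \<Rightarrow>\<^sub>0 ratfun) set" where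
  "hecke_relators n =
     {(gen i + 1) * (gen i - scale qvar 1) | i. 1 \<le> i \<and> i < n}
     \<union> {gen i * gen j - gen j * gen i | i j.
          1 \<le> i \<and> i < n \<and> 1 \<le> j \<and> j < n \<and> \<bar>int i - int j\<bar> > 1}
     \<union> {gen i * gen (i + 1) * gen i - gen (i + 1) * gen i * gen (i + 1) | i.
          1 \<le> i \<and> i + 1 < n}"

definition hecke_algebra :: "nat \<Rightarrow> (word \<Rightarrow>\<^sub>0 ratfun) set ring" where
  "hecke_algebra n = free_algebra n Quot (Idl\<^bsub>free_algebra n\<^esub> (hecke_relators n))"

text \<open>
  Given operators \<open>T i\<close> for the generators, \<open>free_act T\<close> is the induced action of the free
  algebra. If the \<open>T i\<close> are linear and satisfy the Hecke relations, it is constant on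
  each class \<open>C\<close> of the Hecke algebra, and \<open>hecke_act T C\<close> is this common value.
\<close>

definition free_act ::
  "(nat \<Rightarrow> ('b \<Rightarrow>\<^sub>0 ratfun) \<Rightarrow> ('b \<Rightarrow>\<^sub>0 ratfun)) \<Rightarrow> (word \<Rightarrow>\<^sub>0 ratfun) \<Rightarrow>
     ('b \<Rightarrow>\<^sub>0 ratfun) \<Rightarrow> ('b \<Rightarrow>\<^sub>0 ratfun)" where
  "free_act T a v =
     (\<Sum>w\<in>Poly_Mapping.keys a. scale (Poly_Mapping.lookup a w) (foldr T (letters w) v))"

definition hecke_act ::
  "(nat \<Rightarrow> ('b \<Rightarrow>\<^sub>0 ratfun) \<Rightarrow> ('b \<Rightarrow>\<^sub>0 ratfun)) \<Rightarrow> (word \<Rightarrow>\<^sub>0 ratfun) set \<Rightarrow>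
     ('b \<Rightarrow>\<^sub>0 ratfun) \<Rightarrow> ('b \<Rightarrow>\<^sub>0 ratfun)" where
  "hecke_act T C v = the_elem ((\<lambda>a. free_act T a v) ` C)"


section \<open>Ordered set partitions\<close>

definition ordered_set_partitions :: "nat \<Rightarrow> nat \<Rightarrow> nat set list set" where
  "ordered_set_partitions n k =
     {\<sigma>. length \<sigma> = k \<and>
         (\<forall>r<k. \<sigma> ! r \<noteq> {}) \<and>
         (\<forall>r<k. \<forall>s<k. r \<noteq> s \<longrightarrow> \<sigma> ! r \<inter> \<sigma> ! s = {}) \<and>
         \<Union> (set \<sigma>) = {1..n}}"

definition osp_swap :: "nat \<Rightarrow> nat set list \<Rightarrow> nat set list" where
  "osp_swap i \<sigma> = map (\<lambda>B. transpose i (i + 1) ` B) \<sigma>"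

definition block_left_of :: "nat set list \<Rightarrow> nat \<Rightarrow> nat \<Rightarrow> bool" where
  "block_left_of \<sigma> a b \<longleftrightarrow> (\<exists>r s. r < s \<and> s < length \<sigma> \<and> a \<in> \<sigma> ! r \<and> b \<in> \<sigma> ! s)"

definition osp_T_basis :: "nat \<Rightarrow> nat set list \<Rightarrow> (nat set list \<Rightarrow>\<^sub>0 ratfun)" where
  "osp_T_basis i \<sigma> =
     (if block_left_of \<sigma> (i + 1) i then
        Poly_Mapping.single (osp_swap i \<sigma>) qvar + Poly_Mapping.single \<sigma> (qvar - 1)
      else if block_left_of \<sigma> i (i + 1) then Poly_Mapping.single (osp_swap i \<sigma>) 1
      else Poly_Mapping.single \<sigma> qvar)"

definition osp_T :: "nat \<Rightarrow> (nat set list \<Rightarrow>\<^sub>0 ratfun) \<Rightarrow> (nat set list \<Rightarrow>\<^sub>0 ratfun)" where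
  "osp_T i v =
     (\<Sum>\<sigma>\<in>Poly_Mapping.keys v. scale (Poly_Mapping.lookup v \<sigma>) (osp_T_basis i \<sigma>))"

definition osp_module ::
  "nat \<Rightarrow> nat \<Rightarrow> ((word \<Rightarrow>\<^sub>0 ratfun) set, nat set list \<Rightarrow>\<^sub>0 ratfun) module" where
  "osp_module n k =
     \<lparr>carrier = {v. Poly_Mapping.keys v \<subseteq> ordered_set_partitions n k},
      mult = undefined, one = undefined, zero = 0, add = (+), smult = hecke_act osp_T\<rparr>"


section \<open>The action on polynomials\<close>

text \<open>
  A monomial is its finitely supported exponent function; the variables are
  \<open>x\<^sub>1, x\<^sub>2, \<dots>\<close>, and \<open>F[x\<^sub>1, \<dots>, x\<^sub>n]\<close> is cut out by a carrier set.
\<close>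

type_synonym mpoly = "(nat \<Rightarrow>\<^sub>0 nat) \<Rightarrow>\<^sub>0 ratfun"

definition poly_ring :: "nat \<Rightarrow> mpoly ring" where
  "poly_ring n =
     \<lparr>carrier = {f. \<forall>m\<in>Poly_Mapping.keys f. Poly_Mapping.keys m \<subseteq> {1..n}},
      mult = (*), one = 1, zero = 0, add = (+)\<rparr>"

definition Var :: "nat \<Rightarrow> mpoly" where
  "Var i = Poly_Mapping.single (Poly_Mapping.single i 1) 1"

text \<open>
  The coefficient of \<open>s\<^sub>i.f\<close> at an exponent function \<open>m\<close> is that of \<open>f\<close> at
  \<open>m \<circ> (i i+1)\<close>.
\<close>

definition swap_vars :: "nat \<Rightarrow> mpoly \<Rightarrow> mpoly" where
  "swap_vars i = Poly_Mapping.map_key (Poly_Mapping.map_key (transpose i (i + 1)))"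

lemma inj_map_key_transpose:
  "inj (Poly_Mapping.map_key (transpose i j) :: (nat \<Rightarrow>\<^sub>0 nat) \<Rightarrow> _)"
proof (rule inj_on_inverseI)
  have inj: "inj (transpose i j)" for i j :: nat
    by (rule inj_transpose)
  show "Poly_Mapping.map_key (transpose i j) (Poly_Mapping.map_key (transpose i j) m) = m"
    for m :: "nat \<Rightarrow>\<^sub>0 nat"
    by (rule poly_mapping_eqI) (simp add: map_key.rep_eq inj)
qed

lemma swap_vars_Var: "swap_vars i (Var j) = Var (transpose i (i + 1) j)"
proof -
  let ?t = "transpose i (i + 1)"
  let ?m = "Poly_Mapping.single (?t j) (1::nat)"
  have key: "Poly_Mapping.map_key ?t ?m = Poly_Mapping.single j 1"
    by (rule map_key_single) (rule inj_transpose)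
  have "Poly_Mapping.map_key (Poly_Mapping.map_key ?t)
          (Poly_Mapping.single (Poly_Mapping.map_key ?t ?m) (1::ratfun)) = Poly_Mapping.single ?m 1"
    by (rule map_key_single) (rule inj_map_key_transpose)
  then show ?thesis
    by (simp only: swap_vars_def Var_def key)
qed

text \<open>The exact quotient, unique since the polynomials form an integral domain.\<close>

definition divided_diff :: "nat \<Rightarrow> mpoly \<Rightarrow> mpoly" where
  "divided_diff i f = (THE g. g * (Var i - Var (i + 1)) = f - swap_vars i f)"

definition demazure :: "nat \<Rightarrow> mpoly \<Rightarrow> mpoly" where
  "demazure i f = divided_diff i (Var i * f)"

definition demazure_bar :: "nat \<Rightarrow> mpoly \<Rightarrow> mpoly" where
  "demazure_bar i f = demazure i f - f"

definition poly_T :: "nat \<Rightarrow> mpoly \<Rightarrow> mpoly" where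
  "poly_T i f = scale qvar (swap_vars i f) + scale (1 - qvar) (demazure_bar i f)"

definition poly_module :: "nat \<Rightarrow> ((word \<Rightarrow>\<^sub>0 ratfun) set, mpoly) module" where
  "poly_module n =
     \<lparr>carrier = carrier (poly_ring n), mult = mult (poly_ring n), one = one (poly_ring n),
      zero = zero (poly_ring n), add = add (poly_ring n), smult = hecke_act poly_T\<rparr>"


section \<open>The ideal and the quotient module\<close>

text \<open>The geometric series is the inverse of \<open>1 - a t\<close>.\<close>

definition geom_fps :: "'a::comm_ring_1 \<Rightarrow> 'a fps" where
  "geom_fps a = Abs_fps (\<lambda>m. a ^ m)"

lemma geom_fps_inverse: "(1 - fps_const a * fps_X) * geom_fps a = 1"
proof (rule fps_ext)
  fix m
  show "fps_nth ((1 - fps_const a * fps_X) * geom_fps a) m = fps_nth 1 m"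
    by (cases m) (simp_all add: geom_fps_def left_diff_distrib mult.assoc)
qed

definition hall_littlewood :: "nat \<Rightarrow> nat \<Rightarrow> mpoly" where
  "hall_littlewood d i =
     scale (inverse (1 - qvar))
       (fps_nth (\<Prod>j=1..i. (1 - fps_const (scale qvar (Var j)) * fps_X) * geom_fps (Var j)) d)"

definition elem_sym :: "nat \<Rightarrow> nat \<Rightarrow> mpoly" where
  "elem_sym d n = (\<Sum>S | S \<subseteq> {1..n} \<and> card S = d. \<Prod>j\<in>S. Var j)"

definition ideal_nk :: "nat \<Rightarrow> nat \<Rightarrow> mpoly set" where
  "ideal_nk n k =
     Idl\<^bsub>poly_ring n\<^esub>
       ({hall_littlewood k i | i. 1 \<le> i \<and> i \<le> n} \<union> {elem_sym d n | d. n - k + 1 \<le> d \<and> d \<le> n})"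

definition R_module :: "nat \<Rightarrow> nat \<Rightarrow> ((word \<Rightarrow>\<^sub>0 ratfun) set, mpoly set) module" where
  "R_module n k = quotient_module (poly_module n) (ideal_nk n k)"

end

theory Submission
  imports Defs
begin

text \<open>
  The idea is to find a larger, inhomogeneous picture in which the isomorphism is visible, and to
  pass to leading forms. Since \<open>T\<^sub>i f = q f + (x\<^sub>i\<^sub>+\<^sub>1 - q x\<^sub>i) \<partial>\<^sub>i f\<close>, the value of \<open>T\<^sub>i f\<close> at a point \<open>y\<close>
  with \<open>y\<^sub>i \<noteq> y\<^sub>i\<^sub>+\<^sub>1\<close> is a combination of \<open>f(y)\<close> and \<open>f(s\<^sub>i y)\<close>, in which the second term is absent
  if \<open>y\<^sub>i\<^sub>+\<^sub>1 = q y\<^sub>i\<close>. Attach to each ordered set partition the point whose coordinates along a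
  block, read in increasing order, are \<open>b, q b, q\<^sup>2 b, \<dots>\<close> with one value \<open>b\<close> for each block
  position. The evaluations at these points span a space of functionals that is stable under
  composition with the \<open>T\<^sub>i\<close>.

  Starting from the evaluations that belong to sorted partitions and composing with the \<open>T\<^sub>i\<close>
  along descents gives one functional for each partition. By the Hecke relations it does
  not depend on the order of the descents (\<open>lam_swap_and_same\<close>), and it differs
  from the evaluation by terms with fewer inversions and a nonzero factor (\<open>lam_triangular\<close>).
  Together these functionals form an equivariant map \<open>psi\<close> from polynomials onto the space of
  ordered set partitions (\<open>psi_poly_T\<close>, \<open>psi_image\<close>).

  On the chosen points every generator of the ideal agrees with a polynomial of smaller degree:
  the product that defines the Hall-Littlewood polynomials telescopes along each block
  (\<open>hall_littlewood_at_points\<close>), and the elementary symmetric polynomials see the \<open>k\<close> fixed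
  values \<open>b\<close> among the coordinates (\<open>elem_sym_at_points\<close>). Hence \<open>psi\<close> maps an element of degree
  \<open>d\<close> of the ideal to the image of the polynomials of degree less than \<open>d\<close>.

  The space of ordered set partitions has a symmetric form, diagonal with entries
  \<open>q\<close> to the number of inversions, for which the \<open>T\<^sub>i\<close> are self-adjoint. The rational functions are an
  ordered field with \<open>q > 0\<close>, so the form is positive definite, and each step of the degree
  filtration has an invariant complement. Projecting a form of degree \<open>d\<close> to the complement
  of the lower steps yields an equivariant surjection \<open>graded_map\<close> that kills the ideal.

  Its kernel is not larger, because the quotient ring has dimension at most the number of
  ordered set partitions (\<open>polys_span_bound\<close>, \<open>card_covering_functions\<close>): filtering by powers
  of the last variable bounds the dimension by the recursion that counts functions onto a
  set of \<open>k\<close> blocks by their last value.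
\<close>

section \<open>The ground field\<close>

text \<open>
  A rational function is positive if its leading coefficients have the same sign, so \<open>q\<close>
  exceeds all constants.
\<close>

lemma qvar_gt_1: "qvar > 1"
  unfolding qvar_def One_fract_def
  by (simp add: less_poly_def pos_poly_def one_pCons)

lemma qvar_pos: "qvar > 0"
  using qvar_gt_1 by (rule less_trans[OF zero_less_one])

lemma qvar_nonzero [simp]: "qvar \<noteq> 0"
  using qvar_pos by simp

lemma qvar_neq_1 [simp]: "qvar \<noteq> 1" "1 - qvar \<noteq> 0"
  using qvar_gt_1 by simp_all

lemma qvar_power_eq_iff [simp]: "qvar ^ a = qvar ^ b \<longleftrightarrow> a = b"
  using power_inject_exp[OF qvar_gt_1] .


section \<open>Finitely supported functions as a vector space\<close>

abbreviation lookup :: "('b \<Rightarrow>\<^sub>0 'c::zero) \<Rightarrow> 'b \<Rightarrow> 'c" where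
  "lookup \<equiv> Poly_Mapping.lookup"

abbreviation keys :: "('b \<Rightarrow>\<^sub>0 'c::zero) \<Rightarrow> 'b set" where
  "keys \<equiv> Poly_Mapping.keys"

abbreviation single :: "'b \<Rightarrow> 'c \<Rightarrow> ('b \<Rightarrow>\<^sub>0 'c::zero)" where
  "single \<equiv> Poly_Mapping.single"

lemma lookup_scale [simp]:
  "lookup (scale c v) b = c * lookup v b"
  by (simp add: scale_def map.rep_eq when_def)

global_interpretation VS: vector_space "scale :: ratfun \<Rightarrow> ('b \<Rightarrow>\<^sub>0 ratfun) \<Rightarrow> _"
  by unfold_locales
    (auto intro!: poly_mapping_eqI simp: lookup_add algebra_simps)

global_interpretation VSP: vector_space_pair
  "scale :: ratfun \<Rightarrow> ('b \<Rightarrow>\<^sub>0 ratfun) \<Rightarrow> _" "scale :: ratfun \<Rightarrow> ('c \<Rightarrow>\<^sub>0 ratfun) \<Rightarrow> _"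
  by unfold_locales

abbreviation linmap :: "(('b \<Rightarrow>\<^sub>0 ratfun) \<Rightarrow> ('c \<Rightarrow>\<^sub>0 ratfun)) \<Rightarrow> bool" where
  "linmap \<equiv> Vector_Spaces.linear scale scale"

lemma linmapI:
  assumes "\<And>u v. f (u + v) = f u + f v" "\<And>c v. f (scale c v) = scale c (f v)"
  shows "linmap f"
  using assms by (simp add: Vector_Spaces.linear_iff VS.vector_space_axioms)

lemmas linmap_simps = VSP.linear_add VSP.linear_scale VSP.linear_0 VSP.linear_neg
  VSP.linear_diff VSP.linear_sum

lemma keys_scale_subset: "keys (scale c v) \<subseteq> keys v"
  by (auto simp: in_keys_iff)

lemma scale_single [simp]: "scale c (single b d) = single b (c * d)"
  by (rule poly_mapping_eqI) (simp add: lookup_single when_def)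

lemma poly_mapping_expand:
  assumes "finite A" "keys v \<subseteq> A"
  shows "v = (\<Sum>b\<in>A. scale (lookup v b) (single b 1))"
proof (rule poly_mapping_eqI)
  fix k
  show "lookup v k =
    lookup (\<Sum>b\<in>A. scale (lookup v b) (single b 1)) k"
    using assms
    by (cases "k \<in> A")
      (auto simp: lookup_sum lookup_single when_def in_keys_iff
        if_distrib sum.delta cong: if_cong)
qed

definition lin_ext :: "('b \<Rightarrow> ('c \<Rightarrow>\<^sub>0 ratfun)) \<Rightarrow> ('b \<Rightarrow>\<^sub>0 ratfun) \<Rightarrow> ('c \<Rightarrow>\<^sub>0 ratfun)" where
  "lin_ext g v = (\<Sum>b\<in>keys v. scale (lookup v b) (g b))"

definition functional :: "('b \<Rightarrow> ratfun) \<Rightarrow> ('b \<Rightarrow>\<^sub>0 ratfun) \<Rightarrow> ratfun" where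
  "functional g v = (\<Sum>b\<in>keys v. lookup v b * g b)"

lemma lin_ext_superset:
  assumes "finite A" "keys v \<subseteq> A"
  shows "lin_ext g v = (\<Sum>b\<in>A. scale (lookup v b) (g b))"
  unfolding lin_ext_def using assms
  by (intro sum.mono_neutral_left) (auto simp: in_keys_iff)

lemma functional_superset:
  assumes "finite A" "keys v \<subseteq> A"
  shows "functional g v = (\<Sum>b\<in>A. lookup v b * g b)"
  unfolding functional_def using assms
  by (intro sum.mono_neutral_left) (auto simp: in_keys_iff)

lemma lin_ext_add: "lin_ext g (u + v) = lin_ext g u + lin_ext g v"
proof -
  let ?A = "keys u \<union> keys v"
  have "keys (u + v) \<subseteq> ?A"
    by (rule keys_add)
  then show ?thesis
    by (simp add: lin_ext_superset[of ?A] lookup_add VS.scale_left_distrib sum.distrib)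
qed

lemma functional_add: "functional g (u + v) = functional g u + functional g v"
proof -
  let ?A = "keys u \<union> keys v"
  have "keys (u + v) \<subseteq> ?A"
    by (rule keys_add)
  then show ?thesis
    by (simp add: functional_superset[of ?A] lookup_add distrib_right sum.distrib)
qed

lemma lin_ext_scale: "lin_ext g (scale c v) = scale c (lin_ext g v)"
  by (simp add: lin_ext_superset[of "keys v"] keys_scale_subset
      VS.scale_sum_right)

lemma functional_scale: "functional g (scale c v) = c * functional g v"
  by (simp add: functional_superset[of "keys v"] keys_scale_subset
      sum_distrib_left mult.assoc)

lemma linmap_lin_ext: "linmap (lin_ext g)"
  by (intro linmapI lin_ext_add lin_ext_scale)

lemma functional_zero [simp]: "functional g 0 = 0"
  by (simp add: functional_def)

lemma functional_diff: "functional g (u - v) = functional g u - functional g v"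
  using functional_add[of g "u - v" v] by simp

lemma functional_sum: "functional g (\<Sum>x\<in>A. f x) = (\<Sum>x\<in>A. functional g (f x))"
  by (induction A rule: infinite_finite_induct) (simp_all add: functional_add)

lemma lin_ext_single [simp]: "lin_ext g (single b c) = scale c (g b)"
  by (subst lin_ext_superset[of "{b}"]) auto

lemma functional_single [simp]: "functional g (single b c) = c * g b"
  by (subst functional_superset[of "{b}"]) auto

lemma poly_mapping_induct [case_names single add]:
  assumes "\<And>b c. Q (single b c)"
    and "\<And>f g. Q f \<Longrightarrow> Q g \<Longrightarrow> Q (f + g)"
  shows "Q (f :: 'b \<Rightarrow>\<^sub>0 'c::monoid_add)"
proof (induction f rule: update_induct)
  case const
  show ?case using assms(1)[of _ 0] by simp
next
  case (update f a b)
  have "Poly_Mapping.update a b f = single a b + f"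
    using update(1)
    by (intro poly_mapping_eqI) (auto simp: lookup_update lookup_add lookup_single in_keys_iff when_def)
  then show ?case
    using assms update by simp
qed


section \<open>Polynomials in a set of variables\<close>

definition polys :: "nat set \<Rightarrow> mpoly set" where
  "polys A = {f. \<forall>m\<in>keys f. keys m \<subseteq> A}"

definition Cst :: "ratfun \<Rightarrow> mpoly" where
  "Cst c = single 0 c"

lemma scale_eq_Cst: "scale c f = Cst c * f"
  unfolding scale_def Cst_def by (rule mult_map_scale_conv_mult)

lemma Cst_mult: "Cst (c * d) = Cst c * Cst d"
  and Cst_diff: "Cst (c - d) = Cst c - Cst d"
  and Cst_0 [simp]: "Cst 0 = 0"
  and Cst_1 [simp]: "Cst 1 = 1"
  by (simp_all add: Cst_def mult_single single_diff)

lemma polys_UNIV [simp]: "f \<in> polys UNIV"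
  by (simp add: polys_def)

lemma polys_mono: "A \<subseteq> B \<Longrightarrow> polys A \<subseteq> polys B"
  by (auto simp: polys_def)

lemma polys_add: "f \<in> polys A \<Longrightarrow> g \<in> polys A \<Longrightarrow> f + g \<in> polys A"
  using keys_add[of f g] by (fastforce simp: polys_def)

lemma polys_Cst [simp]: "Cst c \<in> polys A"
  by (simp add: polys_def Cst_def)

lemma polys_0 [simp]: "0 \<in> polys A" and polys_1 [simp]: "1 \<in> polys A"
  using polys_Cst[of 0 A] polys_Cst[of 1 A] by simp_all

lemma polys_Var [simp]: "i \<in> A \<Longrightarrow> Var i \<in> polys A"
  by (simp add: polys_def Var_def)

lemma polys_mult:
  assumes "f \<in> polys A" "g \<in> polys A"
  shows "f * g \<in> polys A"
proof -
  have "keys m \<subseteq> A" if m: "m \<in> keys (f * g)" for m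
  proof -
    obtain a b where "m = a + b" "a \<in> keys f" "b \<in> keys g"
      using m keys_mult[of f g] by auto
    then show ?thesis
      using keys_add[of a b] assms by (fastforce simp: polys_def)
  qed
  then show ?thesis by (simp add: polys_def)
qed

lemma polys_scale: "f \<in> polys A \<Longrightarrow> scale c f \<in> polys A"
  by (simp add: scale_eq_Cst polys_mult)

lemma polys_uminus: "f \<in> polys A \<Longrightarrow> - f \<in> polys A"
  by (simp add: polys_def)

lemma polys_diff: "f \<in> polys A \<Longrightarrow> g \<in> polys A \<Longrightarrow> f - g \<in> polys A"
  using polys_add[of f A "- g"] polys_uminus[of g A] by simp

lemma polys_sum: "(\<And>x. x \<in> B \<Longrightarrow> f x \<in> polys A) \<Longrightarrow> (\<Sum>x\<in>B. f x) \<in> polys A"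
  by (induction B rule: infinite_finite_induct) (simp_all add: polys_add)

lemma polys_prod: "(\<And>x. x \<in> B \<Longrightarrow> f x \<in> polys A) \<Longrightarrow> (\<Prod>x\<in>B. f x) \<in> polys A"
  by (induction B rule: infinite_finite_induct) (simp_all add: polys_mult)

lemma polys_power: "f \<in> polys A \<Longrightarrow> f ^ m \<in> polys A"
  by (induction m) (simp_all add: polys_mult)

lemma subspace_polys: "VS.subspace (polys A)"
  by (simp add: VS.subspace_def polys_add polys_scale)

lemma Var_power: "Var i ^ e = single (single i e) 1"
  by (induction e) (simp_all add: Var_def mult_single single_add[symmetric])

lemma single_eq_prod_Var:
  "single m c = Cst c * (\<Prod>i\<in>keys m. Var i ^ lookup m i)"
proof -
  have "(\<Prod>i\<in>A. Var i ^ lookup m i) =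
      single (\<Sum>i\<in>A. single i (lookup m i)) 1"
    if "finite A" for A
    using that by (induction A) (simp_all add: Var_power mult_single)
  moreover have "(\<Sum>i\<in>keys m. single i (lookup m i)) = m"
    by (rule poly_mapping_eqI)
      (auto simp: lookup_sum lookup_single when_def in_keys_iff)
  ultimately show ?thesis
    by (simp add: Cst_def mult_single)
qed

lemma polys_induct [consumes 1, case_names Cst Var add mult]:
  assumes f: "f \<in> polys A"
    and Cst: "\<And>c. Q (Cst c)" and Var: "\<And>i. i \<in> A \<Longrightarrow> Q (Var i)"
    and add: "\<And>f g. \<lbrakk>f \<in> polys A; g \<in> polys A; Q f; Q g\<rbrakk> \<Longrightarrow> Q (f + g)"
    and mult: "\<And>f g. \<lbrakk>f \<in> polys A; g \<in> polys A; Q f; Q g\<rbrakk> \<Longrightarrow> Q (f * g)"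
  shows "Q f"
proof -
  have one: "Q 1" using Cst[of 1] by simp
  have zero: "Q 0" using Cst[of 0] by simp
  have pow: "Q (Var i ^ e)" if "i \<in> A" for i e
    using that by (induction e) (auto simp: one polys_power intro!: mult Var)
  have prod: "Q (\<Prod>i\<in>B. Var i ^ e i)" if "finite B" "B \<subseteq> A" for B e
    using that by (induction B) (auto simp: one intro!: mult pow polys_power polys_prod)
  have single: "Q (single m c)" if "keys m \<subseteq> A" for m c
    unfolding single_eq_prod_Var
    using that by (intro mult Cst prod polys_prod polys_power) auto
  have *: "Q (\<Sum>m\<in>B. scale (lookup f m) (single m 1))"
    if "finite B" "B \<subseteq> keys f" for B
    using that
  proof (induction B)
    case (insert m B)
    have "keys m' \<subseteq> A" if "m' \<in> insert m B" for m'
      using that insert f by (auto simp: polys_def)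
    then show ?case
      using insert by (auto intro!: add single polys_sum simp: polys_def)
  qed (simp add: zero)
  show ?thesis
    by (subst poly_mapping_expand[OF finite_keys order_refl], rule *) auto
qed

lemma Var_eq_iff [simp]: "Var i = Var j \<longleftrightarrow> i = j"
proof
  assume "Var i = Var j"
  then have "lookup (Var i) (single i 1)
    = lookup (Var j) (single i 1)" by simp
  then have "single j 1 = single i (1::nat)"
    by (simp add: Var_def lookup_single when_def split: if_splits)
  then have "lookup (single j 1) i = lookup (single i (1::nat)) i"
    by simp
  then show "i = j" by (simp add: lookup_single when_def split: if_splits)
qed simp

subsection \<open>Evaluation\<close>

definition eval_poly :: "(nat \<Rightarrow> ratfun) \<Rightarrow> mpoly \<Rightarrow> ratfun" where
  "eval_poly y = functional (\<lambda>m. \<Prod>i\<in>keys m. y i ^ lookup m i)"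

lemma eval_add: "eval_poly y (f + g) = eval_poly y f + eval_poly y g"
  and eval_diff: "eval_poly y (f - g) = eval_poly y f - eval_poly y g"
  and eval_scale: "eval_poly y (scale c f) = c * eval_poly y f"
  and eval_0 [simp]: "eval_poly y 0 = 0"
  by (simp_all add: eval_poly_def functional_add functional_diff functional_scale functional_sum)

lemma eval_Cst [simp]: "eval_poly y (Cst c) = c"
  by (simp add: eval_poly_def Cst_def)

lemma eval_1 [simp]: "eval_poly y 1 = 1"
  using eval_Cst[of y 1] by simp

lemma eval_Var [simp]: "eval_poly y (Var i) = y i"
  by (simp add: eval_poly_def Var_def)

lemma eval_mult: "eval_poly y (f * g) = eval_poly y f * eval_poly y g"
proof (induction f rule: poly_mapping_induct)
  case (single a c)
  show ?case
  proof (induction g rule: poly_mapping_induct)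
    case (single b d)
    let ?A = "keys a \<union> keys b"
    have *: "(\<Prod>i\<in>keys m. y i ^ lookup m i) =
        (\<Prod>i\<in>?A. y i ^ lookup m i)" if "keys m \<subseteq> ?A" for m
      using that by (intro prod.mono_neutral_left) (auto simp: in_keys_iff)
    show ?case
      unfolding eval_poly_def mult_single functional_single *[OF keys_add] *[OF Un_upper1]
        *[OF Un_upper2] by (simp add: lookup_add power_add prod.distrib)
  qed (simp add: eval_add distrib_left)
qed (simp add: eval_add distrib_right)

lemma eval_prod: "eval_poly y (\<Prod>x\<in>B. h x) = (\<Prod>x\<in>B. eval_poly y (h x))"
  by (induction B rule: infinite_finite_induct) (simp_all add: eval_mult)


subsection \<open>Homogeneous components\<close>

definition mdeg :: "(nat \<Rightarrow>\<^sub>0 nat) \<Rightarrow> nat" where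
  "mdeg m = (\<Sum>i\<in>keys m. lookup m i)"

lift_definition hom_comp ::
    "nat \<Rightarrow> ((nat \<Rightarrow>\<^sub>0 nat) \<Rightarrow>\<^sub>0 'a::zero) \<Rightarrow> (nat \<Rightarrow>\<^sub>0 nat) \<Rightarrow>\<^sub>0 'a" is
  "\<lambda>d f m. if mdeg m = d then f m else 0"
  by (rule finite_subset[rotated]) auto

lemma mdeg_superset:
  assumes "finite A" "keys m \<subseteq> A"
  shows "mdeg m = (\<Sum>i\<in>A. lookup m i)"
  unfolding mdeg_def using assms
  by (intro sum.mono_neutral_left) (auto simp: in_keys_iff)

lemma mdeg_add: "mdeg (a + b) = mdeg a + mdeg b"
proof -
  let ?A = "keys a \<union> keys b"
  show ?thesis
    using keys_add[of a b]
    by (simp add: mdeg_superset[of ?A] lookup_add sum.distrib)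
qed

lemma lookup_hom_comp:
  "lookup (hom_comp d f) m = (if mdeg m = d then lookup f m else 0)"
  by (simp add: hom_comp.rep_eq)

lemma hom_comp_add: "hom_comp d (f + g) = hom_comp d f + hom_comp d g"
  by (rule poly_mapping_eqI) (simp add: lookup_hom_comp lookup_add)

lemma hom_comp_scale: "hom_comp d (scale c f) = scale c (hom_comp d f)"
  by (rule poly_mapping_eqI) (simp add: lookup_hom_comp)

lemma linmap_hom_comp: "linmap (hom_comp d)"
  by (intro linmapI hom_comp_add hom_comp_scale)

lemma polys_hom_comp: "f \<in> polys A \<Longrightarrow> hom_comp d f \<in> polys A"
  by (auto simp: polys_def in_keys_iff lookup_hom_comp split: if_splits)

lemma hom_comp_single:
  "hom_comp d (single m c) = (if mdeg m = d then single m c else 0)"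
  by (rule poly_mapping_eqI) (auto simp: lookup_hom_comp lookup_single when_def)

definition homogeneous :: "nat \<Rightarrow> mpoly \<Rightarrow> bool" where
  "homogeneous d f \<longleftrightarrow> (\<forall>m\<in>keys f. mdeg m = d)"

lemma homogeneous_iff: "homogeneous d f \<longleftrightarrow> hom_comp d f = f"
proof
  assume "homogeneous d f"
  then show "hom_comp d f = f"
    by (intro poly_mapping_eqI) (auto simp: homogeneous_def lookup_hom_comp in_keys_iff)
next
  assume *: "hom_comp d f = f"
  have "lookup f m = 0" if "mdeg m \<noteq> d" for m
    using arg_cong[OF *, of "\<lambda>f. lookup f m"] that by (simp add: lookup_hom_comp)
  then show "homogeneous d f"
    by (auto simp: homogeneous_def in_keys_iff)
qed

lemma homogeneous_hom_comp: "homogeneous d (hom_comp d f)"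
  by (auto simp: homogeneous_def in_keys_iff lookup_hom_comp split: if_splits)

lemma hom_comp_homogeneous:
  assumes "homogeneous d f"
  shows "hom_comp e f = (if e = d then f else 0)"
  using assms
  by (intro poly_mapping_eqI) (auto simp: lookup_hom_comp homogeneous_def in_keys_iff)

lemma homogeneous_add: "homogeneous d f \<Longrightarrow> homogeneous d g \<Longrightarrow> homogeneous d (f + g)"
  by (simp add: homogeneous_iff hom_comp_add)

lemma homogeneous_scale: "homogeneous d f \<Longrightarrow> homogeneous d (scale c f)"
  by (simp add: homogeneous_iff hom_comp_scale)

lemma homogeneous_0 [simp]: "homogeneous d 0"
  by (simp add: homogeneous_def)

lemma homogeneous_diff: "homogeneous d f \<Longrightarrow> homogeneous d g \<Longrightarrow> homogeneous d (f - g)"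
  by (simp add: homogeneous_iff linmap_simps[OF linmap_hom_comp])

lemma homogeneous_sum:
  "(\<And>x. x \<in> B \<Longrightarrow> homogeneous d (f x)) \<Longrightarrow> homogeneous d (\<Sum>x\<in>B. f x)"
  by (induction B rule: infinite_finite_induct) (simp_all add: homogeneous_add)

lemma homogeneous_Cst: "homogeneous 0 (Cst c)"
  by (simp add: homogeneous_def Cst_def mdeg_def)

lemma homogeneous_1: "homogeneous 0 1"
  using homogeneous_Cst[of 1] by simp

lemma homogeneous_Var: "homogeneous 1 (Var i)"
  by (simp add: homogeneous_def Var_def mdeg_def)

lemma homogeneous_mult:
  assumes "homogeneous d f" "homogeneous e g"
  shows "homogeneous (d + e) (f * g)"
  using assms keys_mult[of f g] by (fastforce simp: homogeneous_def mdeg_add)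

lemma homogeneous_prod:
  "(\<And>x. x \<in> B \<Longrightarrow> homogeneous (d x) (f x)) \<Longrightarrow> homogeneous (\<Sum>x\<in>B. d x) (\<Prod>x\<in>B. f x)"
  by (induction B rule: infinite_finite_induct)
    (simp_all add: homogeneous_1 homogeneous_mult)

lemma homogeneous_Var_power: "homogeneous e (Var i ^ e)"
  by (simp add: Var_power homogeneous_def mdeg_def)

lemma hom_comp_mult_homogeneous:
  assumes "homogeneous e g"
  shows "hom_comp (d + e) (f * g) = hom_comp d f * g"
proof (induction f rule: poly_mapping_induct)
  case (single m c)
  have "homogeneous (mdeg m) (single m c)"
    by (simp add: homogeneous_def)
  then have "homogeneous (mdeg m + e) (single m c * g)"
    using assms by (rule homogeneous_mult)
  then show ?case
    by (simp add: hom_comp_single hom_comp_homogeneous)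
next
  case (add f1 f2)
  then show ?case
    by (simp add: distrib_right hom_comp_add)
qed

lemma sum_hom_comp:
  assumes "finite D" "mdeg ` keys f \<subseteq> D"
  shows "(\<Sum>d\<in>D. hom_comp d f) = f"
proof (rule poly_mapping_eqI)
  fix m
  show "lookup (\<Sum>d\<in>D. hom_comp d f) m = lookup f m"
    using assms by (cases "m \<in> keys f") (auto simp: lookup_sum lookup_hom_comp in_keys_iff)
qed


section \<open>The Demazure-Lusztig operators\<close>

subsection \<open>Swapping variables\<close>

definition swap_exps :: "nat \<Rightarrow> (nat \<Rightarrow>\<^sub>0 nat) \<Rightarrow> (nat \<Rightarrow>\<^sub>0 nat)" where
  "swap_exps i = Poly_Mapping.map_key (transpose i (i + 1))"

lemma inj_transpose_nat: "inj (transpose (i::nat) j)"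
  by (rule inj_transpose)

lemma lookup_swap_exps: "lookup (swap_exps i m) j = lookup m (transpose i (i + 1) j)"
  by (simp add: swap_exps_def map_key.rep_eq[OF inj_transpose_nat])

lemma swap_exps_add: "swap_exps i (a + b) = swap_exps i a + swap_exps i b"
  unfolding swap_exps_def by (rule map_key_plus[OF inj_transpose_nat])

lemma swap_exps_swap_exps: "swap_exps i (swap_exps i m) = m"
  by (rule poly_mapping_eqI) (simp add: lookup_swap_exps del: One_nat_def)

lemma swap_single: "swap_vars i (single m c) = single (swap_exps i m) c"
proof -
  have "swap_vars i (single (swap_exps i (swap_exps i m)) c) =
      single (swap_exps i m) c"
    unfolding swap_vars_def swap_exps_def by (rule map_key_single[OF inj_map_key_transpose])
  then show ?thesis by (simp only: swap_exps_swap_exps)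
qed

lemma swap_add: "swap_vars i (f + g) = swap_vars i f + swap_vars i g"
  unfolding swap_vars_def by (rule map_key_plus[OF inj_map_key_transpose])

lemma lookup_swap: "lookup (swap_vars i f) m = lookup f (swap_exps i m)"
  unfolding swap_vars_def swap_exps_def by (simp add: map_key.rep_eq[OF inj_map_key_transpose])

lemma swap_diff: "swap_vars i (f - g) = swap_vars i f - swap_vars i g"
  by (rule poly_mapping_eqI) (simp add: lookup_swap lookup_minus)

lemma swap_mult: "swap_vars i (f * g) = swap_vars i f * swap_vars i g"
proof (induction f rule: poly_mapping_induct)
  case (single a c)
  show ?case
    by (induction g rule: poly_mapping_induct)
      (simp_all add: mult_single swap_single swap_exps_add swap_add distrib_left)
qed (simp add: swap_add distrib_right)

lemma swap_swap [simp]: "swap_vars i (swap_vars i f) = f"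
  by (rule poly_mapping_eqI) (simp add: lookup_swap swap_exps_swap_exps del: One_nat_def)

lemma swap_Cst [simp]: "swap_vars i (Cst c) = Cst c"
proof -
  have "swap_exps i 0 = 0" unfolding swap_exps_def by (rule map_key_zero[OF inj_transpose_nat])
  then show ?thesis by (simp add: Cst_def swap_single)
qed

lemma swap_polys:
  assumes "f \<in> polys A" "i \<in> A" "i + 1 \<in> A"
  shows "swap_vars i f \<in> polys A"
  using assms(1)
proof (induction rule: polys_induct)
  case (Var j)
  then show ?case using assms by (simp add: swap_vars_Var transpose_def)
qed (simp_all add: swap_add swap_mult polys_add polys_mult)

lemma swap_commute:
  assumes "i + 1 < j"
  shows "swap_vars i (swap_vars j f) = swap_vars j (swap_vars i f)"
  using polys_UNIV[of f]
proof (induction rule: polys_induct)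
  case (Var k)
  show ?case using assms by (simp add: swap_vars_Var transpose_def)
qed (simp_all add: swap_add swap_mult)

lemma swap_braid:
  "swap_vars i (swap_vars (i + 1) (swap_vars i f)) =
   swap_vars (i + 1) (swap_vars i (swap_vars (i + 1) f))"
  using polys_UNIV[of f]
proof (induction rule: polys_induct)
  case (Var k)
  show ?case by (simp add: swap_vars_Var transpose_def)
qed (simp_all add: swap_add swap_mult)

lemma mdeg_swap_exps: "mdeg (swap_exps i m) = mdeg m"
proof -
  let ?t = "transpose i (i + 1)"
  have "keys (swap_exps i m) = ?t ` keys m"
    by (simp add: swap_exps_def keys_map_key[OF inj_transpose_nat] bij_vimage_eq_inv_image)
  then have "mdeg (swap_exps i m) = (\<Sum>j\<in>?t ` keys m. lookup m (?t j))"
    by (simp add: mdeg_def lookup_swap_exps)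
  also have "\<dots> = mdeg m"
    by (subst sum.reindex) (simp_all add: mdeg_def inj_on_subset[OF inj_transpose_nat])
  finally show ?thesis .
qed

lemma hom_comp_swap: "hom_comp d (swap_vars i f) = swap_vars i (hom_comp d f)"
  by (rule poly_mapping_eqI) (simp add: lookup_hom_comp lookup_swap mdeg_swap_exps del: One_nat_def)

lemma eval_swap: "eval_poly y (swap_vars i f) = eval_poly (y \<circ> transpose i (i + 1)) f"
  using polys_UNIV[of f]
  by (induction rule: polys_induct) (simp_all add: swap_add swap_mult eval_add eval_mult swap_vars_Var)


subsection \<open>Divided differences\<close>

lemma Var_diff_nonzero [simp]: "Var i - Var (i + 1) \<noteq> 0" "Var i - Var (Suc i) \<noteq> 0"
  by simp_all

text \<open>
  The difference \<open>f - s\<^sub>i f\<close> obeys a twisted Leibniz rule, so divisibility passes from the variables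
  to all polynomials, and the quotient needs no further variables.
\<close>

lemma divided_diff_exists:
  assumes "f \<in> polys A" "i \<in> A" "i + 1 \<in> A"
  shows "\<exists>g\<in>polys A. g * (Var i - Var (i + 1)) = f - swap_vars i f"
  using assms(1)
proof (induction rule: polys_induct)
  case (Cst c)
  show ?case by (rule bexI[of _ 0]) simp_all
next
  case (Var j)
  show ?case
  proof (cases "j = i \<or> j = i + 1")
    case True
    then show ?thesis
    proof
      assume "j = i"
      then show ?thesis by (intro bexI[of _ 1]) (simp_all add: swap_vars_Var)
    next
      assume "j = i + 1"
      then show ?thesis by (intro bexI[of _ "-1"]) (simp_all add: swap_vars_Var polys_uminus)
    qed
  next
    case False
    then show ?thesis by (intro bexI[of _ 0]) (simp_all add: swap_vars_Var)
  qed
next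
  case (add f g)
  then obtain f' g' where "f' \<in> polys A" "f' * (Var i - Var (i + 1)) = f - swap_vars i f"
    "g' \<in> polys A" "g' * (Var i - Var (i + 1)) = g - swap_vars i g" by blast
  then show ?case
    by (intro bexI[of _ "f' + g'"]) (simp_all add: swap_add polys_add distrib_right)
next
  case (mult f g)
  then obtain f' g' where *: "f' \<in> polys A" "f' * (Var i - Var (i + 1)) = f - swap_vars i f"
    "g' \<in> polys A" "g' * (Var i - Var (i + 1)) = g - swap_vars i g" by blast
  have "(f' * g + swap_vars i f * g') * (Var i - Var (i + 1)) =
      f' * (Var i - Var (i + 1)) * g + swap_vars i f * (g' * (Var i - Var (i + 1)))"
    by (simp add: algebra_simps)
  also have "\<dots> = f * g - swap_vars i (f * g)"
    unfolding * by (simp add: algebra_simps swap_mult)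
  finally show ?case
    using * mult assms
    by (intro bexI[of _ "f' * g + swap_vars i f * g'"]) (simp_all add: polys_add polys_mult swap_polys)
qed

lemma divided_diff_eqI:
  assumes "g * (Var i - Var (i + 1)) = f - swap_vars i f"
  shows "divided_diff i f = g"
  unfolding divided_diff_def
proof (rule the_equality)
  fix h
  assume "h * (Var i - Var (i + 1)) = f - swap_vars i f"
  then have "h * (Var i - Var (i + 1)) = g * (Var i - Var (i + 1))"
    using assms by simp
  then show "h = g"
    by (simp only: mult_right_cancel[OF Var_diff_nonzero(1)])
qed fact

lemma divided_diff_mult: "divided_diff i f * (Var i - Var (i + 1)) = f - swap_vars i f"
  using divided_diff_exists[OF polys_UNIV[of f], of i] divided_diff_eqI by force

lemma polys_divided_diff:
  assumes "f \<in> polys A" "i \<in> A" "i + 1 \<in> A"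
  shows "divided_diff i f \<in> polys A"
  using divided_diff_exists[OF assms] divided_diff_eqI by force

lemma Var_diff_cancel: "f * (Var i - Var (i + 1)) = g * (Var i - Var (i + 1)) \<Longrightarrow> f = g"
  by (simp only: mult_right_cancel[OF Var_diff_nonzero(1)])


subsection \<open>A formula for the operators\<close>

text \<open>
  In this form the divided difference has disappeared. As the polynomials form a domain, the
  identity determines \<open>T\<^sub>i f\<close>, and it replaces the definition from here on.
\<close>

lemma poly_T_mult:
  "poly_T i f * (Var i - Var (i + 1)) =
     Cst qvar * f * (Var i - Var (i + 1)) + (Var (i + 1) - Cst qvar * Var i) * (f - swap_vars i f)"
proof -
  have "demazure i f * (Var i - Var (i + 1)) = Var i * f - Var (i + 1) * swap_vars i f"
    unfolding demazure_def divided_diff_mult by (simp add: swap_mult swap_vars_Var)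
  then show ?thesis
    unfolding poly_T_def demazure_bar_def scale_eq_Cst Cst_diff Cst_1
    by (simp only: distrib_right left_diff_distrib mult.assoc) (simp add: algebra_simps)
qed

lemma poly_T_alt:
  "poly_T i f = Cst qvar * f + (Var (i + 1) - Cst qvar * Var i) * divided_diff i f"
proof (rule Var_diff_cancel[of _ i])
  show "poly_T i f * (Var i - Var (i + 1)) =
    (Cst qvar * f + (Var (i + 1) - Cst qvar * Var i) * divided_diff i f) * (Var i - Var (i + 1))"
    unfolding poly_T_mult distrib_right mult.assoc divided_diff_mult ..
qed

lemma poly_T_eqI:
  assumes "g * (Var i - Var (i + 1)) =
     Cst qvar * f * (Var i - Var (i + 1)) + (Var (i + 1) - Cst qvar * Var i) * (f - swap_vars i f)"
  shows "poly_T i f = g"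
  using assms poly_T_mult Var_diff_cancel by metis

lemma polys_poly_T:
  assumes "f \<in> polys A" "i \<in> A" "i + 1 \<in> A"
  shows "poly_T i f \<in> polys A"
  unfolding poly_T_alt using assms
  by (intro polys_add polys_mult polys_diff polys_divided_diff polys_Cst polys_Var)

lemma poly_T_add: "poly_T i (f + g) = poly_T i f + poly_T i g"
  by (rule poly_T_eqI) (simp only: distrib_right poly_T_mult swap_add, simp add: algebra_simps)

lemma poly_T_scale: "poly_T i (scale c f) = scale c (poly_T i f)"
proof (rule poly_T_eqI)
  have "scale c (poly_T i f) * (Var i - Var (i + 1)) = Cst c * (poly_T i f * (Var i - Var (i + 1)))"
    by (simp add: scale_eq_Cst mult.assoc)
  then show "scale c (poly_T i f) * (Var i - Var (i + 1)) = Cst qvar * scale c f * (Var i - Var (i + 1)) +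
      (Var (i + 1) - Cst qvar * Var i) * (scale c f - swap_vars i (scale c f))"
    unfolding poly_T_mult by (simp add: scale_eq_Cst swap_mult algebra_simps)
qed

lemma linmap_poly_T: "linmap (poly_T i)"
  by (intro linmapI poly_T_add poly_T_scale)

text \<open>
  Both linear forms that occur in the characterizing identity have degree \<open>1\<close>.
\<close>

lemma hom_comp_poly_T: "hom_comp d (poly_T i f) = poly_T i (hom_comp d f)"
proof (rule poly_T_eqI[symmetric])
  have D: "homogeneous 1 (Var i - Var (i + 1))" "homogeneous 1 (Var (i + 1) - Cst qvar * Var i)"
    by (simp_all add: homogeneous_diff homogeneous_Var homogeneous_scale del: One_nat_def
        flip: scale_eq_Cst)
  have "hom_comp d (poly_T i f) * (Var i - Var (i + 1)) =
      hom_comp (d + 1) (poly_T i f * (Var i - Var (i + 1)))"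
    by (simp only: hom_comp_mult_homogeneous[OF D(1)])
  also have "\<dots> = hom_comp (d + 1) (scale qvar (f * (Var i - Var (i + 1))))
      + hom_comp (d + 1) ((f - swap_vars i f) * (Var (i + 1) - Cst qvar * Var i))"
    by (simp only: poly_T_mult hom_comp_add scale_eq_Cst mult_ac)
  also have "\<dots> = scale qvar (hom_comp d f * (Var i - Var (i + 1)))
      + (hom_comp d f - swap_vars i (hom_comp d f)) * (Var (i + 1) - Cst qvar * Var i)"
    by (simp only: hom_comp_scale hom_comp_mult_homogeneous[OF D(1)]
       hom_comp_mult_homogeneous[OF D(2)] linmap_simps[OF linmap_hom_comp] hom_comp_swap)
  finally show "hom_comp d (poly_T i f) * (Var i - Var (i + 1)) =
     Cst qvar * hom_comp d f * (Var i - Var (i + 1)) +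
     (Var (i + 1) - Cst qvar * Var i) * (hom_comp d f - swap_vars i (hom_comp d f))"
    by (simp only: scale_eq_Cst mult_ac)
qed

text \<open>
  Only the points \<open>y\<close> and \<open>s\<^sub>i y\<close> enter, and the second one drops out if \<open>y\<^sub>i\<^sub>+\<^sub>1 = q y\<^sub>i\<close>.
\<close>

lemma eval_poly_T:
  assumes "y i \<noteq> y (i + 1)"
  shows "eval_poly y (poly_T i f) = qvar * eval_poly y f +
    (y (i + 1) - qvar * y i) / (y i - y (i + 1)) * (eval_poly y f - eval_poly (y \<circ> transpose i (i + 1)) f)"
proof -
  have "eval_poly y (poly_T i f) * (y i - y (i + 1)) = eval_poly y (poly_T i f * (Var i - Var (i + 1)))"
    by (simp add: eval_mult eval_diff)
  also have "\<dots> = qvar * eval_poly y f * (y i - y (i + 1)) +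
    (y (i + 1) - qvar * y i) * (eval_poly y f - eval_poly (y \<circ> transpose i (i + 1)) f)"
    unfolding poly_T_mult by (simp add: eval_add eval_mult eval_diff eval_swap)
  finally show ?thesis
    using assms by (simp add: field_simps)
qed


subsection \<open>The Hecke relations\<close>

text \<open>
  Over the fraction field, \<open>T\<^sub>i f = A f + B (s\<^sub>i f)\<close> with rational functions \<open>A\<close> and \<open>B\<close> of \<open>x\<^sub>i\<close> and
  \<open>x\<^sub>i\<^sub>+\<^sub>1\<close>. Each relation then follows by comparing the coefficients of the translates of \<open>f\<close> under
  the group generated by the swaps.
\<close>

context
begin

private definition emb :: "mpoly \<Rightarrow> mpoly fract" where "emb f = Fraction_Field.Fract f 1"

private lemma emb_add: "emb (f + g) = emb f + emb g"
  and emb_mult: "emb (f * g) = emb f * emb g"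
  and emb_diff: "emb (f - g) = emb f - emb g"
  and emb_eq_iff: "emb f = emb g \<longleftrightarrow> f = g"
  and emb_1: "emb 1 = 1"
  by (simp_all add: emb_def eq_fract One_fract_def)

private definition coefA :: "mpoly fract \<Rightarrow> mpoly fract \<Rightarrow> mpoly fract" where
  "coefA a b = (1 - emb (Cst qvar)) * b / (a - b)"

private definition coefB :: "mpoly fract \<Rightarrow> mpoly fract \<Rightarrow> mpoly fract" where
  "coefB a b = (emb (Cst qvar) * a - b) / (a - b)"

text \<open>
  The substitution \<open>w\<close> stands for a composition of swaps, which occurs when an outer operator
  is expanded first.
\<close>

private lemma emb_poly_T:
  assumes "\<And>f g. w (f + g) = w f + w g" "\<And>f g. w (f * g) = w f * w g"
    "\<And>f g. w (f - g) = w f - w g" "\<And>c. w (Cst c) = Cst c" "w (Var i) \<noteq> w (Var (i + 1))"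
  shows "emb (w (poly_T i f)) =
    coefA (emb (w (Var i))) (emb (w (Var (i + 1)))) * emb (w f)
    + coefB (emb (w (Var i))) (emb (w (Var (i + 1)))) * emb (w (swap_vars i f))"
proof -
  let ?a = "emb (w (Var i))" and ?b = "emb (w (Var (i + 1)))" and ?q = "emb (Cst qvar)"
  have ne: "?a - ?b \<noteq> 0" using assms(5) by (simp add: emb_eq_iff)
  have "emb (w (poly_T i f)) * (?a - ?b) = emb (w (poly_T i f * (Var i - Var (i + 1))))"
    by (simp only: assms emb_mult emb_diff)
  also have "\<dots> = ?q * emb (w f) * (?a - ?b) + (?b - ?q * ?a) * (emb (w f) - emb (w (swap_vars i f)))"
    unfolding poly_T_mult by (simp only: assms emb_add emb_mult emb_diff)
  also have "\<dots> = (1 - ?q) * ?b * emb (w f) + (?q * ?a - ?b) * emb (w (swap_vars i f))"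
    by (simp add: algebra_simps)
  finally show ?thesis
    using ne by (simp add: coefA_def coefB_def divide_simps)
qed

private lemmas emb_T0 = emb_poly_T[of "\<lambda>f. f"]
private lemmas emb_T1 = emb_poly_T[of "\<lambda>f. swap_vars j f" for j, OF swap_add swap_mult swap_diff swap_Cst]
private lemmas emb_T2 = emb_poly_T[of "\<lambda>f. swap_vars j (swap_vars k f)" for j k,
  simplified swap_add swap_mult swap_diff swap_Cst, simplified]

lemma poly_T_quadratic: "poly_T i (poly_T i f) = scale (qvar - 1) (poly_T i f) + scale qvar f"
proof -
  let ?a = "emb (Var i)" and ?b = "emb (Var (i + 1))" and ?q = "emb (Cst qvar)"
  have ne: "?a - ?b \<noteq> 0" "?b - ?a \<noteq> 0" by (simp_all add: emb_eq_iff)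
  have A: "coefA ?a ?b * coefA ?a ?b + coefB ?a ?b * coefB ?b ?a = (?q - 1) * coefA ?a ?b + ?q"
    using ne unfolding coefA_def coefB_def by (simp add: divide_simps, simp add: algebra_simps)
  have B: "coefA ?a ?b * coefB ?a ?b + coefB ?a ?b * coefA ?b ?a = (?q - 1) * coefB ?a ?b"
    using ne unfolding coefA_def coefB_def by (simp add: divide_simps, simp add: algebra_simps)
  have "emb (poly_T i (poly_T i f)) =
     (coefA ?a ?b * coefA ?a ?b + coefB ?a ?b * coefB ?b ?a) * emb f
     + (coefA ?a ?b * coefB ?a ?b + coefB ?a ?b * coefA ?b ?a) * emb (swap_vars i f)"
    by (simp add: emb_T0 emb_T1 swap_vars_Var algebra_simps)
  also have "\<dots> = emb (scale (qvar - 1) (poly_T i f) + scale qvar f)"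
    unfolding A B scale_eq_Cst emb_add emb_mult Cst_diff emb_diff Cst_1 emb_1
    by (simp add: emb_T0 algebra_simps)
  finally show ?thesis by (simp only: emb_eq_iff)
qed

lemma poly_T_commute:
  assumes "i + 1 < j"
  shows "poly_T i (poly_T j f) = poly_T j (poly_T i f)"
proof -
  have "emb (poly_T i (poly_T j f)) = emb (poly_T j (poly_T i f))"
    using assms
    by (simp add: emb_T0 emb_T1 swap_vars_Var swap_commute[OF assms] algebra_simps)
  then show ?thesis by (simp only: emb_eq_iff)
qed

lemma poly_T_braid:
  "poly_T i (poly_T (i + 1) (poly_T i f)) = poly_T (i + 1) (poly_T i (poly_T (i + 1) f))"
proof -
  let ?q = "emb (Cst qvar)"
  define a b c where abc: "a = emb (Var i)" "b = emb (Var (i + 1))" "c = emb (Var (i + 2))"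
  have ne: "a - b \<noteq> 0" "b - a \<noteq> 0" "b - c \<noteq> 0" "c - b \<noteq> 0" "a - c \<noteq> 0"
    by (simp_all add: abc emb_eq_iff)
  have c0: "coefA a b * coefA b c * coefA a b + coefB a b * coefA a c * coefB b a =
    coefA b c * coefA a b * coefA b c + coefB b c * coefA a c * coefB c b"
    using ne unfolding coefA_def coefB_def by (simp add: divide_simps, simp add: algebra_simps)
  have c1: "coefA a b * coefA b c * coefB a b + coefB a b * coefA a c * coefA b a =
    coefA b c * coefB a b * coefA a c"
    using ne unfolding coefA_def coefB_def by (simp add: divide_simps, simp add: algebra_simps)
  have c2: "coefA a b * coefB b c * coefA a c =
    coefA b c * coefA a b * coefB b c + coefB b c * coefA a c * coefA c b"
    using ne unfolding coefA_def coefB_def by (simp add: divide_simps, simp add: algebra_simps)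
  let ?s = "swap_vars i" and ?t = "swap_vars (i + 1)"
  have "emb (poly_T i (poly_T (i + 1) (poly_T i f))) =
     (coefA a b * coefA b c * coefA a b + coefB a b * coefA a c * coefB b a) * emb f
     + (coefA a b * coefA b c * coefB a b + coefB a b * coefA a c * coefA b a) * emb (?s f)
     + (coefA a b * coefB b c * coefA a c) * emb (?t f)
     + coefA a b * coefB b c * coefB a c * emb (?t (?s f))
     + coefB a b * coefB a c * coefA b c * emb (?s (?t f))
     + coefB a b * coefB a c * coefB b c * emb (?s (?t (?s f)))"
    by (simp add: emb_T0 emb_T1 emb_T2 swap_vars_Var transpose_def abc algebra_simps)
  also have "\<dots> = (coefA b c * coefA a b * coefA b c + coefB b c * coefA a c * coefB c b) * emb f
     + (coefA b c * coefB a b * coefA a c) * emb (?s f)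
     + (coefA b c * coefA a b * coefB b c + coefB b c * coefA a c * coefA c b) * emb (?t f)
     + coefA a b * coefB b c * coefB a c * emb (?t (?s f))
     + coefB a b * coefB a c * coefA b c * emb (?s (?t f))
     + coefB a b * coefB a c * coefB b c * emb (?t (?s (?t f)))"
    unfolding c0 c1 c2 swap_braid ..
  also have "\<dots> = emb (poly_T (i + 1) (poly_T i (poly_T (i + 1) f)))"
    by (simp add: emb_T0 emb_T1 emb_T2 swap_vars_Var transpose_def abc algebra_simps)
  finally show ?thesis by (simp only: emb_eq_iff)
qed

end


section \<open>Left modules\<close>

text \<open>
  All module axioms of the quotient are inherited along the injection into the target.
\<close>

lemma left_module_isomorphic_quotient_kernel:
  fixes R (structure) and M :: "('r, 'a, 't) module_scheme" and M' :: "('r, 'b, 'u) module_scheme"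
  assumes M: "left_module R M" and M': "left_module R M'"
    and closed: "\<And>x. x \<in> carrier M \<Longrightarrow> \<phi> x \<in> carrier M'"
    and add: "\<And>x y. \<lbrakk>x \<in> carrier M; y \<in> carrier M\<rbrakk> \<Longrightarrow> \<phi> (x \<oplus>\<^bsub>M\<^esub> y) = \<phi> x \<oplus>\<^bsub>M'\<^esub> \<phi> y"
    and smult: "\<And>a x. \<lbrakk>a \<in> carrier R; x \<in> carrier M\<rbrakk> \<Longrightarrow> \<phi> (a \<odot>\<^bsub>M\<^esub> x) = a \<odot>\<^bsub>M'\<^esub> \<phi> x"
    and surj: "\<And>y. y \<in> carrier M' \<Longrightarrow> \<exists>x\<in>carrier M. \<phi> x = y"
    and N: "N = {x \<in> carrier M. \<phi> x = \<zero>\<^bsub>M'\<^esub>}"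
  shows "left_module_isomorphic R (quotient_module M N) M'"
proof -
  interpret M: left_module R M by fact
  interpret M': left_module R M' by fact
  define fib where "fib x = {y \<in> carrier M. \<phi> y = \<phi> x}" for x
  let ?Q = "quotient_module M N"
  have zero: "\<phi> \<zero>\<^bsub>M\<^esub> = \<zero>\<^bsub>M'\<^esub>"
    using add[of "\<zero>\<^bsub>M\<^esub>" "\<zero>\<^bsub>M\<^esub>"] closed[of "\<zero>\<^bsub>M\<^esub>"] by simp
  have neg: "\<phi> (\<ominus>\<^bsub>M\<^esub> x) = \<ominus>\<^bsub>M'\<^esub> \<phi> x" if "x \<in> carrier M" for x
    using add[of "\<ominus>\<^bsub>M\<^esub> x" x] that closed zero
    by (metis M'.M.minus_equality M.M.add.inv_closed M.M.l_neg)
  have coset: "N +>\<^bsub>M\<^esub> x = fib x" if x: "x \<in> carrier M" for x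
  proof (intro equalityI subsetI)
    fix y assume "y \<in> N +>\<^bsub>M\<^esub> x"
    then show "y \<in> fib x"
      using x closed by (auto simp: a_r_coset_def' N fib_def add)
  next
    fix y assume y: "y \<in> fib x"
    then have "y \<oplus>\<^bsub>M\<^esub> (\<ominus>\<^bsub>M\<^esub> x) \<in> N"
      using x closed by (auto simp: N fib_def add neg M'.M.r_neg)
    moreover have "y = (y \<oplus>\<^bsub>M\<^esub> (\<ominus>\<^bsub>M\<^esub> x)) \<oplus>\<^bsub>M\<^esub> x"
      using x y by (simp add: fib_def M.M.a_assoc M.M.l_neg)
    ultimately show "y \<in> N +>\<^bsub>M\<^esub> x"
      by (auto simp: a_r_coset_def')
  qed
  have carr: "carrier ?Q = fib ` carrier M"
    by (auto simp: quotient_module_def FactRing_def A_RCOSETS_def' coset)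
  have fib_eq: "fib x = fib y \<longleftrightarrow> \<phi> x = \<phi> y" if "x \<in> carrier M" "y \<in> carrier M" for x y
    using that by (auto simp: fib_def)
  have Qadd: "fib x \<oplus>\<^bsub>?Q\<^esub> fib y = fib (x \<oplus>\<^bsub>M\<^esub> y)" if x: "x \<in> carrier M" and y: "y \<in> carrier M" for x y
  proof -
    have "fib x <+>\<^bsub>M\<^esub> fib y = fib (x \<oplus>\<^bsub>M\<^esub> y)"
    proof (intro equalityI subsetI)
      fix z assume "z \<in> fib x <+>\<^bsub>M\<^esub> fib y"
      then show "z \<in> fib (x \<oplus>\<^bsub>M\<^esub> y)"
        using x y by (auto simp: set_add_def' fib_def add)
    next
      fix z assume z: "z \<in> fib (x \<oplus>\<^bsub>M\<^esub> y)"
      then have "z \<oplus>\<^bsub>M\<^esub> (\<ominus>\<^bsub>M\<^esub> y) \<in> fib x"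
        using x y closed by (simp add: fib_def add neg M'.M.a_assoc M'.M.r_neg)
      moreover have "z = (z \<oplus>\<^bsub>M\<^esub> (\<ominus>\<^bsub>M\<^esub> y)) \<oplus>\<^bsub>M\<^esub> y" "y \<in> fib y"
        using y z by (simp_all add: fib_def M.M.a_assoc M.M.l_neg)
      ultimately show "z \<in> fib x <+>\<^bsub>M\<^esub> fib y"
        unfolding set_add_def' by blast
    qed
    then show ?thesis by (simp add: quotient_module_def FactRing_def)
  qed
  have Qsmult: "a \<odot>\<^bsub>?Q\<^esub> fib x = fib (a \<odot>\<^bsub>M\<^esub> x)" if a: "a \<in> carrier R" and x: "x \<in> carrier M" for a x
  proof -
    have "(\<Union>z\<in>fib x. N +>\<^bsub>M\<^esub> (a \<odot>\<^bsub>M\<^esub> z)) = (\<Union>z\<in>fib x. fib (a \<odot>\<^bsub>M\<^esub> x))"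
    proof (rule SUP_cong)
      fix z assume "z \<in> fib x"
      then show "N +>\<^bsub>M\<^esub> (a \<odot>\<^bsub>M\<^esub> z) = fib (a \<odot>\<^bsub>M\<^esub> x)"
        using a x by (subst coset) (auto simp: fib_def M.smult_closed smult)
    qed simp
    also have "\<dots> = fib (a \<odot>\<^bsub>M\<^esub> x)"
      using x by (auto simp: fib_def)
    finally show ?thesis by (simp add: quotient_module_def)
  qed
  have Qzero: "\<zero>\<^bsub>?Q\<^esub> = fib \<zero>\<^bsub>M\<^esub>"
    by (simp add: quotient_module_def FactRing_def N fib_def zero)
  define \<Phi> where "\<Phi> C = the_elem (\<phi> ` C)" for C
  have \<Phi>: "\<Phi> (fib x) = \<phi> x" if "x \<in> carrier M" for x
  proof -
    have "\<phi> ` fib x = {\<phi> x}" using that by (auto simp: fib_def)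
    then show ?thesis by (simp add: \<Phi>_def)
  qed
  have "abelian_group ?Q"
  proof (rule abelian_groupI)
    fix X assume "X \<in> carrier ?Q"
    then obtain x where x: "x \<in> carrier M" "X = fib x" by (auto simp: carr)
    then show "\<exists>Y\<in>carrier ?Q. Y \<oplus>\<^bsub>?Q\<^esub> X = \<zero>\<^bsub>?Q\<^esub>"
      by (intro bexI[of _ "fib (\<ominus>\<^bsub>M\<^esub> x)"]) (simp_all add: Qadd Qzero M.M.l_neg carr)
  next
    fix X Y Z assume "X \<in> carrier ?Q" "Y \<in> carrier ?Q" "Z \<in> carrier ?Q"
    then show "X \<oplus>\<^bsub>?Q\<^esub> Y \<oplus>\<^bsub>?Q\<^esub> Z = X \<oplus>\<^bsub>?Q\<^esub> (Y \<oplus>\<^bsub>?Q\<^esub> Z)"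
      by (auto simp: carr Qadd M.M.a_assoc)
  next
    fix X Y assume "X \<in> carrier ?Q" "Y \<in> carrier ?Q"
    then show "X \<oplus>\<^bsub>?Q\<^esub> Y = Y \<oplus>\<^bsub>?Q\<^esub> X"
      by (auto simp: carr Qadd M.M.a_comm)
  qed (auto simp: carr Qadd Qzero)
  moreover have "left_module_axioms R ?Q"
    by unfold_locales
      (auto simp: carr Qadd Qsmult M.smult_closed M.smult_l_distr M.smult_r_distr
        M.smult_assoc M.smult_one)
  ultimately have "left_module R ?Q"
    using M by (simp add: left_module_def)
  moreover have "left_module_iso_map R ?Q M' \<Phi>"
    unfolding left_module_iso_map_def
  proof (intro conjI ballI)
    show "bij_betw \<Phi> (carrier ?Q) (carrier M')"
      unfolding bij_betw_def
    proof
      show "inj_on \<Phi> (carrier ?Q)"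
        by (auto simp: inj_on_def carr \<Phi> fib_eq)
      show "\<Phi> ` carrier ?Q = carrier M'"
        using surj by (force simp: carr image_image \<Phi> closed)
    qed
  qed (auto simp: carr Qadd Qsmult \<Phi> add smult M.smult_closed)
  ultimately show ?thesis
    using M' by (auto simp: left_module_isomorphic_def)
qed


section \<open>Representations of the Hecke algebra\<close>

subsection \<open>The free algebra\<close>

lemma letters_simps [simp]: "letters 0 = []" "letters (u + v) = letters u @ letters v"
  by (simp_all add: zero_word_def plus_word_def)

lemma free_algebra_simps [simp]:
  "mult (free_algebra n) = (*)" "one (free_algebra n) = 1"
  "zero (free_algebra n) = 0" "add (free_algebra n) = (+)"
  by (simp_all add: free_algebra_def)

lemma free_algebra_carrier:
  "a \<in> carrier (free_algebra n) \<longleftrightarrow> (\<forall>w\<in>keys a. set (letters w) \<subseteq> {1..<n})"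
  by (simp add: free_algebra_def)

lemma free_algebra_add_closed:
  "a \<in> carrier (free_algebra n) \<Longrightarrow> b \<in> carrier (free_algebra n) \<Longrightarrow> a + b \<in> carrier (free_algebra n)"
  unfolding free_algebra_carrier using keys_add[of a b] by blast

lemma free_algebra_mult_closed:
  assumes "a \<in> carrier (free_algebra n)" "b \<in> carrier (free_algebra n)"
  shows "a * b \<in> carrier (free_algebra n)"
  unfolding free_algebra_carrier
proof
  fix w assume "w \<in> keys (a * b)"
  then obtain u v where "w = u + v" "u \<in> keys a" "v \<in> keys b"
    using keys_mult[of a b] by auto
  then show "set (letters w) \<subseteq> {1..<n}"
    using assms by (auto simp: free_algebra_carrier)
qed

lemma free_algebra_uminus_closed:
  "a \<in> carrier (free_algebra n) \<Longrightarrow> - a \<in> carrier (free_algebra n)"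
  by (simp add: free_algebra_carrier in_keys_iff)

lemma free_algebra_1_closed: "1 \<in> carrier (free_algebra n)"
  by (simp add: free_algebra_carrier)

lemma free_algebra_scale_closed:
  "a \<in> carrier (free_algebra n) \<Longrightarrow> scale c a \<in> carrier (free_algebra n)"
  by (simp add: free_algebra_carrier in_keys_iff)

lemma gen_closed: "1 \<le> i \<Longrightarrow> i < n \<Longrightarrow> gen i \<in> carrier (free_algebra n)"
  by (simp add: free_algebra_carrier gen_def)

lemma ring_free_algebra: "ring (free_algebra n)"
proof (rule ringI)
  show "abelian_group (free_algebra n)"
  proof (rule abelian_groupI)
    fix a assume "a \<in> carrier (free_algebra n)"
    then show "\<exists>b\<in>carrier (free_algebra n). b \<oplus>\<^bsub>free_algebra n\<^esub> a = \<zero>\<^bsub>free_algebra n\<^esub>"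
      by (intro bexI[of _ "- a"]) (simp_all add: free_algebra_uminus_closed)
  qed (simp_all add: free_algebra_add_closed add_ac, simp add: free_algebra_carrier)
  show "monoid (free_algebra n)"
    by (rule monoidI) (simp_all add: free_algebra_mult_closed free_algebra_1_closed mult.assoc)
qed (simp_all add: distrib_left distrib_right)

lemma hecke_relators_closed: "hecke_relators n \<subseteq> carrier (free_algebra n)"
proof -
  have diff: "a - b \<in> carrier (free_algebra n)"
    if "a \<in> carrier (free_algebra n)" "b \<in> carrier (free_algebra n)" for a b
    using free_algebra_add_closed[OF that(1) free_algebra_uminus_closed[OF that(2)]] by simp
  show ?thesis
    unfolding hecke_relators_def
    by (auto intro!: diff free_algebra_mult_closed free_algebra_add_closed gen_closed
        free_algebra_1_closed free_algebra_scale_closed simp del: Suc_eq_plus1)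
qed

lemma ideal_hecke: "ideal (Idl\<^bsub>free_algebra n\<^esub> (hecke_relators n)) (free_algebra n)"
  by (rule ring.genideal_ideal[OF ring_free_algebra hecke_relators_closed])

lemma ring_hecke_algebra: "ring (hecke_algebra n)"
  unfolding hecke_algebra_def by (rule ideal.quotient_is_ring[OF ideal_hecke])

lemma hecke_algebra_cases:
  assumes "C \<in> carrier (hecke_algebra n)"
  obtains a where "a \<in> carrier (free_algebra n)"
    "C = Idl\<^bsub>free_algebra n\<^esub> (hecke_relators n) +>\<^bsub>free_algebra n\<^esub> a"
  using assms by (auto simp: hecke_algebra_def FactRing_def A_RCOSETS_def')


subsection \<open>Action of the free algebra\<close>

lemma free_act_eq_lin_ext: "free_act T a v = lin_ext (\<lambda>w. foldr T (letters w) v) a"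
  by (simp add: free_act_def lin_ext_def)

lemma free_act_add_left: "free_act T (a + b) v = free_act T a v + free_act T b v"
  and free_act_scale_left: "free_act T (scale c a) v = scale c (free_act T a v)"
  and free_act_diff_left: "free_act T (a - b) v = free_act T a v - free_act T b v"
  and free_act_0_left: "free_act T 0 v = 0"
  using linmap_lin_ext[of "\<lambda>w. foldr T (letters w) v"]
  by (simp_all add: free_act_eq_lin_ext linmap_simps)

lemma free_act_1: "free_act T 1 v = v"
proof -
  have "free_act T (single 0 1) v = v"
    by (simp only: free_act_eq_lin_ext lin_ext_single) simp
  then show ?thesis by simp
qed

lemma free_act_gen: "free_act T (gen i) v = T i v"
  by (simp add: free_act_eq_lin_ext gen_def)

lemma linmap_foldr:
  assumes "\<And>i. linmap (T i)"
  shows "linmap (\<lambda>v. foldr T ws v)"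
proof (induction ws)
  case Nil
  show ?case by (simp add: linmapI)
next
  case (Cons i ws)
  show ?case
    by (rule linmapI) (simp_all add: linmap_simps[OF Cons] linmap_simps[OF assms])
qed

lemma linmap_free_act:
  assumes "\<And>i. linmap (T i)"
  shows "linmap (free_act T a)"
proof (rule linmapI)
  show "free_act T a (u + v) = free_act T a u + free_act T a v" for u v
    by (simp add: free_act_def linmap_simps[OF linmap_foldr[OF assms]] VS.scale_right_distrib
        sum.distrib)
  show "free_act T a (scale c v) = scale c (free_act T a v)" for c v
    by (simp add: free_act_def linmap_simps[OF linmap_foldr[OF assms]] VS.scale_sum_right mult.commute)
qed

lemma free_act_mult:
  assumes "\<And>i. linmap (T i)"
  shows "free_act T (a * b) v = free_act T a (free_act T b v)"
proof (induction a rule: poly_mapping_induct)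
  case (single u c)
  show ?case
  proof (induction b rule: poly_mapping_induct)
    case (single w d)
    show ?case
      by (simp add: mult_single free_act_eq_lin_ext linmap_simps[OF linmap_foldr[OF assms]])
  next
    case (add f g)
    then show ?case
      by (simp add: distrib_left free_act_add_left linmap_simps[OF linmap_free_act[OF assms]])
  qed
next
  case (add f g)
  then show ?case
    by (simp add: distrib_right free_act_add_left)
qed


subsection \<open>Operators satisfying the Hecke relations\<close>

locale hecke_rep =
  fixes n :: nat and T :: "nat \<Rightarrow> ('b \<Rightarrow>\<^sub>0 ratfun) \<Rightarrow> ('b \<Rightarrow>\<^sub>0 ratfun)" and V :: "('b \<Rightarrow>\<^sub>0 ratfun) set"
  assumes linear_T: "\<And>i. linmap (T i)"
    and subspace_V: "VS.subspace V"
    and T_closed: "\<And>i v. \<lbrakk>1 \<le> i; i < n; v \<in> V\<rbrakk> \<Longrightarrow> T i v \<in> V"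
    and quadratic: "\<And>i v. \<lbrakk>1 \<le> i; i < n; v \<in> V\<rbrakk> \<Longrightarrow>
          T i (T i v) = scale (qvar - 1) (T i v) + scale qvar v"
    and commute: "\<And>i j v. \<lbrakk>1 \<le> i; i + 1 < j; j < n; v \<in> V\<rbrakk> \<Longrightarrow> T i (T j v) = T j (T i v)"
    and braid: "\<And>i v. \<lbrakk>1 \<le> i; i + 1 < n; v \<in> V\<rbrakk> \<Longrightarrow>
          T i (T (i + 1) (T i v)) = T (i + 1) (T i (T (i + 1) v))"
begin

lemma foldr_closed: "set ws \<subseteq> {1..<n} \<Longrightarrow> v \<in> V \<Longrightarrow> foldr T ws v \<in> V"
  by (induction ws) (auto intro: T_closed)

lemma free_act_closed:
  "a \<in> carrier (free_algebra n) \<Longrightarrow> v \<in> V \<Longrightarrow> free_act T a v \<in> V"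
  unfolding free_act_def free_algebra_carrier
  by (intro VS.subspace_sum[OF subspace_V] VS.subspace_scale[OF subspace_V] foldr_closed) auto

lemma relator_act:
  assumes "r \<in> hecke_relators n" "v \<in> V"
  shows "free_act T r v = 0"
proof -
  note [simp] = free_act_add_left free_act_diff_left free_act_scale_left free_act_1 free_act_gen
    free_act_mult[OF linear_T]
  consider (relq) i where "r = (gen i + 1) * (gen i - scale qvar 1)" "1 \<le> i" "i < n"
    | (relc) i j where "r = gen i * gen j - gen j * gen i"
      "1 \<le> i" "i < n" "1 \<le> j" "j < n" "\<bar>int i - int j\<bar> > 1"
    | (relb) i where
      "r = gen i * gen (i + 1) * gen i - gen (i + 1) * gen i * gen (i + 1)" "1 \<le> i" "i + 1 < n"
    using assms(1) unfolding hecke_relators_def Un_iff mem_Collect_eq by (elim disjE exE conjE)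
  then show ?thesis
  proof cases
    case relq
    then show ?thesis
      using quadratic[of i v] assms(2)
      by (simp add: linmap_simps[OF linear_T] VS.scale_left_diff_distrib)
  next
    case relc
    then have "i + 1 < j \<or> j + 1 < i" by linarith
    then show ?thesis
      using relc commute[of i j v] commute[of j i v] assms(2) by auto
  next
    case relb
    then show ?thesis
      using braid[of i v] assms(2) by simp
  qed
qed

text \<open>
  The elements that act as zero form a two-sided ideal; closure under right multiplication
  uses that \<open>V\<close> is stable.
\<close>

lemma ideal_act:
  assumes "a \<in> Idl\<^bsub>free_algebra n\<^esub> (hecke_relators n)" "v \<in> V"
  shows "free_act T a v = 0"
proof -
  interpret A: ring "free_algebra n" by (rule ring_free_algebra)
  define K where "K = {a \<in> carrier (free_algebra n). \<forall>v\<in>V. free_act T a v = 0}"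
  have "ideal K (free_algebra n)"
  proof (rule idealI)
    show "subgroup K (add_monoid (free_algebra n))"
    proof (rule A.add.subgroupI)
      fix a assume a: "a \<in> K"
      have "\<ominus>\<^bsub>free_algebra n\<^esub> a = - a"
        using a by (intro A.minus_equality) (auto simp: K_def free_algebra_uminus_closed)
      moreover have "- a \<in> K"
        using a free_act_diff_left[of T 0 a]
        by (auto simp: K_def free_algebra_uminus_closed free_act_0_left)
      ultimately show "\<ominus>\<^bsub>free_algebra n\<^esub> a \<in> K"
        by (simp only:)
    next
      have "0 \<in> K" by (simp add: K_def free_act_0_left free_algebra_carrier)
      then show "K \<noteq> {}" by blast
    qed (auto simp: K_def free_act_add_left free_algebra_add_closed)
    fix a x assume a: "a \<in> K" and x: "x \<in> carrier (free_algebra n)"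
    show "x \<otimes>\<^bsub>free_algebra n\<^esub> a \<in> K"
      using a x by (auto simp: K_def free_algebra_mult_closed free_act_mult[OF linear_T]
          linmap_simps[OF linmap_free_act[OF linear_T]])
    show "a \<otimes>\<^bsub>free_algebra n\<^esub> x \<in> K"
      using a x by (auto simp: K_def free_algebra_mult_closed free_act_mult[OF linear_T] free_act_closed)
  qed (rule ring_free_algebra)
  moreover have "hecke_relators n \<subseteq> K"
    using hecke_relators_closed relator_act by (auto simp: K_def)
  ultimately have "Idl\<^bsub>free_algebra n\<^esub> (hecke_relators n) \<subseteq> K"
    by (rule A.genideal_minimal)
  then show ?thesis using assms by (auto simp: K_def)
qed

lemma hecke_act_coset:
  assumes "a \<in> carrier (free_algebra n)" "v \<in> V"
  shows "hecke_act T (Idl\<^bsub>free_algebra n\<^esub> (hecke_relators n) +>\<^bsub>free_algebra n\<^esub> a) v = free_act T a v"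
proof -
  interpret I: ideal "Idl\<^bsub>free_algebra n\<^esub> (hecke_relators n)" "free_algebra n"
    by (rule ideal_hecke)
  have "(\<lambda>a. free_act T a v) ` (Idl\<^bsub>free_algebra n\<^esub> (hecke_relators n) +>\<^bsub>free_algebra n\<^esub> a)
      = {free_act T a v}"
  proof
    show "(\<lambda>a. free_act T a v) ` (Idl\<^bsub>free_algebra n\<^esub> (hecke_relators n) +>\<^bsub>free_algebra n\<^esub> a)
        \<subseteq> {free_act T a v}"
      using assms by (auto simp: a_r_coset_def' free_act_add_left ideal_act)
    show "{free_act T a v} \<subseteq>
        (\<lambda>a. free_act T a v) ` (Idl\<^bsub>free_algebra n\<^esub> (hecke_relators n) +>\<^bsub>free_algebra n\<^esub> a)"
      using I.a_rcos_self[OF assms(1)] by blast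
  qed
  then show ?thesis by (simp add: hecke_act_def)
qed

lemma left_module:
  assumes "carrier M = V" "zero M = 0" "add M = (+)" "smult M = hecke_act T"
  shows "left_module (hecke_algebra n) M"
proof -
  interpret I: ideal "Idl\<^bsub>free_algebra n\<^esub> (hecke_relators n)" "free_algebra n"
    by (rule ideal_hecke)
  have zero: "0 \<in> V" and plus: "\<And>u v. u \<in> V \<Longrightarrow> v \<in> V \<Longrightarrow> u + v \<in> V"
    and neg: "\<And>v. v \<in> V \<Longrightarrow> - v \<in> V"
    using subspace_V by (auto simp: VS.subspace_0 VS.subspace_add VS.subspace_neg)
  have abel: "abelian_group M"
  proof (rule abelian_groupI)
    fix x assume "x \<in> carrier M"
    then show "\<exists>y\<in>carrier M. y \<oplus>\<^bsub>M\<^esub> x = \<zero>\<^bsub>M\<^esub>"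
      by (intro bexI[of _ "- x"]) (simp_all add: assms neg)
  qed (simp_all add: assms zero plus add_ac)
  show ?thesis
  proof (intro left_module.intro abel ring_hecke_algebra left_module_axioms.intro)
    fix C x assume C: "C \<in> carrier (hecke_algebra n)" and x: "x \<in> carrier M"
    from C obtain a where a: "a \<in> carrier (free_algebra n)"
      "C = Idl\<^bsub>free_algebra n\<^esub> (hecke_relators n) +>\<^bsub>free_algebra n\<^esub> a"
      by (rule hecke_algebra_cases)
    then show "C \<odot>\<^bsub>M\<^esub> x \<in> carrier M"
      using x by (simp add: assms hecke_act_coset free_act_closed)
    fix y assume y: "y \<in> carrier M"
    then show "C \<odot>\<^bsub>M\<^esub> (x \<oplus>\<^bsub>M\<^esub> y) = C \<odot>\<^bsub>M\<^esub> x \<oplus>\<^bsub>M\<^esub> C \<odot>\<^bsub>M\<^esub> y"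
      using x a
      by (simp add: assms hecke_act_coset plus linmap_simps[OF linmap_free_act[OF linear_T]])
  next
    fix C D x assume C: "C \<in> carrier (hecke_algebra n)" and D: "D \<in> carrier (hecke_algebra n)"
      and x: "x \<in> carrier M"
    from C obtain a where a: "a \<in> carrier (free_algebra n)"
      "C = Idl\<^bsub>free_algebra n\<^esub> (hecke_relators n) +>\<^bsub>free_algebra n\<^esub> a"
      by (rule hecke_algebra_cases)
    from D obtain b where b: "b \<in> carrier (free_algebra n)"
      "D = Idl\<^bsub>free_algebra n\<^esub> (hecke_relators n) +>\<^bsub>free_algebra n\<^esub> b"
      by (rule hecke_algebra_cases)
    have "C \<oplus>\<^bsub>hecke_algebra n\<^esub> D =
        Idl\<^bsub>free_algebra n\<^esub> (hecke_relators n) +>\<^bsub>free_algebra n\<^esub> (a + b)"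
      using I.a_rcos_sum[OF a(1) b(1)] by (simp add: a b hecke_algebra_def FactRing_def)
    then show "(C \<oplus>\<^bsub>hecke_algebra n\<^esub> D) \<odot>\<^bsub>M\<^esub> x = C \<odot>\<^bsub>M\<^esub> x \<oplus>\<^bsub>M\<^esub> D \<odot>\<^bsub>M\<^esub> x"
      using x a b by (simp add: assms hecke_act_coset free_algebra_add_closed free_act_add_left)
    have "C \<otimes>\<^bsub>hecke_algebra n\<^esub> D =
        Idl\<^bsub>free_algebra n\<^esub> (hecke_relators n) +>\<^bsub>free_algebra n\<^esub> (a * b)"
      using I.rcoset_mult_add[OF a(1) b(1)] by (simp add: a b hecke_algebra_def FactRing_def)
    then show "(C \<otimes>\<^bsub>hecke_algebra n\<^esub> D) \<odot>\<^bsub>M\<^esub> x = C \<odot>\<^bsub>M\<^esub> (D \<odot>\<^bsub>M\<^esub> x)"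
      using x a b
      by (simp add: assms hecke_act_coset free_algebra_mult_closed free_act_mult[OF linear_T] free_act_closed)
  next
    fix x assume "x \<in> carrier M"
    moreover have "\<one>\<^bsub>hecke_algebra n\<^esub> =
        Idl\<^bsub>free_algebra n\<^esub> (hecke_relators n) +>\<^bsub>free_algebra n\<^esub> 1"
      by (simp add: hecke_algebra_def FactRing_def)
    ultimately show "\<one>\<^bsub>hecke_algebra n\<^esub> \<odot>\<^bsub>M\<^esub> x = x"
      by (simp add: assms hecke_act_coset free_algebra_1_closed free_act_1)
  qed
qed

end

lemma hecke_act_intertwine:
  assumes "hecke_rep n T V" "hecke_rep n T' V'" and lin: "linmap \<phi>"
    and closed: "\<And>v. v \<in> V \<Longrightarrow> \<phi> v \<in> V'"
    and comm: "\<And>i v. \<lbrakk>1 \<le> i; i < n; v \<in> V\<rbrakk> \<Longrightarrow> \<phi> (T i v) = T' i (\<phi> v)"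
    and C: "C \<in> carrier (hecke_algebra n)" and v: "v \<in> V"
  shows "\<phi> (hecke_act T C v) = hecke_act T' C (\<phi> v)"
proof -
  interpret V: hecke_rep n T V by fact
  interpret V': hecke_rep n T' V' by fact
  have word: "\<phi> (foldr T ws v) = foldr T' ws (\<phi> v)" if "set ws \<subseteq> {1..<n}" for ws
    using that
  proof (induction ws)
    case (Cons i ws)
    then show ?case
      using comm[of i "foldr T ws v"] V.foldr_closed[of ws v] v by simp
  qed simp
  from C obtain a where a: "a \<in> carrier (free_algebra n)"
    "C = Idl\<^bsub>free_algebra n\<^esub> (hecke_relators n) +>\<^bsub>free_algebra n\<^esub> a"
    by (rule hecke_algebra_cases)
  have "\<phi> (free_act T a v) = free_act T' a (\<phi> v)"
    using a(1) unfolding free_act_def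
    by (simp add: linmap_simps[OF lin] free_algebra_carrier word)
  then show ?thesis
    using a v closed by (simp add: V.hecke_act_coset V'.hecke_act_coset)
qed


text \<open>Index sets stay in the form \<open>{1..n}\<close>.\<close>

declare One_nat_def [simp del]

section \<open>Ideals of the polynomial ring\<close>

lemma poly_ring_simps [simp]:
  "carrier (poly_ring n) = polys {1..n}"
  "mult (poly_ring n) = (*)" "one (poly_ring n) = 1"
  "zero (poly_ring n) = 0" "add (poly_ring n) = (+)"
  by (simp_all add: poly_ring_def polys_def)

lemma ring_poly_ring: "ring (poly_ring n)"
proof (rule ringI)
  show "abelian_group (poly_ring n)"
  proof (rule abelian_groupI)
    fix a assume "a \<in> carrier (poly_ring n)"
    then show "\<exists>b\<in>carrier (poly_ring n). b \<oplus>\<^bsub>poly_ring n\<^esub> a = \<zero>\<^bsub>poly_ring n\<^esub>"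
      by (intro bexI[of _ "- a"]) (simp_all add: polys_uminus)
  qed (simp_all add: polys_add add_ac)
  show "monoid (poly_ring n)"
    by (rule monoidI) (simp_all add: polys_mult mult_ac)
qed (simp_all add: distrib_left distrib_right)

text \<open>
  The ideal as an additive closure, which provides rule induction over its elements and lets the
  variable set be any set.
\<close>

inductive_set gen_ideal :: "nat set \<Rightarrow> mpoly set \<Rightarrow> mpoly set" for A G where
  zero: "0 \<in> gen_ideal A G"
| gen: "\<lbrakk>h \<in> polys A; g \<in> G\<rbrakk> \<Longrightarrow> h * g \<in> gen_ideal A G"
| add: "\<lbrakk>f \<in> gen_ideal A G; f' \<in> gen_ideal A G\<rbrakk> \<Longrightarrow> f + f' \<in> gen_ideal A G"

lemma gen_ideal_gen: "g \<in> G \<Longrightarrow> g \<in> gen_ideal A G"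
  using gen_ideal.gen[of 1 A g G] by simp

lemma gen_ideal_mult:
  assumes "f \<in> gen_ideal A G" "h \<in> polys A"
  shows "h * f \<in> gen_ideal A G"
  using assms(1)
proof induction
  case (gen h' g)
  then have "h * h' * g \<in> gen_ideal A G"
    by (intro gen_ideal.gen polys_mult assms)
  then show ?case by (simp add: mult.assoc)
qed (auto simp: distrib_left intro: gen_ideal.intros)

lemma gen_ideal_subset:
  assumes "G \<subseteq> polys A"
  shows "gen_ideal A G \<subseteq> polys A"
proof
  fix f assume "f \<in> gen_ideal A G"
  then show "f \<in> polys A"
    using assms by induction (auto intro: polys_add polys_mult)
qed

lemma gen_ideal_scale: "f \<in> gen_ideal A G \<Longrightarrow> scale c f \<in> gen_ideal A G"
  by (simp add: scale_eq_Cst gen_ideal_mult)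

lemma gen_ideal_diff: "f \<in> gen_ideal A G \<Longrightarrow> g \<in> gen_ideal A G \<Longrightarrow> f - g \<in> gen_ideal A G"
  using gen_ideal.add[of f A G "scale (-1) g"] gen_ideal_scale[of g A G "-1"] by simp

lemma subspace_gen_ideal: "VS.subspace (gen_ideal A G)"
  by (simp add: VS.subspace_def gen_ideal.zero gen_ideal.add gen_ideal_scale)

lemma genideal_eq_gen_ideal:
  assumes G: "G \<subseteq> polys {1..n}"
  shows "Idl\<^bsub>poly_ring n\<^esub> G = gen_ideal {1..n} G"
proof (intro equalityI subsetI)
  interpret R: ring "poly_ring n" by (rule ring_poly_ring)
  interpret I: ideal "Idl\<^bsub>poly_ring n\<^esub> G" "poly_ring n"
    by (rule R.genideal_ideal) (simp add: G)
  fix f assume "f \<in> gen_ideal {1..n} G"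
  then show "f \<in> Idl\<^bsub>poly_ring n\<^esub> G"
  proof induction
    case zero
    then show ?case using I.zero_closed by simp
  next
    case (gen h g)
    then show ?case
      using I.I_l_closed[of g h] R.genideal_self[of G] G by auto
  next
    case (add f f')
    then show ?case using I.a_closed[of f f'] by simp
  qed
next
  interpret R: ring "poly_ring n" by (rule ring_poly_ring)
  have sub: "gen_ideal {1..n} G \<subseteq> polys {1..n}"
    by (rule gen_ideal_subset[OF G])
  have "ideal (gen_ideal {1..n} G) (poly_ring n)"
  proof (rule idealI)
    show "subgroup (gen_ideal {1..n} G) (add_monoid (poly_ring n))"
    proof (rule R.add.subgroupI)
      fix a assume a: "a \<in> gen_ideal {1..n} G"
      have "\<ominus>\<^bsub>poly_ring n\<^esub> a = - a"
        using a sub by (intro R.minus_equality) (auto simp: polys_uminus)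
      then show "\<ominus>\<^bsub>poly_ring n\<^esub> a \<in> gen_ideal {1..n} G"
        using gen_ideal_diff[OF gen_ideal.zero a] by simp
    next
      show "gen_ideal {1..n} G \<noteq> {}" using gen_ideal.zero by blast
    qed (use sub in \<open>auto intro: gen_ideal.add\<close>)
    show "a \<otimes>\<^bsub>poly_ring n\<^esub> x \<in> gen_ideal {1..n} G"
      if "a \<in> gen_ideal {1..n} G" "x \<in> carrier (poly_ring n)" for a x
      using gen_ideal_mult[of a _ G x] that by (simp add: mult.commute)
  qed (auto simp: ring_poly_ring intro: gen_ideal_mult)
  moreover have "G \<subseteq> gen_ideal {1..n} G"
    by (auto intro: gen_ideal_gen)
  ultimately have "Idl\<^bsub>poly_ring n\<^esub> G \<subseteq> gen_ideal {1..n} G"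
    by (rule R.genideal_minimal)
  then show "f \<in> Idl\<^bsub>poly_ring n\<^esub> G \<Longrightarrow> f \<in> gen_ideal {1..n} G" for f by blast
qed


section \<open>Hall-Littlewood and elementary symmetric polynomials\<close>

subsection \<open>Ring homomorphisms on power series\<close>

locale comm_ring_hom =
  fixes h :: "'a::comm_ring_1 \<Rightarrow> 'b::comm_ring_1"
  assumes hom_add: "h (x + y) = h x + h y"
    and hom_mult: "h (x * y) = h x * h y"
    and hom_1: "h 1 = 1"
begin

lemma hom_0: "h 0 = 0"
  using hom_add[of 0 0] by simp

lemma hom_diff: "h (x - y) = h x - h y"
  using hom_add[of "x - y" y] by simp

lemma hom_sum: "h (\<Sum>x\<in>A. f x) = (\<Sum>x\<in>A. h (f x))"
  by (induction A rule: infinite_finite_induct) (simp_all add: hom_0 hom_add)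

lemma hom_power: "h (x ^ m) = h x ^ m"
  by (induction m) (simp_all add: hom_1 hom_mult)

definition fps_hom :: "'a fps \<Rightarrow> 'b fps" where
  "fps_hom F = Abs_fps (\<lambda>d. h (fps_nth F d))"

lemma fps_hom_nth [simp]: "fps_nth (fps_hom F) d = h (fps_nth F d)"
  by (simp add: fps_hom_def)

lemma fps_hom_add: "fps_hom (F + G) = fps_hom F + fps_hom G"
  and fps_hom_diff: "fps_hom (F - G) = fps_hom F - fps_hom G"
  and fps_hom_mult: "fps_hom (F * G) = fps_hom F * fps_hom G"
  and fps_hom_const: "fps_hom (fps_const c) = fps_const (h c)"
  and fps_hom_1: "fps_hom 1 = 1"
  and fps_hom_X: "fps_hom fps_X = fps_X"
  and fps_hom_geom: "fps_hom (geom_fps c) = geom_fps (h c)"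
  by (simp_all add: fps_eq_iff fps_mult_nth hom_add hom_diff hom_sum hom_mult hom_0 hom_1 hom_power
      geom_fps_def)

lemma fps_hom_prod: "fps_hom (\<Prod>x\<in>A. f x) = (\<Prod>x\<in>A. fps_hom (f x))"
  by (induction A rule: infinite_finite_induct) (simp_all add: fps_hom_1 fps_hom_mult)

end

interpretation eval: comm_ring_hom "eval_poly y" for y
  by unfold_locales (simp_all add: eval_add eval_mult)

subsection \<open>Hall-Littlewood polynomials\<close>

text \<open>
  The generating function of the Hall-Littlewood polynomials, for arbitrary elements in place of
  the variables.
\<close>

definition HL_factor :: "'a::comm_ring_1 \<Rightarrow> 'a \<Rightarrow> 'a fps" where
  "HL_factor q a = (1 - fps_const (q * a) * fps_X) * geom_fps a"

definition HL_series :: "nat \<Rightarrow> mpoly fps" where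
  "HL_series i = (\<Prod>j=1..i. HL_factor (Cst qvar) (Var j))"

lemma hall_littlewood_eq: "hall_littlewood d i = scale (inverse (1 - qvar)) (fps_nth (HL_series i) d)"
  by (simp add: hall_littlewood_def HL_series_def HL_factor_def scale_eq_Cst)

lemma HL_series_0 [simp]: "HL_series 0 = 1"
  by (simp add: HL_series_def)

lemma HL_series_Suc: "HL_series (Suc i) = HL_series i * HL_factor (Cst qvar) (Var (Suc i))"
  by (simp add: HL_series_def)

lemma geom_fps_unfold: "fps_const a * fps_X * geom_fps a = geom_fps a - 1"
  using geom_fps_inverse[of a] by (simp add: algebra_simps)

text \<open>
  Partial fractions.
\<close>

lemma HL_factor_alt: "HL_factor q a = fps_const q + fps_const (1 - q) * geom_fps a"
proof -
  have "HL_factor q a = geom_fps a - fps_const q * (fps_const a * fps_X * geom_fps a)"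
    by (simp add: HL_factor_def algebra_simps flip: fps_const_mult)
  also have "\<dots> = fps_const q + fps_const (1 - q) * geom_fps a"
    by (simp only: geom_fps_unfold) (simp add: algebra_simps flip: fps_const_sub)
  finally show ?thesis .
qed

lemma HL_factor_nth: "fps_nth (HL_factor q a) d = (if d = 0 then 1 else (1 - q) * a ^ d)"
  by (simp add: HL_factor_alt geom_fps_def)

lemma bij_betw_transpose_interval:
  assumes "1 \<le> i" "i \<noteq> m"
  shows "bij_betw (transpose i (i + 1)) {1..m} {1..m::nat}"
  using assms by (intro bij_betwI[where g = "transpose i (i + 1)"]) (auto simp: transpose_def)

lemma polys_HL_series: "fps_nth (HL_series i) d \<in> polys {1..i}"
proof (induction i arbitrary: d)
  case 0
  show ?case by simp
next
  case (Suc i)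
  have "fps_nth (HL_factor (Cst qvar) (Var (Suc i))) d \<in> polys {1..Suc i}" for d
    using polys_Cst[of "1 - qvar"] by (auto simp: HL_factor_nth Cst_diff intro!: polys_mult polys_power)
  moreover have "fps_nth (HL_series i) d \<in> polys {1..Suc i}" for d
    using Suc polys_mono[of "{1..i}" "{1..Suc i}"] by auto
  ultimately show ?case
    by (simp add: HL_series_Suc fps_mult_nth polys_sum polys_mult)
qed

lemma homogeneous_HL_series: "homogeneous d (fps_nth (HL_series i) d)"
proof (induction i arbitrary: d)
  case 0
  show ?case by (simp add: homogeneous_1)
next
  case (Suc i)
  have f: "homogeneous d (fps_nth (HL_factor (Cst qvar) (Var (Suc i))) d)" for d
    using homogeneous_scale[OF homogeneous_Var_power, where c = "1 - qvar"]
    by (simp add: HL_factor_nth homogeneous_1 scale_eq_Cst Cst_diff)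
  have "homogeneous d (fps_nth (HL_series i) j * fps_nth (HL_factor (Cst qvar) (Var (Suc i))) (d - j))"
    if "j \<le> d" for j
    using homogeneous_mult[OF Suc[of j] f[of "d - j"]] that by simp
  then show ?case
    by (auto simp: HL_series_Suc fps_mult_nth intro!: homogeneous_sum)
qed

text \<open>
  The summand for \<open>a = 0\<close> is the \<open>k\<close>-th power of the last variable; so the polynomial is monic in
  that variable, and the other coefficients live in fewer variables.
\<close>

lemma hall_littlewood_Suc:
  "hall_littlewood k (Suc i) = scale (inverse (1 - qvar)) (fps_nth (HL_series i) k)
     + (\<Sum>a<k. fps_nth (HL_series i) a * Var (Suc i) ^ (k - a))"
proof -
  have "fps_nth (HL_series (Suc i)) k =
      (\<Sum>a\<in>insert k {..<k}. fps_nth (HL_series i) a * fps_nth (HL_factor (Cst qvar) (Var (Suc i))) (k - a))"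
    unfolding HL_series_Suc fps_mult_nth by (rule sum.cong) auto
  also have "\<dots> = fps_nth (HL_series i) k + (\<Sum>a<k. fps_nth (HL_series i) a * ((1 - Cst qvar) * Var (Suc i) ^ (k - a)))"
    by (simp add: HL_factor_nth)
  also have "(\<Sum>a<k. fps_nth (HL_series i) a * ((1 - Cst qvar) * Var (Suc i) ^ (k - a))) =
      scale (1 - qvar) (\<Sum>a<k. fps_nth (HL_series i) a * Var (Suc i) ^ (k - a))"
    by (simp add: scale_eq_Cst Cst_diff sum_distrib_left mult_ac)
  finally show ?thesis
    by (simp add: hall_littlewood_eq VS.scale_right_distrib)
qed

lemma HL_series_nth_0 [simp]: "fps_nth (HL_series i) 0 = 1"
  by (induction i) (simp_all add: HL_series_Suc HL_factor_nth)

subsection \<open>Elementary symmetric polynomials\<close>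

definition E_series :: "nat \<Rightarrow> mpoly fps" where
  "E_series n = (\<Prod>j=1..n. 1 + fps_const (Var j) * fps_X)"

text \<open>
  Expanding the product over all subsets recovers the definition.
\<close>

lemma elem_sym_eq: "elem_sym d n = fps_nth (E_series n) d"
proof -
  have term_eq: "fps_nth ((\<Prod>j\<in>S. fps_const (Var j) * fps_X) * (\<Prod>j\<in>T. 1)) d =
      (if card S = d then \<Prod>j\<in>S. Var j else 0)" for S T :: "nat set"
  proof -
    have "(\<Prod>j\<in>S. fps_const (Var j) * fps_X) = fps_const (\<Prod>j\<in>S. Var j) * fps_X ^ card S"
      by (induction S rule: infinite_finite_induct) (simp_all add: mult_ac flip: fps_const_mult)
    then show ?thesis by simp
  qed
  have "E_series n = (\<Prod>j\<in>{1..n}. fps_const (Var j) * fps_X + 1)"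
    by (simp only: E_series_def add.commute)
  then have "fps_nth (E_series n) d =
      (\<Sum>S\<in>Pow {1..n}. fps_nth ((\<Prod>j\<in>S. fps_const (Var j) * fps_X) * (\<Prod>j\<in>{1..n} - S. 1)) d)"
    by (simp only: prod_add[OF finite_atLeastAtMost] fps_sum_nth)
  also have "\<dots> = (\<Sum>S\<in>Pow {1..n}. if card S = d then \<Prod>j\<in>S. Var j else 0)"
    by (simp only: term_eq)
  also have "\<dots> = elem_sym d n"
    unfolding elem_sym_def by (simp add: sum.If_cases Int_def)
  finally show ?thesis ..
qed

lemma E_series_Suc: "E_series (Suc n) = E_series n * (1 + fps_const (Var (Suc n)) * fps_X)"
  by (simp add: E_series_def)

lemma elem_sym_Suc: "elem_sym (Suc d) (Suc n) = elem_sym (Suc d) n + Var (Suc n) * elem_sym d n"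
proof -
  have "E_series (Suc n) = E_series n + fps_const (Var (Suc n)) * (fps_X * E_series n)"
    unfolding E_series_Suc by (simp add: algebra_simps)
  then show ?thesis unfolding elem_sym_eq by simp
qed

lemma elem_sym_0 [simp]: "elem_sym 0 n = 1"
proof -
  have "{S. S \<subseteq> {1..n} \<and> card S = 0} = {{}}"
    by (auto simp: finite_subset[of _ "{1..n}"])
  then show ?thesis by (simp only: elem_sym_def) simp
qed

lemma elem_sym_eq_0: "n < d \<Longrightarrow> elem_sym d n = 0"
proof -
  assume "n < d"
  then have "card S \<noteq> d" if "S \<subseteq> {1..n}" for S
    using card_mono[OF _ that] by simp
  then have "{S. S \<subseteq> {1..n} \<and> card S = d} = {}"
    by auto
  then show ?thesis by (simp only: elem_sym_def) simp
qed

lemma polys_elem_sym: "elem_sym d n \<in> polys {1..n}"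
  unfolding elem_sym_def by (intro polys_sum polys_prod polys_Var) auto

lemma homogeneous_elem_sym: "homogeneous d (elem_sym d n)"
  unfolding elem_sym_def
proof (rule homogeneous_sum)
  fix S assume S: "S \<in> {S. S \<subseteq> {1..n} \<and> card S = d}"
  have "homogeneous (\<Sum>j\<in>S. 1) (\<Prod>j\<in>S. Var j)"
    by (rule homogeneous_prod) (rule homogeneous_Var)
  then show "homogeneous d (\<Prod>j\<in>S. Var j)" using S by simp
qed

subsection \<open>Ideals with fewer elementary symmetric generators\<close>

text \<open>
  The number \<open>s\<close> of elementary symmetric generators is independent of the degree \<open>k\<close>: removing
  a variable may lower \<open>s\<close> but keeps \<open>k\<close>.
\<close>

definition ideal_gens :: "nat \<Rightarrow> nat \<Rightarrow> nat \<Rightarrow> mpoly set" where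
  "ideal_gens n k s =
     {hall_littlewood k i | i. 1 \<le> i \<and> i \<le> n} \<union> {elem_sym d n | d. n < d + s \<and> d \<le> n}"

definition ideal_nks :: "nat \<Rightarrow> nat \<Rightarrow> nat \<Rightarrow> mpoly set" where
  "ideal_nks n k s = gen_ideal {1..n} (ideal_gens n k s)"

lemma polys_hall_littlewood: "i \<le> n \<Longrightarrow> hall_littlewood k i \<in> polys {1..n}"
  using polys_HL_series[of i k] polys_mono[of "{1..i}" "{1..n}"]
  by (auto simp: hall_littlewood_eq intro!: polys_scale)

lemma ideal_gens_subset: "ideal_gens n k s \<subseteq> polys {1..n}"
  by (auto simp: ideal_gens_def polys_hall_littlewood polys_elem_sym)

lemma ideal_nks_subset: "ideal_nks n k s \<subseteq> polys {1..n}"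
  unfolding ideal_nks_def by (rule gen_ideal_subset[OF ideal_gens_subset])

lemma ideal_nk_eq: "k \<le> n \<Longrightarrow> ideal_nk n k = ideal_nks n k k"
proof -
  assume "k \<le> n"
  then have "{hall_littlewood k i | i. 1 \<le> i \<and> i \<le> n} \<union> {elem_sym d n | d. n - k + 1 \<le> d \<and> d \<le> n}
    = ideal_gens n k k"
    unfolding ideal_gens_def by (intro arg_cong2[of _ _ _ _ "(\<union>)"] refl Collect_cong) auto
  then show ?thesis
    unfolding ideal_nk_def ideal_nks_def by (simp only: genideal_eq_gen_ideal[OF ideal_gens_subset])
qed

lemma hall_littlewood_in_ideal: "1 \<le> i \<Longrightarrow> i \<le> n \<Longrightarrow> hall_littlewood k i \<in> ideal_nks n k s"
  unfolding ideal_nks_def by (rule gen_ideal_gen) (auto simp: ideal_gens_def)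

lemma elem_sym_in_ideal: "n < d + s \<Longrightarrow> elem_sym d n \<in> ideal_nks n k s"
  by (cases "d \<le> n")
    (auto simp: ideal_nks_def ideal_gens_def elem_sym_eq_0 gen_ideal.zero intro!: gen_ideal_gen)

lemma subspace_ideal_nks: "VS.subspace (ideal_nks n k s)"
  unfolding ideal_nks_def by (rule subspace_gen_ideal)

lemma ideal_nks_mult: "f \<in> ideal_nks n k s \<Longrightarrow> h \<in> polys {1..n} \<Longrightarrow> h * f \<in> ideal_nks n k s"
  unfolding ideal_nks_def by (rule gen_ideal_mult)

section \<open>A spanning set of the quotient\<close>

text \<open>
  For \<open>s \<le> k\<close>, the number of functions from \<open>{1..n}\<close> to \<open>{..<k}\<close> whose image contains \<open>s\<close> prescribed values.
\<close>

fun cover_count :: "nat \<Rightarrow> nat \<Rightarrow> nat \<Rightarrow> nat" where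
  "cover_count 0 k s = (if s = 0 then 1 else 0)"
| "cover_count (Suc n) k s = s * cover_count n k (s - 1) + (k - s) * cover_count n k s"

text \<open>
  With \<open>x\<close> the last variable, \<open>x e\<^sub>d\<close> of the other variables is \<open>- e\<^sub>d\<^sub>+\<^sub>1\<close> of them modulo the
  ideal, as long as \<open>e\<^sub>d\<^sub>+\<^sub>1\<close> of all variables is a generator. After \<open>m\<close> steps the index exceeds the number
  of variables.
\<close>

lemma Var_power_elem_sym_in_ideal:
  assumes "Suc n \<le> d + m" "m \<le> s"
  shows "Var (Suc n) ^ m * elem_sym d n \<in> ideal_nks (Suc n) k s"
  using assms
proof (induction m arbitrary: d)
  case 0
  then show ?case
    by (simp add: elem_sym_eq_0 VS.subspace_0[OF subspace_ideal_nks])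
next
  case (Suc m)
  have "Var (Suc n) ^ m * elem_sym (Suc d) (Suc n) \<in> ideal_nks (Suc n) k s"
    using Suc.prems by (intro ideal_nks_mult elem_sym_in_ideal polys_power polys_Var) auto
  moreover have "Var (Suc n) ^ m * elem_sym (Suc d) n \<in> ideal_nks (Suc n) k s"
    using Suc.prems by (intro Suc.IH) auto
  ultimately have "Var (Suc n) ^ m * elem_sym (Suc d) (Suc n) - Var (Suc n) ^ m * elem_sym (Suc d) n
      \<in> ideal_nks (Suc n) k s"
    by (rule VS.subspace_diff[OF subspace_ideal_nks])
  then show ?case
    by (simp add: elem_sym_Suc algebra_simps)
qed

text \<open>
  Division by the Hall-Littlewood polynomial in all variables, which is monic of degree \<open>k\<close> in
  the last one.
\<close>

lemma polys_Suc_subset_span: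
  assumes "1 \<le> k" and U: "VS.subspace U" and I: "ideal_nks (Suc n) k s \<subseteq> U"
    and low: "\<And>j f. \<lbrakk>j < k; f \<in> polys {1..n}\<rbrakk> \<Longrightarrow> Var (Suc n) ^ j * f \<in> U"
  shows "polys {1..Suc n} \<subseteq> U"
proof
  let ?x = "Var (Suc n)"
  have sub: "polys {1..n} \<subseteq> polys {1..Suc n}" by (rule polys_mono) auto
  have all: "?x ^ j * f \<in> U" if "f \<in> polys {1..n}" for j f
    using that
  proof (induction j arbitrary: f rule: less_induct)
    case (less j)
    show ?case
    proof (cases "j < k")
      case True
      then show ?thesis using low less.prems by blast
    next
      case False
      define P where "P = hall_littlewood k (Suc n)"
      define Q where "Q = scale (inverse (1 - qvar)) (fps_nth (HL_series n) k)"
      have split: "{..<k} = insert 0 {1..<k}" using assms(1) by auto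
      have P: "P = Q + (?x ^ k + (\<Sum>a\<in>{1..<k}. fps_nth (HL_series n) a * ?x ^ (k - a)))"
        unfolding P_def Q_def hall_littlewood_Suc split by simp
      have "?x ^ j * f = ?x ^ (j - k) * f * ?x ^ k"
        using False by (simp add: mult_ac flip: power_add)
      also have "?x ^ k = P - Q - (\<Sum>a\<in>{1..<k}. fps_nth (HL_series n) a * ?x ^ (k - a))"
        by (simp add: P)
      also have "?x ^ (j - k) * f * \<dots> = ?x ^ (j - k) * f * P - ?x ^ (j - k) * (f * Q)
          - (\<Sum>a\<in>{1..<k}. ?x ^ (j - k) * ?x ^ (k - a) * (f * fps_nth (HL_series n) a))"
        by (simp add: right_diff_distrib left_diff_distrib sum_distrib_left mult_ac)
      also have "(\<Sum>a\<in>{1..<k}. ?x ^ (j - k) * ?x ^ (k - a) * (f * fps_nth (HL_series n) a)) =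
          (\<Sum>a\<in>{1..<k}. ?x ^ (j - a) * (f * fps_nth (HL_series n) a))"
        using False by (intro sum.cong refl) (simp flip: power_add)
      finally have eq: "?x ^ j * f = ?x ^ (j - k) * f * P - ?x ^ (j - k) * (f * Q)
          - (\<Sum>a\<in>{1..<k}. ?x ^ (j - a) * (f * fps_nth (HL_series n) a))" .
      have "?x ^ (j - k) * f * P \<in> U"
        using I less.prems sub unfolding P_def
        by (intro subsetD[OF I] ideal_nks_mult polys_mult polys_power hall_littlewood_in_ideal) auto
      moreover have "?x ^ (j - k) * (f * Q) \<in> U"
        using False assms(1) less.prems unfolding Q_def
        by (intro less.IH polys_mult polys_scale polys_HL_series) auto
      moreover have "?x ^ (j - a) * (f * fps_nth (HL_series n) a) \<in> U" if "a \<in> {1..<k}" for a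
        using False that less.prems by (intro less.IH polys_mult polys_HL_series) auto
      ultimately show ?thesis
        unfolding eq by (intro VS.subspace_diff[OF U] VS.subspace_sum[OF U]) auto
    qed
  qed
  have mon: "single m 1 \<in> U" if m: "keys m \<subseteq> {1..Suc n}" for m
  proof -
    define e where "e = lookup m (Suc n)"
    define m' where "m' = m - single (Suc n) e"
    have m_eq: "m = single (Suc n) e + m'"
      by (rule poly_mapping_eqI)
        (auto simp: m'_def lookup_add lookup_minus lookup_single when_def e_def)
    have "i \<in> {1..n}" if "i \<in> keys m'" for i
    proof -
      have "i \<noteq> Suc n" "i \<in> keys m"
        using that by (auto simp: m'_def in_keys_iff lookup_minus lookup_single when_def e_def)
      then show ?thesis using m by fastforce
    qed
    then have "single m' 1 \<in> polys {1..n}"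
      by (auto simp: polys_def)
    then have "?x ^ e * single m' 1 \<in> U" by (rule all)
    then show ?thesis by (simp add: Var_power mult_single m_eq[symmetric])
  qed
  fix f assume f: "f \<in> polys {1..Suc n}"
  have "(\<Sum>m\<in>keys f. scale (lookup f m) (single m 1)) \<in> U"
    using f by (intro VS.subspace_sum[OF U] VS.subspace_scale[OF U] mon) (auto simp: polys_def)
  then show "f \<in> U"
    using poly_mapping_expand[OF finite_keys order_refl, of f] by simp
qed

lemma linmap_mult_left: "linmap (\<lambda>f. g * f)" for g :: mpoly
  by (rule linmapI) (simp_all add: distrib_left scale_eq_Cst mult_ac)

text \<open>
  Here \<open>U\<close> is the span of the ideal and of the multiples of the higher powers of the last variable
  \<open>x\<close>, so the lemma bounds the \<open>j\<close>-th step of the filtration by powers of \<open>x\<close>. If \<open>j < s\<close>,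
  replacing \<open>e\<^sub>d\<close> of all variables by \<open>e\<^sub>d\<close> of the others costs a multiple of \<open>x\<close>, and there is
  one generator less. If \<open>j \<ge> s\<close>, the factor \<open>x\<^sup>j\<close> alone moves \<open>s\<close> generators in the other variables
  into the ideal.
\<close>

lemma Var_power_ideal_subset:
  assumes "j < k" "s \<le> k" and U: "VS.subspace U" and I: "ideal_nks (Suc n) k s \<subseteq> U"
    and high: "\<And>i f. \<lbrakk>j < i; i < k; f \<in> polys {1..n}\<rbrakk> \<Longrightarrow> Var (Suc n) ^ i * f \<in> U"
    and f: "f \<in> ideal_nks n k (if j < s then s - 1 else s)"
  shows "Var (Suc n) ^ j * f \<in> U"
  using f unfolding ideal_nks_def
proof induction
  case zero
  show ?case by (simp add: VS.subspace_0[OF U])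
next
  case (add f f')
  then show ?case by (simp add: distrib_left VS.subspace_add[OF U])
next
  case (gen h g)
  let ?x = "Var (Suc n)"
  let ?s = "if j < s then s - 1 else s"
  have h: "h \<in> polys {1..Suc n}"
    using gen(1) polys_mono[of "{1..n}" "{1..Suc n}"] by auto
  have xh: "?x ^ e * h \<in> polys {1..Suc n}" for e
    by (intro polys_mult polys_power h polys_Var) auto
  from gen(2) consider i where "g = hall_littlewood k i" "1 \<le> i" "i \<le> n"
    | d where "g = elem_sym d n" "n < d + ?s" unfolding ideal_gens_def by blast
  then show ?case
  proof cases
    case 1
    then have "(?x ^ j * h) * g \<in> ideal_nks (Suc n) k s"
      by (intro ideal_nks_mult xh) (auto intro: hall_littlewood_in_ideal)
    then show ?thesis using I by (auto simp: mult.assoc)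
  next
    case 2
    \<comment> \<open>the case in which \<open>m \<le> j\<close> factors \<open>x\<close> already suffice\<close>
    have small: "?x ^ j * (h * g) \<in> U" if "Suc n \<le> d + m" "m \<le> s" "m \<le> j" for m
    proof -
      have "?x ^ m * g \<in> ideal_nks (Suc n) k s"
        using that Var_power_elem_sym_in_ideal[of n d m s k] 2 by simp
      then have "(?x ^ (j - m) * h) * (?x ^ m * g) \<in> ideal_nks (Suc n) k s"
        by (rule ideal_nks_mult) (rule xh)
      moreover have "(?x ^ (j - m) * h) * (?x ^ m * g) = ?x ^ (j - m) * ?x ^ m * (h * g)"
        by (simp add: mult_ac)
      ultimately show ?thesis using that I by (auto simp flip: power_add)
    qed
    show ?thesis
    proof (cases "j < s")
      case False
      then show ?thesis using 2 by (intro small[of s]) auto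
    next
      case True
      show ?thesis
      proof (cases "Suc j = k")
        case True
        then show ?thesis using 2 \<open>j < s\<close> assms(2) by (intro small[of j]) auto
      next
        case False
        show ?thesis
        proof (cases d)
          case 0
          then have "(?x ^ j * h) * elem_sym 0 (Suc n) \<in> ideal_nks (Suc n) k s"
            using 2 True by (intro ideal_nks_mult xh elem_sym_in_ideal) auto
          then show ?thesis using I 0 2 by auto
        next
          case (Suc d')
          have "(?x ^ j * h) * elem_sym d (Suc n) \<in> ideal_nks (Suc n) k s"
            using 2 True by (intro ideal_nks_mult xh elem_sym_in_ideal) auto
          moreover have "?x ^ Suc j * (elem_sym d' n * h) \<in> U"
            using False assms(1) gen(1) by (intro high polys_mult polys_elem_sym) auto
          ultimately have "(?x ^ j * h) * elem_sym d (Suc n) - ?x ^ Suc j * (elem_sym d' n * h) \<in> U"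
            using I by (intro VS.subspace_diff[OF U]) auto
          then show ?thesis
            unfolding Suc elem_sym_Suc 2 by (simp add: algebra_simps)
        qed
      qed
    qed
  qed
qed

text \<open>
  The first \<open>s\<close> steps of the filtration by powers of the last variable are quotients of the
  ring for \<open>s - 1\<close>, the remaining \<open>k - s\<close> steps of the ring for \<open>s\<close>. The basis elements for step \<open>j\<close>
  are multiplied by the \<open>j\<close>-th power.
\<close>

lemma polys_span_bound:
  assumes "1 \<le> k" "s \<le> k"
  shows "\<exists>B. finite B \<and> card B \<le> cover_count n k s \<and> polys {1..n} \<subseteq> VS.span (B \<union> ideal_nks n k s)"
  using assms(2)
proof (induction n arbitrary: s)
  case 0
  show ?case
  proof (cases "s = 0")
    case True
    have "f \<in> VS.span {1}" if "f \<in> polys {}" for f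
      using that
    proof (induction rule: polys_induct)
      case (Cst c)
      have "Cst c = scale c 1" by (simp add: scale_eq_Cst)
      then show ?case by (simp only: VS.span_scale VS.span_base singletonI)
    next
      case (add f g)
      then show ?case by (intro VS.span_add)
    next
      case (mult f g)
      then obtain c d where "f = scale c 1" "g = scale d 1"
        unfolding VS.span_singleton by blast
      then have "f * g = scale (c * d) 1" by (simp add: scale_eq_Cst Cst_mult)
      then show ?case unfolding VS.span_singleton by blast
    qed auto
    then show ?thesis
      using True VS.span_mono[of "{1}" "{1} \<union> ideal_nks 0 k s"]
      by (intro exI[of _ "{1}"]) auto
  next
    case False
    have "f \<in> ideal_nks 0 k s" if "f \<in> polys {1..0}" for f
      using ideal_nks_mult[OF elem_sym_in_ideal[of 0 0 s k] that] False by simp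
    then show ?thesis
      by (intro exI[of _ "{}"]) (auto intro: VS.span_base)
  qed
next
  case (Suc n)
  let ?x = "Var (Suc n)"
  let ?I = "ideal_nks (Suc n) k s"
  let ?c = "\<lambda>j. if j < s then cover_count n k (s - 1) else cover_count n k s"
  have "\<exists>B. finite B \<and> card B \<le> (\<Sum>j\<in>{t..<k}. ?c j) \<and>
      (\<forall>j f. t \<le> j \<longrightarrow> j < k \<longrightarrow> f \<in> polys {1..n} \<longrightarrow> ?x ^ j * f \<in> VS.span (B \<union> ?I))" if "t \<le> k" for t
    using that
  proof (induction t rule: inc_induct)
    case base
    show ?case by (intro exI[of _ "{}"]) auto
  next
    case (step t)
    from step.IH obtain B where B: "finite B" "card B \<le> (\<Sum>j\<in>{Suc t..<k}. ?c j)"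
      "\<And>j f. \<lbrakk>t < j; j < k; f \<in> polys {1..n}\<rbrakk> \<Longrightarrow> ?x ^ j * f \<in> VS.span (B \<union> ?I)"
      by (auto simp: Suc_le_eq)
    let ?s = "if t < s then s - 1 else s"
    have "\<exists>B'. finite B' \<and> card B' \<le> ?c t \<and> polys {1..n} \<subseteq> VS.span (B' \<union> ideal_nks n k ?s)"
      using Suc.IH[of ?s] Suc.prems by (auto split: if_splits)
    then obtain B' where B': "finite B'" "card B' \<le> ?c t"
      "polys {1..n} \<subseteq> VS.span (B' \<union> ideal_nks n k ?s)"
      by blast
    define B2 where "B2 = (\<lambda>f. ?x ^ t * f) ` B' \<union> B"
    let ?U = "VS.span (B2 \<union> ?I)"
    have mono: "VS.span (B \<union> ?I) \<subseteq> ?U"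
      by (rule VS.span_mono) (auto simp: B2_def)
    have new: "?x ^ t * f \<in> ?U" if f: "f \<in> polys {1..n}" for f
    proof -
      have "?x ^ t * f \<in> (\<lambda>f. ?x ^ t * f) ` VS.span (B' \<union> ideal_nks n k ?s)"
        using f B'(3) by blast
      also have "\<dots> = VS.span ((\<lambda>f. ?x ^ t * f) ` (B' \<union> ideal_nks n k ?s))"
        by (rule VSP.linear_span_image[OF linmap_mult_left, symmetric])
      also have "\<dots> \<subseteq> ?U"
      proof (rule VS.span_minimal[OF _ VS.subspace_span], safe)
        fix g assume "g \<in> B'"
        then show "?x ^ t * g \<in> ?U"
          by (intro VS.span_base) (auto simp: B2_def)
      next
        fix g assume g: "g \<in> ideal_nks n k ?s"
        show "?x ^ t * g \<in> ?U"
          using step Suc.prems g B(3) mono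
          by (intro Var_power_ideal_subset[of t k s ?U n g] VS.subspace_span)
            (auto intro: VS.span_base)
      qed
      finally show ?thesis .
    qed
    have "card B2 \<le> card B' + card B"
      unfolding B2_def by (rule order_trans[OF card_Un_le]) (simp add: card_image_le B'(1))
    also have "\<dots> \<le> (\<Sum>j\<in>{t..<k}. ?c j)"
      using B(2) B'(2) step.hyps by (simp add: sum.atLeast_Suc_lessThan)
    finally have "card B2 \<le> (\<Sum>j\<in>{t..<k}. ?c j)" .
    moreover have "?x ^ j * f \<in> ?U" if "t \<le> j" "j < k" "f \<in> polys {1..n}" for j f
      using that new B(3)[of j f] mono by (cases "t = j") auto
    ultimately show ?case
      using B(1) B'(1) by (intro exI[of _ B2]) (auto simp: B2_def)
  qed
  from this[of 0] obtain B where B: "finite B" "card B \<le> (\<Sum>j\<in>{0..<k}. ?c j)"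
    "\<And>j f. \<lbrakk>j < k; f \<in> polys {1..n}\<rbrakk> \<Longrightarrow> ?x ^ j * f \<in> VS.span (B \<union> ?I)"
    by auto
  have "{0..<k} = {0..<s} \<union> {s..<k}" "{0..<s} \<inter> {s..<k} = {}"
    using Suc.prems by auto
  then have "(\<Sum>j\<in>{0..<k}. ?c j) = (\<Sum>j\<in>{0..<s}. ?c j) + (\<Sum>j\<in>{s..<k}. ?c j)"
    by (simp add: sum.union_disjoint)
  also have "\<dots> = cover_count (Suc n) k s" by simp
  finally have "card B \<le> cover_count (Suc n) k s" using B(2) by simp
  moreover have "polys {1..Suc n} \<subseteq> VS.span (B \<union> ?I)"
    using assms(1) B(3)
    by (intro polys_Suc_subset_span[of k _ n s] VS.subspace_span) (auto intro: VS.span_base)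
  ultimately show ?case using B(1) by blast
qed


section \<open>Counting ordered set partitions\<close>

abbreviation OP :: "nat \<Rightarrow> nat \<Rightarrow> nat set list set" where
  "OP n k \<equiv> ordered_set_partitions n k"

text \<open>
  If the last point takes the value \<open>j\<close>, the others have to cover \<open>S - {j}\<close>. For the induction \<open>S\<close> is
  an arbitrary set of values.
\<close>

lemma card_covering_functions:
  assumes "S \<subseteq> {..<k}"
  shows "card {w \<in> {1..n} \<rightarrow>\<^sub>E {..<k}. S \<subseteq> w ` {1..n}} = cover_count n k (card S)"
  using assms
proof (induction n arbitrary: S)
  case 0
  have "finite S" using 0 finite_subset by blast
  then show ?case by (cases "S = {}") auto
next
  case (Suc n)
  let ?W = "\<lambda>n::nat. \<lambda>S. {w \<in> {1..n} \<rightarrow>\<^sub>E {..<k}. S \<subseteq> w ` {1..n}}"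
  have finS: "finite S" using Suc.prems finite_subset by blast
  have fin: "finite (?W n S)" for n :: nat and S :: "nat set"
    by (rule finite_subset[of _ "{1..n} \<rightarrow>\<^sub>E {..<k}"]) (auto intro!: finite_PiE)
  have ins: "{1..Suc n} = insert (Suc n) {1..n}" by auto
  have part: "?W (Suc n) S = (\<Union>j\<in>{..<k}. (\<lambda>w. w(Suc n := j)) ` ?W n (S - {j}))"
  proof (intro equalityI subsetI)
    fix w assume w: "w \<in> ?W (Suc n) S"
    have "w = (w(Suc n := undefined))(Suc n := w (Suc n))" by simp
    moreover have "w(Suc n := undefined) \<in> ?W n (S - {w (Suc n)})"
    proof -
      have "(w(Suc n := undefined)) ` {1..n} = w ` {1..n}" by (rule image_cong) auto
      then show ?thesis using w by (auto simp: ins PiE_iff extensional_def)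
    qed
    moreover have "w (Suc n) < k" using w by auto
    ultimately show "w \<in> (\<Union>j\<in>{..<k}. (\<lambda>w. w(Suc n := j)) ` ?W n (S - {j}))" by blast
  next
    fix w assume "w \<in> (\<Union>j\<in>{..<k}. (\<lambda>w. w(Suc n := j)) ` ?W n (S - {j}))"
    then obtain j v where j: "j < k" and v: "v \<in> ?W n (S - {j})" and w: "w = v(Suc n := j)" by auto
    have "w ` {1..Suc n} = insert j (v ` {1..n})"
      unfolding ins w by (auto simp: image_iff)
    then show "w \<in> ?W (Suc n) S"
      using v j by (auto simp: w ins PiE_iff extensional_def)
  qed
  have inj: "inj_on (\<lambda>w. w(Suc n := j)) (?W n S')" for j S'
  proof (rule inj_onI)
    fix v w assume *: "v \<in> ?W n S'" "w \<in> ?W n S'" "v(Suc n := j) = w(Suc n := j)"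
    have "v (Suc n) = w (Suc n)" using *(1,2) by (auto simp: PiE_iff extensional_def)
    then show "v = w" using *(3) by (metis fun_upd_triv fun_upd_upd)
  qed
  have "card (?W (Suc n) S) = (\<Sum>j<k. card ((\<lambda>w. w(Suc n := j)) ` ?W n (S - {j})))"
    unfolding part
  proof (rule card_UN_disjoint)
    show "\<forall>i\<in>{..<k}. \<forall>j\<in>{..<k}. i \<noteq> j \<longrightarrow>
      (\<lambda>w. w(Suc n := i)) ` ?W n (S - {i}) \<inter> (\<lambda>w. w(Suc n := j)) ` ?W n (S - {j}) = {}"
    proof (intro ballI impI)
      fix i j :: nat assume "i \<noteq> j"
      then have "v(Suc n := i) \<noteq> w(Suc n := j)" for v w :: "nat \<Rightarrow> nat"
        by (metis fun_upd_same)
      then show "(\<lambda>w. w(Suc n := i)) ` ?W n (S - {i}) \<inter> (\<lambda>w. w(Suc n := j)) ` ?W n (S - {j}) = {}"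
        by blast
    qed
  qed (use fin in auto)
  also have "\<dots> = (\<Sum>j<k. card (?W n (S - {j})))"
    by (intro sum.cong refl card_image inj)
  also have "\<dots> = (\<Sum>j<k. if j \<in> S then cover_count n k (card S - 1) else cover_count n k (card S))"
    using Suc.prems finS by (intro sum.cong refl) (subst Suc.IH, auto)
  also have "\<dots> = card S * cover_count n k (card S - 1) + (k - card S) * cover_count n k (card S)"
    using Suc.prems finS
    by (simp add: sum.If_cases Int_absorb1 Diff_eq[symmetric] card_Diff_subset)
  finally show ?case by simp
qed

lemma finite_ordered_set_partitions: "finite (OP n k)"
proof (rule finite_subset)
  show "OP n k \<subseteq> {\<sigma>. set \<sigma> \<subseteq> Pow {1..n} \<and> length \<sigma> = k}"
    by (auto simp: ordered_set_partitions_def)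
  show "finite {\<sigma>. set \<sigma> \<subseteq> Pow {1..n::nat} \<and> length \<sigma> = k}"
    by (intro finite_lists_length_eq) auto
qed

lemma cover_count_le_card_osp: "cover_count n k k \<le> card (OP n k)"
proof -
  let ?W = "{w \<in> {1..n} \<rightarrow>\<^sub>E {..<k}. {..<k} \<subseteq> w ` {1..n}}"
  define blocks where "blocks w = map (\<lambda>r. {a \<in> {1..n}. w a = r}) [0..<k]" for w
  have len: "length (blocks w) = k" and nth: "r < k \<Longrightarrow> blocks w ! r = {a \<in> {1..n}. w a = r}" for w r
    by (simp_all add: blocks_def)
  have "blocks ` ?W \<subseteq> OP n k"
  proof
    fix \<sigma> assume "\<sigma> \<in> blocks ` ?W"
    then obtain w where w: "w \<in> ?W" "\<sigma> = blocks w" by blast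
    have "\<Union> (set \<sigma>) = {1..n}"
      using w by (auto simp: blocks_def PiE_iff)
    moreover have "\<sigma> ! r \<noteq> {}" if r: "r < k" for r
    proof -
      have "r \<in> w ` {1..n}" using w(1) r by blast
      then obtain a where "a \<in> {1..n}" "w a = r" by blast
      then have "a \<in> \<sigma> ! r" unfolding w(2) nth[OF r] by blast
      then show ?thesis by blast
    qed
    moreover have "\<sigma> ! r \<inter> \<sigma> ! s = {}" if "r < k" "s < k" "r \<noteq> s" for r s
      unfolding w(2) nth[OF that(1)] nth[OF that(2)] using that(3) by blast
    moreover have "length \<sigma> = k" unfolding w(2) by (rule len)
    ultimately show "\<sigma> \<in> OP n k"
      unfolding ordered_set_partitions_def by blast
  qed
  moreover have "inj_on blocks ?W"
  proof (rule inj_onI, rule ext)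
    fix v w a assume v: "v \<in> ?W" and w: "w \<in> ?W" and eq: "blocks v = blocks w"
    show "v a = w a"
    proof (cases "a \<in> {1..n}")
      case True
      then have va: "v a < k" using v by blast
      have "a \<in> blocks v ! v a" unfolding nth[OF va] using True by blast
      then show ?thesis unfolding eq nth[OF va] by simp
    next
      case False
      then show ?thesis using v w by (auto simp: PiE_iff extensional_def)
    qed
  qed
  ultimately have "card ?W \<le> card (OP n k)"
    using card_inj_on_le finite_ordered_set_partitions by blast
  then show ?thesis using card_covering_functions[of "{..<k}" k n] by simp
qed


section \<open>Ordered set partitions as maps\<close>

definition blk :: "nat set list \<Rightarrow> nat \<Rightarrow> nat" where
  "blk \<sigma> a = (THE r. r < length \<sigma> \<and> a \<in> \<sigma> ! r)"

lemma osp_length: "\<sigma> \<in> OP n k \<Longrightarrow> length \<sigma> = k"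
  by (simp add: ordered_set_partitions_def)

lemma blk_eqI:
  assumes "\<sigma> \<in> OP n k" "r < k" "a \<in> \<sigma> ! r"
  shows "blk \<sigma> a = r"
  unfolding blk_def
proof (rule the_equality)
  show "r < length \<sigma> \<and> a \<in> \<sigma> ! r" using assms by (simp add: osp_length)
  fix s assume "s < length \<sigma> \<and> a \<in> \<sigma> ! s"
  then show "s = r"
    using assms unfolding ordered_set_partitions_def by blast
qed

lemma blk_props:
  assumes "\<sigma> \<in> OP n k" "a \<in> {1..n}"
  shows "blk \<sigma> a < k" "a \<in> \<sigma> ! blk \<sigma> a"
proof -
  have "a \<in> \<Union> (set \<sigma>)" using assms by (simp add: ordered_set_partitions_def)
  then obtain r where "r < k" "a \<in> \<sigma> ! r"
    using osp_length[OF assms(1)] by (auto simp: in_set_conv_nth)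
  then show "blk \<sigma> a < k" "a \<in> \<sigma> ! blk \<sigma> a"
    using blk_eqI[OF assms(1)] by auto
qed

lemma osp_block_subset: "\<sigma> \<in> OP n k \<Longrightarrow> r < k \<Longrightarrow> \<sigma> ! r \<subseteq> {1..n}"
  unfolding ordered_set_partitions_def by (auto dest: nth_mem)

lemma osp_block_eq:
  assumes "\<sigma> \<in> OP n k" "r < k"
  shows "\<sigma> ! r = {a \<in> {1..n}. blk \<sigma> a = r}"
  using osp_block_subset[OF assms] blk_eqI[OF assms] blk_props(2)[OF assms(1)] by blast

lemma osp_block_nonempty:
  assumes "\<sigma> \<in> OP n k" "r < k"
  obtains a where "a \<in> {1..n}" "blk \<sigma> a = r"
proof -
  have "\<sigma> ! r \<noteq> {}" using assms by (simp add: ordered_set_partitions_def)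
  then show thesis using that osp_block_eq[OF assms] by blast
qed

lemma osp_eqI:
  assumes "\<sigma> \<in> OP n k" "\<tau> \<in> OP n k" "\<And>a. a \<in> {1..n} \<Longrightarrow> blk \<sigma> a = blk \<tau> a"
  shows "\<sigma> = \<tau>"
proof (rule nth_equalityI)
  show "length \<sigma> = length \<tau>" using assms by (simp add: osp_length)
  fix r assume "r < length \<sigma>"
  then have r: "r < k" using assms by (simp add: osp_length)
  show "\<sigma> ! r = \<tau> ! r"
    unfolding osp_block_eq[OF assms(1) r] osp_block_eq[OF assms(2) r] using assms(3) by auto
qed

lemma block_left_of_iff:
  assumes "\<sigma> \<in> OP n k" "a \<in> {1..n}" "b \<in> {1..n}"
  shows "block_left_of \<sigma> a b \<longleftrightarrow> blk \<sigma> a < blk \<sigma> b"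
proof
  assume "block_left_of \<sigma> a b"
  then obtain r s where "r < s" "s < k" "a \<in> \<sigma> ! r" "b \<in> \<sigma> ! s"
    using osp_length[OF assms(1)] by (auto simp: block_left_of_def)
  then show "blk \<sigma> a < blk \<sigma> b"
    using blk_eqI[OF assms(1), of r a] blk_eqI[OF assms(1), of s b] by simp
next
  assume "blk \<sigma> a < blk \<sigma> b"
  then show "block_left_of \<sigma> a b"
    unfolding block_left_of_def
    using blk_props[OF assms(1,2)] blk_props[OF assms(1,3)] osp_length[OF assms(1)] by blast
qed

abbreviation adj :: "nat \<Rightarrow> nat \<Rightarrow> nat" where
  "adj i \<equiv> transpose i (i + 1)"

lemma adj_image:
  assumes "1 \<le> i" "i < n"
  shows "adj i ` {1..n} = {1..n}"
  using bij_betw_transpose_interval[of i n] assms by (auto simp: bij_betw_def)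

lemma adj_in: "1 \<le> i \<Longrightarrow> i < n \<Longrightarrow> adj i a \<in> {1..n} \<longleftrightarrow> a \<in> {1..n}"
  by (auto simp: transpose_def)

lemma osp_swap_closed:
  assumes "\<sigma> \<in> OP n k" "1 \<le> i" "i < n"
  shows "osp_swap i \<sigma> \<in> OP n k"
proof -
  have disj: "adj i ` (\<sigma> ! r) \<inter> adj i ` (\<sigma> ! s) = {}" if "r < k" "s < k" "r \<noteq> s" for r s
    using that assms(1) unfolding ordered_set_partitions_def
    by (simp add: image_Int[OF inj_transpose, symmetric])
  have "\<Union> (set (osp_swap i \<sigma>)) = adj i ` \<Union> (set \<sigma>)"
    by (auto simp: osp_swap_def)
  also have "\<dots> = {1..n}"
    using assms adj_image by (simp add: ordered_set_partitions_def)
  finally show ?thesis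
    using assms(1) disj by (simp add: ordered_set_partitions_def osp_swap_def)
qed

lemma osp_swap_swap [simp]: "osp_swap i (osp_swap i \<sigma>) = \<sigma>"
  by (simp add: osp_swap_def image_image comp_def)

lemma osp_swap_commute:
  assumes "a + 1 < b"
  shows "osp_swap a (osp_swap b \<sigma>) = osp_swap b (osp_swap a \<sigma>)"
proof -
  have "adj a (adj b c) = adj b (adj a c)" for c
    using assms by (auto simp: transpose_def)
  then show ?thesis by (simp add: osp_swap_def image_image comp_def)
qed

lemma osp_swap_braid:
  "osp_swap a (osp_swap (a + 1) (osp_swap a \<sigma>)) = osp_swap (a + 1) (osp_swap a (osp_swap (a + 1) \<sigma>))"
proof -
  have "adj a (adj (a + 1) (adj a c)) = adj (a + 1) (adj a (adj (a + 1) c))" for c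
    by (auto simp: transpose_def)
  then show ?thesis by (simp add: osp_swap_def image_image comp_def)
qed

lemma blk_swap:
  assumes "\<sigma> \<in> OP n k" "1 \<le> i" "i < n" "a \<in> {1..n}"
  shows "blk (osp_swap i \<sigma>) a = blk \<sigma> (adj i a)"
proof (rule blk_eqI[OF osp_swap_closed[OF assms(1-3)]])
  have a: "adj i a \<in> {1..n}" using assms by (simp only: adj_in)
  show "blk \<sigma> (adj i a) < k" using blk_props[OF assms(1) a] by simp
  have "adj i (adj i a) \<in> adj i ` (\<sigma> ! blk \<sigma> (adj i a))"
    using blk_props(2)[OF assms(1) a] by (rule imageI)
  then show "a \<in> osp_swap i \<sigma> ! blk \<sigma> (adj i a)"
    using blk_props(1)[OF assms(1) a] osp_length[OF assms(1)] by (simp add: osp_swap_def)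
qed

lemma osp_swap_same:
  assumes "\<sigma> \<in> OP n k" "1 \<le> i" "i < n" "blk \<sigma> i = blk \<sigma> (i + 1)"
  shows "osp_swap i \<sigma> = \<sigma>"
  by (rule osp_eqI[OF osp_swap_closed[OF assms(1-3)] assms(1)])
    (use assms in \<open>auto simp: blk_swap transpose_def\<close>)

lemma osp_swap_neq:
  assumes "\<sigma> \<in> OP n k" "1 \<le> i" "i < n" "blk \<sigma> i \<noteq> blk \<sigma> (i + 1)"
  shows "osp_swap i \<sigma> \<noteq> \<sigma>"
  using blk_swap[OF assms(1-3), of i] assms by auto


subsection \<open>Inversions\<close>

definition inversions :: "nat \<Rightarrow> nat set list \<Rightarrow> (nat \<times> nat) set" where
  "inversions n \<sigma> = {(a, b). a \<in> {1..n} \<and> b \<in> {1..n} \<and> a < b \<and> blk \<sigma> b < blk \<sigma> a}"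

definition inv_num :: "nat \<Rightarrow> nat set list \<Rightarrow> nat" where
  "inv_num n \<sigma> = card (inversions n \<sigma>)"

lemma finite_inversions: "finite (inversions n \<sigma>)"
  by (rule finite_subset[of _ "{1..n} \<times> {1..n}"]) (auto simp: inversions_def)

text \<open>
  The transposition permutes the pairs \<open>a < b\<close> other than \<open>(i, i + 1)\<close> without reversing them, and
  only this last pair becomes an inversion.
\<close>

lemma inv_num_swap:
  assumes \<sigma>: "\<sigma> \<in> OP n k" and i: "1 \<le> i" "i < n" and asc: "blk \<sigma> i < blk \<sigma> (i + 1)"
  shows "inv_num n (osp_swap i \<sigma>) = Suc (inv_num n \<sigma>)"
proof -
  let ?t = "adj i"
  let ?p = "\<lambda>(a, b). (?t a, ?t b)"
  have less: "?t a < ?t b" if "a < b" "(a, b) \<noteq> (i, i + 1)" for a b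
    using that by (auto simp: transpose_def)
  have "inversions n (osp_swap i \<sigma>) = insert (i, i + 1) (?p ` inversions n \<sigma>)"
  proof (intro equalityI subsetI)
    fix x assume x: "x \<in> inversions n (osp_swap i \<sigma>)"
    obtain a b where ab: "x = (a, b)" by (cases x)
    have *: "a \<in> {1..n}" "b \<in> {1..n}" "a < b" "blk \<sigma> (?t b) < blk \<sigma> (?t a)"
      using x blk_swap[OF \<sigma> i] by (auto simp: ab inversions_def)
    show "x \<in> insert (i, i + 1) (?p ` inversions n \<sigma>)"
    proof (cases "x = (i, i + 1)")
      case False
      then have "(?t a, ?t b) \<in> inversions n \<sigma>"
        using * less[of a b] adj_in[OF i] by (simp add: inversions_def ab del: atLeastAtMost_iff)
      then have "?p (?t a, ?t b) \<in> ?p ` inversions n \<sigma>" by (rule imageI)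
      then show ?thesis by (simp add: ab)
    qed simp
  next
    fix x assume "x \<in> insert (i, i + 1) (?p ` inversions n \<sigma>)"
    then show "x \<in> inversions n (osp_swap i \<sigma>)"
    proof
      assume "x = (i, i + 1)"
      then show ?thesis
        using asc i blk_swap[OF \<sigma> i, of i] blk_swap[OF \<sigma> i, of "i + 1"]
        by (simp add: inversions_def)
    next
      assume "x \<in> ?p ` inversions n \<sigma>"
      then obtain a b where ab: "(a, b) \<in> inversions n \<sigma>" "x = (?t a, ?t b)" by auto
      then have "(a, b) \<noteq> (i, i + 1)" using asc by (auto simp: inversions_def)
      then show ?thesis
        using ab less[of a b] blk_swap[OF \<sigma> i, of "?t a"] blk_swap[OF \<sigma> i, of "?t b"] adj_in[OF i]
        by (simp add: inversions_def del: atLeastAtMost_iff)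
    qed
  qed
  moreover have "(i, i + 1) \<notin> ?p ` inversions n \<sigma>"
  proof
    assume "(i, i + 1) \<in> ?p ` inversions n \<sigma>"
    then obtain a b where ab: "(a, b) \<in> inversions n \<sigma>" "?t a = i" "?t b = i + 1" by auto
    then have "a = i + 1" "b = i" by (auto simp: transpose_def split: if_splits)
    then show False using ab by (simp add: inversions_def)
  qed
  moreover have "inj_on ?p (inversions n \<sigma>)"
    by (rule inj_onI) (auto dest: injD[OF inj_transpose])
  ultimately show ?thesis
    by (simp add: inv_num_def card_image finite_inversions)
qed

lemma inv_num_swap_desc:
  assumes "\<sigma> \<in> OP n k" "1 \<le> i" "i < n" "blk \<sigma> (i + 1) < blk \<sigma> i"
  shows "inv_num n \<sigma> = Suc (inv_num n (osp_swap i \<sigma>))"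
proof -
  have "blk (osp_swap i \<sigma>) i < blk (osp_swap i \<sigma>) (i + 1)"
    using assms blk_swap[OF assms(1-3), of i] blk_swap[OF assms(1-3), of "i + 1"] by simp
  then show ?thesis
    using inv_num_swap[OF osp_swap_closed[OF assms(1-3)] assms(2,3)] by simp
qed

lemma inv_num_swap_le:
  assumes "\<sigma> \<in> OP n k" "1 \<le> i" "i < n"
  shows "inv_num n (osp_swap i \<sigma>) \<le> Suc (inv_num n \<sigma>)"
proof (cases "blk \<sigma> i" "blk \<sigma> (i + 1)" rule: linorder_cases)
  case less
  then show ?thesis using inv_num_swap[OF assms] by simp
next
  case equal
  then show ?thesis using osp_swap_same[OF assms] by simp
next
  case greater
  then show ?thesis using inv_num_swap_desc[OF assms] by simp
qed


section \<open>A point for each ordered set partition\<close>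

text \<open>
  The point of a partition has coordinates \<open>b, q b, q\<^sup>2 b, \<dots>\<close> along each block, where the initial
  value \<open>b\<close> depends only on the position of the block. The initial values are powers of \<open>q\<close> whose
  exponents are \<open>n + 2\<close> apart: even after one further multiplication by \<open>q\<close>, coordinates from
  different blocks are different. The coordinates outside \<open>{1..n}\<close> are \<open>0\<close>, so that swapping a partition
  and swapping the coordinates of its point agree as functions.
\<close>

definition block_count :: "nat set list \<Rightarrow> nat \<Rightarrow> nat \<Rightarrow> nat" where
  "block_count \<sigma> r i = card {b \<in> {1..i}. blk \<sigma> b = r}"

definition rank :: "nat set list \<Rightarrow> nat \<Rightarrow> nat" where
  "rank \<sigma> a = block_count \<sigma> (blk \<sigma> a) (a - 1)"

definition base :: "nat \<Rightarrow> nat \<Rightarrow> ratfun" where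
  "base n r = qvar ^ ((n + 2) * r)"

definition pt :: "nat \<Rightarrow> nat set list \<Rightarrow> nat \<Rightarrow> ratfun" where
  "pt n \<sigma> a = (if a \<in> {1..n} then base n (blk \<sigma> a) * qvar ^ rank \<sigma> a else 0)"

lemma block_count_le: "block_count \<sigma> r i \<le> i"
proof -
  have "card {b \<in> {1..i}. blk \<sigma> b = r} \<le> card {1..i}" by (rule card_mono) auto
  then show ?thesis by (simp add: block_count_def)
qed

lemma block_count_Suc:
  "block_count \<sigma> r (Suc i) = block_count \<sigma> r i + (if blk \<sigma> (Suc i) = r then 1 else 0)"
proof -
  have "{b \<in> {1..Suc i}. blk \<sigma> b = r} =
      (if blk \<sigma> (Suc i) = r then insert (Suc i) {b \<in> {1..i}. blk \<sigma> b = r} else {b \<in> {1..i}. blk \<sigma> b = r})"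
    by (auto simp: le_Suc_eq)
  then show ?thesis by (simp add: block_count_def)
qed

lemma rank_le: "a \<in> {1..n} \<Longrightarrow> rank \<sigma> a < n"
  using block_count_le[of \<sigma> "blk \<sigma> a" "a - 1"] by (auto simp: rank_def)

lemma rank_mono:
  assumes "1 \<le> a" "a < b" "blk \<sigma> a = blk \<sigma> b"
  shows "rank \<sigma> a < rank \<sigma> b"
proof -
  have "a \<in> {c \<in> {1..b - 1}. blk \<sigma> c = blk \<sigma> b}" "a \<notin> {c \<in> {1..a - 1}. blk \<sigma> c = blk \<sigma> a}"
    using assms by auto
  moreover have "{c \<in> {1..a - 1}. blk \<sigma> c = blk \<sigma> a} \<subseteq> {c \<in> {1..b - 1}. blk \<sigma> c = blk \<sigma> b}"
    using assms by auto
  ultimately show ?thesis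
    unfolding rank_def block_count_def by (intro psubset_card_mono) auto
qed

lemma rank_Suc_same:
  assumes "1 \<le> i" "blk \<sigma> (i + 1) = blk \<sigma> i"
  shows "rank \<sigma> (i + 1) = Suc (rank \<sigma> i)"
proof -
  obtain j where "i = Suc j" using assms by (cases i) auto
  then show ?thesis
    using assms block_count_Suc[of \<sigma> "blk \<sigma> i" j] by (simp add: rank_def Suc_eq_plus1)
qed

lemma pt_eq_power: "a \<in> {1..n} \<Longrightarrow> pt n \<sigma> a = qvar ^ ((n + 2) * blk \<sigma> a + rank \<sigma> a)"
  by (simp add: pt_def base_def power_add)

lemma exponent_eq_iff:
  assumes "u < n + 2" "v < n + 2"
  shows "(n + 2) * r + u = (n + 2) * s + v \<longleftrightarrow> r = s \<and> u = (v :: nat)"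
proof
  assume *: "(n + 2) * r + u = (n + 2) * s + v"
  have "((n + 2) * r + u) div (n + 2) = r" "((n + 2) * s + v) div (n + 2) = s"
    using assms by (simp_all del: add_2_eq_Suc')
  then show "r = s \<and> u = v" using * by auto
qed simp

lemma pt_eq_iff:
  assumes "a \<in> {1..n}" "b \<in> {1..n}"
  shows "pt n \<sigma> a = pt n \<tau> b \<longleftrightarrow> blk \<sigma> a = blk \<tau> b \<and> rank \<sigma> a = rank \<tau> b"
  using assms exponent_eq_iff[of "rank \<sigma> a" n "rank \<tau> b"] rank_le[of a n \<sigma>] rank_le[of b n \<tau>]
  by (simp add: pt_eq_power del: add_2_eq_Suc' distrib_right)

lemma pt_distinct:
  assumes "a \<in> {1..n}" "b \<in> {1..n}" "a \<noteq> b"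
  shows "pt n \<sigma> a \<noteq> pt n \<sigma> b"
proof
  assume "pt n \<sigma> a = pt n \<sigma> b"
  then have "blk \<sigma> a = blk \<sigma> b" "rank \<sigma> a = rank \<sigma> b"
    using pt_eq_iff[OF assms(1,2)] by auto
  then show False
    using rank_mono[of a b \<sigma>] rank_mono[of b a \<sigma>] assms by (cases "a < b") auto
qed

lemma pt_same_block:
  assumes "1 \<le> i" "i < n" "blk \<sigma> i = blk \<sigma> (i + 1)"
  shows "pt n \<sigma> (i + 1) = qvar * pt n \<sigma> i"
  using assms rank_Suc_same[of i \<sigma>] by (simp add: pt_def)

text \<open>
  This is what makes the coefficient of \<open>f(s\<^sub>i y)\<close> in the value of \<open>T\<^sub>i f\<close> nonzero.
\<close>

lemma pt_diff_block:
  assumes "1 \<le> i" "i < n" "blk \<sigma> i \<noteq> blk \<sigma> (i + 1)"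
  shows "pt n \<sigma> (i + 1) \<noteq> qvar * pt n \<sigma> i"
proof -
  have i: "i \<in> {1..n}" "i + 1 \<in> {1..n}" using assms by auto
  have "qvar * pt n \<sigma> i = qvar ^ ((n + 2) * blk \<sigma> i + Suc (rank \<sigma> i))"
    unfolding pt_eq_power[OF i(1)] by simp
  then show ?thesis
    using assms(3) exponent_eq_iff[of "rank \<sigma> (i + 1)" n "Suc (rank \<sigma> i)" "blk \<sigma> (i + 1)" "blk \<sigma> i"]
      rank_le[OF i(1), of \<sigma>] rank_le[OF i(2), of \<sigma>]
    unfolding pt_eq_power[OF i(2)] by (simp del: add_2_eq_Suc' distrib_right add_Suc_right)
qed

lemma pt_inj:
  assumes "\<sigma> \<in> OP n k" "\<tau> \<in> OP n k" "\<sigma> \<noteq> \<tau>"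
  obtains a where "a \<in> {1..n}" "pt n \<sigma> a \<noteq> pt n \<tau> a"
proof -
  obtain a where "a \<in> {1..n}" "blk \<sigma> a \<noteq> blk \<tau> a" using assms osp_eqI by blast
  then show thesis using that pt_eq_iff by blast
qed

text \<open>
  If \<open>i\<close> and \<open>i + 1\<close> lie in different blocks, swapping them keeps the order within every
  block and hence the exponents.
\<close>

lemma pt_swap:
  assumes \<sigma>: "\<sigma> \<in> OP n k" and i: "1 \<le> i" "i < n" and diff: "blk \<sigma> i \<noteq> blk \<sigma> (i + 1)"
  shows "pt n (osp_swap i \<sigma>) = pt n \<sigma> \<circ> adj i"
proof
  fix a
  show "pt n (osp_swap i \<sigma>) a = (pt n \<sigma> \<circ> adj i) a"
  proof (cases "a \<in> {1..n}")
    case False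
    then show ?thesis using adj_in[OF i] by (simp add: pt_def del: atLeastAtMost_iff)
  next
    case a: True
    let ?R = "\<lambda>\<sigma> a. {b \<in> {1..a - 1}. blk \<sigma> b = blk \<sigma> a}"
    let ?t = "adj i"
    have less: "b < a \<longleftrightarrow> ?t b < ?t a" if "blk \<sigma> (?t b) = blk \<sigma> (?t a)" for b
      using that diff by (cases "b = i"; cases "b = i + 1"; cases "a = i"; cases "a = i + 1") auto
    have ta: "?t a \<in> {1..n}" using a adj_in[OF i] by blast
    have R: "?R \<rho> c = {b \<in> {1..n}. b < c \<and> blk \<rho> b = blk \<rho> c}" if "c \<in> {1..n}" for \<rho> c
      using that by auto
    have "?R \<sigma> (?t a) = ?t ` ?R (osp_swap i \<sigma>) a"
      unfolding R[OF a] R[OF ta]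
    proof (intro equalityI subsetI)
      fix c assume c: "c \<in> {b \<in> {1..n}. b < ?t a \<and> blk \<sigma> b = blk \<sigma> (?t a)}"
      then have "?t c \<in> {b \<in> {1..n}. b < a \<and> blk (osp_swap i \<sigma>) b = blk (osp_swap i \<sigma>) a}"
        using a adj_in[OF i] less[of "?t c"] blk_swap[OF \<sigma> i] by (simp del: atLeastAtMost_iff)
      then have "?t (?t c) \<in> ?t ` {b \<in> {1..n}. b < a \<and> blk (osp_swap i \<sigma>) b = blk (osp_swap i \<sigma>) a}"
        by (rule imageI)
      then show "c \<in> ?t ` {b \<in> {1..n}. b < a \<and> blk (osp_swap i \<sigma>) b = blk (osp_swap i \<sigma>) a}"
        by simp
    next
      fix c assume "c \<in> ?t ` {b \<in> {1..n}. b < a \<and> blk (osp_swap i \<sigma>) b = blk (osp_swap i \<sigma>) a}"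
      then obtain b where "c = ?t b" "b \<in> {1..n}" "b < a" "blk (osp_swap i \<sigma>) b = blk (osp_swap i \<sigma>) a"
        by blast
      then show "c \<in> {b \<in> {1..n}. b < ?t a \<and> blk \<sigma> b = blk \<sigma> (?t a)}"
        using a adj_in[OF i] less[of b] blk_swap[OF \<sigma> i] by (simp del: atLeastAtMost_iff)
    qed
    then have "card (?R \<sigma> (?t a)) = card (?R (osp_swap i \<sigma>) a)"
      by (simp add: card_image inj_on_subset[OF inj_transpose])
    then have "rank (osp_swap i \<sigma>) a = rank \<sigma> (?t a)"
      by (simp add: rank_def block_count_def)
    then show ?thesis
      using a ta blk_swap[OF \<sigma> i a] by (simp add: pt_def del: atLeastAtMost_iff)
  qed
qed

text \<open>
  Lagrange interpolation: a product of linear factors, each separating \<open>\<sigma>\<close> from one other partition.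
\<close>

lemma interpolation:
  assumes "\<sigma> \<in> OP n k"
  obtains f where "f \<in> polys {1..n}"
    "\<And>\<tau>. \<tau> \<in> OP n k \<Longrightarrow> eval_poly (pt n \<tau>) f = (if \<tau> = \<sigma> then 1 else 0)"
proof -
  have "\<exists>g\<in>polys {1..n}. eval_poly (pt n \<sigma>) g = 1 \<and> eval_poly (pt n \<tau>) g = 0"
    if \<tau>: "\<tau> \<in> OP n k" "\<tau> \<noteq> \<sigma>" for \<tau>
  proof -
    obtain a where a: "a \<in> {1..n}" "pt n \<sigma> a \<noteq> pt n \<tau> a"
      by (rule pt_inj[of \<sigma> n k \<tau>]) (use \<tau> assms in auto)
    then show ?thesis
      by (intro bexI[of _ "Cst (inverse (pt n \<sigma> a - pt n \<tau> a)) * (Var a - Cst (pt n \<tau> a))"])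
        (auto simp: eval_mult eval_diff intro!: polys_mult polys_diff)
  qed
  then have "\<forall>\<tau>\<in>OP n k - {\<sigma>}. \<exists>g. g \<in> polys {1..n} \<and>
      eval_poly (pt n \<sigma>) g = 1 \<and> eval_poly (pt n \<tau>) g = 0" by blast
  from bchoice[OF this] obtain g where g: "\<And>\<tau>. \<tau> \<in> OP n k \<Longrightarrow> \<tau> \<noteq> \<sigma> \<Longrightarrow> g \<tau> \<in> polys {1..n} \<and>
      eval_poly (pt n \<sigma>) (g \<tau>) = 1 \<and> eval_poly (pt n \<tau>) (g \<tau>) = 0"
    by blast
  define f where "f = (\<Prod>\<tau>\<in>OP n k - {\<sigma>}. g \<tau>)"
  have "f \<in> polys {1..n}" unfolding f_def using g by (intro polys_prod) auto
  moreover have "eval_poly (pt n \<sigma>) f = 1"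
    unfolding f_def eval_prod using g by (intro prod.neutral) auto
  moreover have "eval_poly (pt n \<tau>) f = 0" if "\<tau> \<in> OP n k" "\<tau> \<noteq> \<sigma>" for \<tau>
    unfolding f_def eval_prod using g that finite_ordered_set_partitions[of n k]
    by (intro prod_zero) auto
  ultimately show thesis using that by simp
qed


subsection \<open>The generators at the points\<close>

definition polys_lt :: "nat \<Rightarrow> nat \<Rightarrow> mpoly set" where
  "polys_lt n d = {f \<in> polys {1..n}. \<forall>m\<in>keys f. mdeg m < d}"

lemma subspace_polys_lt: "VS.subspace (polys_lt n d)"
proof (rule VS.subspaceI)
  show "0 \<in> polys_lt n d" by (simp add: polys_lt_def)
  fix f g assume f: "f \<in> polys_lt n d" and g: "g \<in> polys_lt n d"
  have "mdeg m < d" if "m \<in> keys (f + g)" for m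
  proof -
    have "m \<in> keys f \<or> m \<in> keys g" using that keys_add[of f g] by blast
    then show ?thesis using f g unfolding polys_lt_def by blast
  qed
  then show "f + g \<in> polys_lt n d" using f g by (simp add: polys_lt_def polys_add)
next
  fix c f assume f: "f \<in> polys_lt n d"
  have "mdeg m < d" if "m \<in> keys (scale c f)" for m
    using that keys_scale_subset[of c f] f unfolding polys_lt_def by blast
  then show "scale c f \<in> polys_lt n d" using f by (simp add: polys_lt_def polys_scale)
qed

lemma homogeneous_in_polys_lt: "homogeneous e f \<Longrightarrow> f \<in> polys {1..n} \<Longrightarrow> e < d \<Longrightarrow> f \<in> polys_lt n d"
  by (simp add: polys_lt_def homogeneous_def)

lemma polys_lt_mult_homogeneous:
  assumes "homogeneous e h" "h \<in> polys {1..n}" "g \<in> polys_lt n d"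
  shows "h * g \<in> polys_lt n (e + d)"
proof -
  have "mdeg m < e + d" if m: "m \<in> keys (h * g)" for m
  proof -
    obtain a b where "m = a + b" "a \<in> keys h" "b \<in> keys g"
      using m keys_mult[of h g] by auto
    moreover from this have "mdeg a = e" "mdeg b < d"
      using assms unfolding homogeneous_def polys_lt_def by blast+
    ultimately show ?thesis by (simp add: mdeg_add)
  qed
  then show ?thesis using assms(2,3) by (simp add: polys_lt_def polys_mult)
qed

lemma fps_nth_prod_0: "fps_nth (\<Prod>x\<in>A. F x) 0 = (\<Prod>x\<in>A. fps_nth (F x) 0)"
  by (induction A rule: infinite_finite_induct) simp_all

lemma fps_prod_linear_nth_high:
  fixes c :: "'a \<Rightarrow> 'b::comm_ring_1"
  assumes "finite R" "card R < d"
  shows "fps_nth (\<Prod>a\<in>R. 1 + fps_const (c a) * fps_X) d = 0"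
  using assms
proof (induction R arbitrary: d)
  case (insert a R)
  obtain d' where d: "d = Suc d'" using insert.prems by (cases d) auto
  have "fps_nth ((1 + fps_const (c a) * fps_X) * F) d = fps_nth F d + c a * fps_nth F d'" for F
    by (simp add: d distrib_right mult.assoc)
  then show ?case using insert d by simp
qed simp

lemma fps_prod_linear_nth_top:
  fixes c :: "'a \<Rightarrow> 'b::comm_ring_1"
  assumes "finite R"
  shows "fps_nth (\<Prod>a\<in>R. 1 + fps_const (c a) * fps_X) (card R) = (\<Prod>a\<in>R. c a)"
  using assms
proof (induction R)
  case (insert a R)
  have "fps_nth ((1 + fps_const (c a) * fps_X) * F) (Suc d) = fps_nth F (Suc d) + c a * fps_nth F d" for F d
    by (simp add: distrib_right mult.assoc)
  then show ?case using insert by (simp add: fps_prod_linear_nth_high)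
qed simp

lemma eval_E_series: "eval.fps_hom y (E_series n) = (\<Prod>j=1..n. 1 + fps_const (y j) * fps_X)"
  unfolding E_series_def
  by (simp add: eval.fps_hom_prod eval.fps_hom_add eval.fps_hom_1 eval.fps_hom_mult
      eval.fps_hom_const eval.fps_hom_X)

lemma eval_HL_series: "eval.fps_hom y (HL_series i) = (\<Prod>j=1..i. HL_factor qvar (y j))"
  unfolding HL_series_def HL_factor_def
  by (simp add: eval.fps_hom_prod eval.fps_hom_diff eval.fps_hom_1 eval.fps_hom_mult eval_mult
      eval.fps_hom_const eval.fps_hom_X eval.fps_hom_geom)

text \<open>
  Every point has the \<open>k\<close> initial values of the progressions among its coordinates, at the
  smallest elements of the blocks. Dividing the generating function by their factors leaves a
  polynomial of degree \<open>n - k\<close>, so the coefficients of larger degree vanish, and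
  the division has the same constants for all partitions.
\<close>

lemma elem_sym_at_points:
  assumes "n < d + k"
  obtains g where "g \<in> polys_lt n d"
    "\<And>\<sigma>. \<sigma> \<in> OP n k \<Longrightarrow> eval_poly (pt n \<sigma>) (elem_sym d n) = eval_poly (pt n \<sigma>) g"
proof
  define G where "G = (\<Prod>r<k. geom_fps (- base n r))"
  define g where "g = - (\<Sum>a<d. scale (fps_nth G (d - a)) (elem_sym a n))"
  have G0: "fps_nth G 0 = 1" by (simp add: G_def fps_nth_prod_0 geom_fps_def)
  show "g \<in> polys_lt n d"
    unfolding g_def
    by (intro VS.subspace_neg[OF subspace_polys_lt] VS.subspace_sum[OF subspace_polys_lt]
        VS.subspace_scale[OF subspace_polys_lt])
      (auto intro!: homogeneous_in_polys_lt homogeneous_elem_sym polys_elem_sym)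
  fix \<sigma> assume \<sigma>: "\<sigma> \<in> OP n k"
  let ?y = "pt n \<sigma>"
  \<comment> \<open>the smallest elements of the blocks\<close>
  define M where "M = {a \<in> {1..n}. rank \<sigma> a = 0}"
  have sub: "M \<subseteq> {1..n}" by (auto simp: M_def)
  have bij: "bij_betw (blk \<sigma>) M {..<k}"
    unfolding bij_betw_def
  proof
    show "inj_on (blk \<sigma>) M"
    proof (rule inj_onI)
      fix a b assume "a \<in> M" "b \<in> M" "blk \<sigma> a = blk \<sigma> b"
      then show "a = b"
        using rank_mono[of a b \<sigma>] rank_mono[of b a \<sigma>] by (cases a b rule: linorder_cases) (auto simp: M_def)
    qed
    show "blk \<sigma> ` M = {..<k}"
    proof (intro equalityI subsetI)
      fix r assume "r \<in> {..<k}"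
      then obtain a where a: "a \<in> {1..n}" "blk \<sigma> a = r" using osp_block_nonempty[OF \<sigma>] by blast
      define m where "m = (LEAST b. b \<in> {1..n} \<and> blk \<sigma> b = r)"
      have m: "m \<in> {1..n} \<and> blk \<sigma> m = r" unfolding m_def by (rule LeastI[of _ a]) (use a in auto)
      have "m \<le> b" if "b \<in> {1..n}" "blk \<sigma> b = r" for b
        unfolding m_def by (rule Least_le) (use that in auto)
      then have "{b \<in> {1..m - 1}. blk \<sigma> b = blk \<sigma> m} = {}"
        using m by fastforce
      then have "m \<in> M" using m by (simp only: M_def rank_def block_count_def) simp
      then show "r \<in> blk \<sigma> ` M" using m by blast
    qed (use blk_props(1)[OF \<sigma>] in \<open>auto simp: M_def\<close>)
  qed
  have cardM: "card M = k" using bij_betw_same_card[OF bij] by simp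
  have "(\<Prod>a\<in>M. 1 + fps_const (?y a) * fps_X) = (\<Prod>a\<in>M. 1 + fps_const (base n (blk \<sigma> a)) * fps_X)"
    by (rule prod.cong) (auto simp: M_def pt_def)
  also have "\<dots> = (\<Prod>r<k. 1 + fps_const (base n r) * fps_X)"
    by (rule prod.reindex_bij_betw[OF bij])
  finally have "(\<Prod>a\<in>M. 1 + fps_const (?y a) * fps_X) * G =
      (\<Prod>r<k. (1 - fps_const (- base n r) * fps_X) * geom_fps (- base n r))"
    by (simp add: G_def prod.distrib fps_const_neg[symmetric] del: fps_const_neg)
  also have "\<dots> = 1" by (simp only: geom_fps_inverse prod.neutral_const)
  finally have MG: "(\<Prod>a\<in>M. 1 + fps_const (?y a) * fps_X) * G = 1" .
  have "eval.fps_hom ?y (E_series n) * G =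
      (\<Prod>a\<in>{1..n} - M. 1 + fps_const (?y a) * fps_X) * ((\<Prod>a\<in>M. 1 + fps_const (?y a) * fps_X) * G)"
    unfolding eval_E_series prod.subset_diff[OF sub finite_atLeastAtMost] by (simp only: mult.assoc)
  also have "\<dots> = (\<Prod>a\<in>{1..n} - M. 1 + fps_const (?y a) * fps_X)"
    by (simp only: MG mult_1_right)
  also have "fps_nth \<dots> d = 0"
    using assms cardM sub card_mono[OF finite_atLeastAtMost sub]
    by (intro fps_prod_linear_nth_high) (simp_all add: card_Diff_subset finite_subset[OF sub])
  finally have "fps_nth (eval.fps_hom ?y (E_series n) * G) d = 0" .
  moreover have "fps_nth (eval.fps_hom ?y (E_series n) * G) d =
      (\<Sum>a\<in>insert d {..<d}. eval_poly ?y (elem_sym a n) * fps_nth G (d - a))"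
    unfolding fps_mult_nth by (rule sum.cong) (auto simp: elem_sym_eq)
  ultimately show "eval_poly ?y (elem_sym d n) = eval_poly ?y g"
    by (simp add: g_def G0 eval.hom_sum eval_scale mult.commute eq_neg_iff_add_eq_0
        eval_diff[of _ 0, simplified])
qed

text \<open>
  The factors \<open>(1 - q y\<^sub>j t) / (1 - y\<^sub>j t)\<close> telescope along the geometric progression of a block.
\<close>

lemma HL_series_at_points:
  assumes "\<sigma> \<in> OP n k" "i \<le> n"
  shows "eval.fps_hom (pt n \<sigma>) (HL_series i) * (\<Prod>r<k. 1 - fps_const (base n r) * fps_X) =
    (\<Prod>r<k. 1 - fps_const (base n r * qvar ^ block_count \<sigma> r i) * fps_X)"
  using assms(2) unfolding eval_HL_series
proof (induction i)
  case 0
  show ?case by (simp add: block_count_def)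
next
  case (Suc i)
  let ?r = "blk \<sigma> (Suc i)"
  let ?y = "pt n \<sigma> (Suc i)"
  let ?F = "\<lambda>i r. 1 - fps_const (base n r * qvar ^ block_count \<sigma> r i) * fps_X"
  have r: "?r < k" using blk_props(1)[OF assms(1)] Suc.prems by simp
  have y: "?y = base n ?r * qvar ^ block_count \<sigma> ?r i" using Suc.prems by (simp add: pt_def rank_def)
  have IH: "(\<Prod>j = 1..i. HL_factor qvar (pt n \<sigma> j)) * (\<Prod>r<k. 1 - fps_const (base n r) * fps_X) =
      (\<Prod>r<k. ?F i r)"
    using Suc by simp
  have "(\<Prod>j = 1..Suc i. HL_factor qvar (pt n \<sigma> j)) * (\<Prod>r<k. 1 - fps_const (base n r) * fps_X) =
     HL_factor qvar ?y * (\<Prod>r<k. ?F i r)"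
    unfolding IH[symmetric] by (simp add: mult_ac)
  also have "(\<Prod>r<k. ?F i r) = ?F i ?r * (\<Prod>r\<in>{..<k} - {?r}. ?F i r)"
    using r by (intro prod.remove) auto
  also have "HL_factor qvar ?y * (?F i ?r * (\<Prod>r\<in>{..<k} - {?r}. ?F i r)) =
      ((1 - fps_const ?y * fps_X) * geom_fps ?y) * ((1 - fps_const (qvar * ?y) * fps_X) * (\<Prod>r\<in>{..<k} - {?r}. ?F i r))"
    by (simp only: HL_factor_def y mult_ac)
  also have "\<dots> = (1 - fps_const (qvar * ?y) * fps_X) * (\<Prod>r\<in>{..<k} - {?r}. ?F i r)"
    by (simp only: geom_fps_inverse mult_1_left)
  also have "1 - fps_const (qvar * ?y) * fps_X = ?F (Suc i) ?r"
    by (simp add: y block_count_Suc mult_ac flip: Suc_eq_plus1)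
  also have "(\<Prod>r\<in>{..<k} - {?r}. ?F i r) = (\<Prod>r\<in>{..<k} - {?r}. ?F (Suc i) r)"
    by (rule prod.cong) (auto simp: block_count_Suc)
  also have "?F (Suc i) ?r * \<dots> = (\<Prod>r<k. ?F (Suc i) r)"
    using r by (intro prod.remove[symmetric]) auto
  finally show ?case .
qed

lemma sum_block_count:
  assumes "\<sigma> \<in> OP n k" "i \<le> n"
  shows "(\<Sum>r<k. block_count \<sigma> r i) = i"
  using assms(2)
proof (induction i)
  case 0
  show ?case by (simp add: block_count_def)
next
  case (Suc i)
  have "blk \<sigma> (Suc i) < k" using blk_props(1)[OF assms(1)] Suc.prems by simp
  then show ?case using Suc by (simp add: block_count_Suc sum.distrib)
qed

text \<open>
  Multiplied by \<open>1 - b t\<close> for all \<open>k\<close> initial values \<open>b\<close>, the generating function becomes a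
  polynomial of degree \<open>k\<close>. Its top coefficient is the product of all \<open>- b\<close> and of \<open>q\<close> to the number of elements
  up to \<open>i\<close> in each block, in total \<open>q\<^sup>i\<close>, which is the same for all partitions.
\<close>

lemma hall_littlewood_at_points:
  assumes "1 \<le> k" "i \<le> n"
  obtains g where "g \<in> polys_lt n k"
    "\<And>\<sigma>. \<sigma> \<in> OP n k \<Longrightarrow> eval_poly (pt n \<sigma>) (hall_littlewood k i) = eval_poly (pt n \<sigma>) g"
proof
  define D where "D = (\<Prod>r<k. 1 - fps_const (base n r) * fps_X)"
  define C where "C = (\<Prod>r<k. - base n r) * qvar ^ i"
  define g0 where "g0 = Cst C - (\<Sum>a<k. scale (fps_nth D (k - a)) (fps_nth (HL_series i) a))"
  define g where "g = scale (inverse (1 - qvar)) g0"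
  have D0: "fps_nth D 0 = 1" by (simp add: D_def fps_nth_prod_0)
  have HL: "fps_nth (HL_series i) a \<in> polys {1..n}" for a
    using polys_HL_series[of i a] polys_mono[of "{1..i}" "{1..n}"] assms(2) by auto
  show "g \<in> polys_lt n k"
    unfolding g_def g0_def using assms
    by (intro VS.subspace_diff[OF subspace_polys_lt] VS.subspace_sum[OF subspace_polys_lt]
        VS.subspace_scale[OF subspace_polys_lt])
      (auto intro!: homogeneous_in_polys_lt[OF homogeneous_Cst] HL
        homogeneous_in_polys_lt[OF homogeneous_HL_series])
  fix \<sigma> assume \<sigma>: "\<sigma> \<in> OP n k"
  let ?y = "pt n \<sigma>"
  have "fps_nth (eval.fps_hom ?y (HL_series i) * D) k =
      fps_nth (\<Prod>r<k. 1 + fps_const (- (base n r * qvar ^ block_count \<sigma> r i)) * fps_X) (card {..<k})"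
    unfolding D_def HL_series_at_points[OF \<sigma> assms(2)]
    by (simp add: fps_const_neg[symmetric] del: fps_const_neg)
  also have "\<dots> = (\<Prod>r<k. (- base n r) * qvar ^ block_count \<sigma> r i)"
    by (subst fps_prod_linear_nth_top) simp_all
  also have "\<dots> = C"
    unfolding prod.distrib C_def power_sum[symmetric] sum_block_count[OF \<sigma> assms(2)] ..
  finally have "C = (\<Sum>a\<in>insert k {..<k}. eval_poly ?y (fps_nth (HL_series i) a) * fps_nth D (k - a))"
    unfolding fps_mult_nth by (subst (asm) sum.cong[of _ "insert k {..<k}"]) auto
  then have "eval_poly ?y (fps_nth (HL_series i) k) = eval_poly ?y g0"
    by (simp add: g0_def D0 eval.hom_sum eval_scale eval_diff mult.commute)
  then show "eval_poly ?y (hall_littlewood k i) = eval_poly ?y g"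
    by (simp add: hall_littlewood_eq g_def eval_scale)
qed


section \<open>Functionals indexed by ordered set partitions\<close>

text \<open>
  For a partition without descents the functional is the evaluation at its point; otherwise
  it is defined from the partition with a descent removed. The descent is chosen arbitrarily.
\<close>

definition descent :: "nat \<Rightarrow> nat set list \<Rightarrow> nat \<Rightarrow> bool" where
  "descent n \<sigma> i \<longleftrightarrow> 1 \<le> i \<and> i < n \<and> blk \<sigma> (i + 1) < blk \<sigma> i"

definition descent_of :: "nat \<Rightarrow> nat set list \<Rightarrow> nat" where
  "descent_of n \<sigma> = (SOME i. descent n \<sigma> i)"

lemma descent_of: "descent n \<sigma> i \<Longrightarrow> descent n \<sigma> (descent_of n \<sigma>)"
  unfolding descent_of_def by (rule someI)

function lam :: "nat \<Rightarrow> nat \<Rightarrow> nat set list \<Rightarrow> mpoly \<Rightarrow> ratfun" where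
  "lam n k \<sigma> f =
    (if \<sigma> \<in> OP n k \<and> (\<exists>i. descent n \<sigma> i)
     then lam n k (osp_swap (descent_of n \<sigma>) \<sigma>) (poly_T (descent_of n \<sigma>) f)
     else eval_poly (pt n \<sigma>) f)"
  by pat_completeness auto
termination
proof (relation "measure (\<lambda>(n, k, \<sigma>, f). inv_num n \<sigma>)")
  fix n k \<sigma> and f :: mpoly
  assume *: "\<sigma> \<in> OP n k \<and> (\<exists>i. descent n \<sigma> i)"
  then have "descent n \<sigma> (descent_of n \<sigma>)" using descent_of by blast
  then have "inv_num n \<sigma> = Suc (inv_num n (osp_swap (descent_of n \<sigma>) \<sigma>))"
    using * inv_num_swap_desc unfolding descent_def by blast
  then show "((n, k, osp_swap (descent_of n \<sigma>) \<sigma>, poly_T (descent_of n \<sigma>) f), (n, k, \<sigma>, f))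
      \<in> measure (\<lambda>(n, k, \<sigma>, f). inv_num n \<sigma>)"
    by simp
qed simp

declare lam.simps [simp del]

lemma lam_descent_of:
  assumes "\<sigma> \<in> OP n k" "descent n \<sigma> i"
  shows "lam n k \<sigma> f = lam n k (osp_swap (descent_of n \<sigma>) \<sigma>) (poly_T (descent_of n \<sigma>) f)"
  using assms by (subst lam.simps) auto

lemma lam_sorted:
  assumes "\<And>i. \<not> descent n \<sigma> i"
  shows "lam n k \<sigma> f = eval_poly (pt n \<sigma>) f"
  using assms by (subst lam.simps) auto

text \<open>
  In a descent step the induction hypothesis is available for all partitions with
  fewer inversions, as comparing two descents leads to partitions two or three steps below.
\<close>

lemma lam_induct [consumes 1, case_names sorted descent]:
  assumes "\<sigma> \<in> OP n k"
    and "\<And>\<sigma>. \<lbrakk>\<sigma> \<in> OP n k; \<And>i. \<not> descent n \<sigma> i\<rbrakk> \<Longrightarrow> Q \<sigma>"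
    and "\<And>\<sigma> i. \<lbrakk>\<sigma> \<in> OP n k; i = descent_of n \<sigma>; descent n \<sigma> i; osp_swap i \<sigma> \<in> OP n k;
           inv_num n \<sigma> = Suc (inv_num n (osp_swap i \<sigma>));
           \<And>\<tau>. \<lbrakk>\<tau> \<in> OP n k; inv_num n \<tau> < inv_num n \<sigma>\<rbrakk> \<Longrightarrow> Q \<tau>\<rbrakk> \<Longrightarrow> Q \<sigma>"
  shows "Q \<sigma>"
  using assms(1)
proof (induction "inv_num n \<sigma>" arbitrary: \<sigma> rule: less_induct)
  case less
  show ?case
  proof (cases "\<exists>i. descent n \<sigma> i")
    case True
    then have "descent n \<sigma> (descent_of n \<sigma>)" using descent_of by blast
    then show ?thesis
      using less osp_swap_closed[OF less.prems] inv_num_swap_desc[OF less.prems]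
      by (intro assms(3)[OF less.prems refl]) (auto simp: descent_def)
  next
    case False
    then show ?thesis using assms(2) less.prems by blast
  qed
qed

lemma lam_add: "\<sigma> \<in> OP n k \<Longrightarrow> lam n k \<sigma> (f + g) = lam n k \<sigma> f + lam n k \<sigma> g"
  and lam_scale: "\<sigma> \<in> OP n k \<Longrightarrow> lam n k \<sigma> (scale c f) = c * lam n k \<sigma> f"
proof -
  assume \<sigma>: "\<sigma> \<in> OP n k"
  show "lam n k \<sigma> (f + g) = lam n k \<sigma> f + lam n k \<sigma> g"
    using \<sigma>
  proof (induction arbitrary: f g rule: lam_induct)
    case (sorted \<sigma>)
    then show ?case by (simp add: lam_sorted eval_add)
  next
    case (descent \<sigma> i)
    have def: "lam n k \<sigma> f = lam n k (osp_swap i \<sigma>) (poly_T i f)" for f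
      using lam_descent_of[OF descent(1,3)] descent(2) by simp
    have "lam n k (osp_swap i \<sigma>) (poly_T i f + poly_T i g) =
        lam n k (osp_swap i \<sigma>) (poly_T i f) + lam n k (osp_swap i \<sigma>) (poly_T i g)"
      by (rule descent.IH[OF descent(4)]) (simp add: descent(5))
    then show ?case
      by (simp only: def poly_T_add)
  qed
  show "lam n k \<sigma> (scale c f) = c * lam n k \<sigma> f"
    using \<sigma>
  proof (induction arbitrary: f rule: lam_induct)
    case (sorted \<sigma>)
    then show ?case by (simp add: lam_sorted eval_scale)
  next
    case (descent \<sigma> i)
    have def: "lam n k \<sigma> f = lam n k (osp_swap i \<sigma>) (poly_T i f)" for f
      using lam_descent_of[OF descent(1,3)] descent(2) by simp
    have "lam n k (osp_swap i \<sigma>) (scale c (poly_T i f)) = c * lam n k (osp_swap i \<sigma>) (poly_T i f)"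
      by (rule descent.IH[OF descent(4)]) (simp add: descent(5))
    then show ?case
      by (simp only: def poly_T_scale)
  qed
qed

lemma poly_T_at_pt:
  assumes "\<sigma> \<in> OP n k" "1 \<le> i" "i < n"
  shows "eval_poly (pt n \<sigma>) (poly_T i f) = qvar * eval_poly (pt n \<sigma>) f +
    (pt n \<sigma> (i + 1) - qvar * pt n \<sigma> i) / (pt n \<sigma> i - pt n \<sigma> (i + 1)) *
      (eval_poly (pt n \<sigma>) f - eval_poly (pt n (osp_swap i \<sigma>)) f)"
proof -
  have "pt n \<sigma> i \<noteq> pt n \<sigma> (i + 1)" using assms by (intro pt_distinct) auto
  note eval_poly_T[OF this, of f]
  moreover have "pt n \<sigma> (i + 1) - qvar * pt n \<sigma> i = 0 \<or>
      eval_poly (pt n \<sigma> \<circ> adj i) f = eval_poly (pt n (osp_swap i \<sigma>)) f"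
    using pt_same_block[OF assms(2,3)] pt_swap[OF assms] by (cases "blk \<sigma> i = blk \<sigma> (i + 1)") auto
  ultimately show ?thesis by auto
qed

lemma poly_T_at_pt_same:
  assumes "1 \<le> i" "i < n" "blk \<sigma> i = blk \<sigma> (i + 1)"
  shows "eval_poly (pt n \<sigma>) (poly_T i f) = qvar * eval_poly (pt n \<sigma>) f"
proof -
  have "pt n \<sigma> i \<noteq> pt n \<sigma> (i + 1)" using assms by (intro pt_distinct) auto
  then show ?thesis using eval_poly_T[of "pt n \<sigma>" i f] pt_same_block[OF assms] by simp
qed

text \<open>
  Composing with \<open>T\<^sub>i\<close> stays within the span of the evaluations at the points.
\<close>

lemma lam_cong:
  assumes "\<sigma> \<in> OP n k" "\<And>\<tau>. \<tau> \<in> OP n k \<Longrightarrow> eval_poly (pt n \<tau>) f = eval_poly (pt n \<tau>) g"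
  shows "lam n k \<sigma> f = lam n k \<sigma> g"
  using assms
proof (induction arbitrary: f g rule: lam_induct)
  case (sorted \<sigma>)
  then show ?case by (simp add: lam_sorted)
next
  case (descent \<sigma> i)
  have i: "1 \<le> i" "i < n" using descent(3) by (auto simp: descent_def)
  have "lam n k (osp_swap i \<sigma>) (poly_T i f) = lam n k (osp_swap i \<sigma>) (poly_T i g)"
  proof (rule descent.IH[OF descent(4)])
    show "eval_poly (pt n \<tau>) (poly_T i f) = eval_poly (pt n \<tau>) (poly_T i g)" if "\<tau> \<in> OP n k" for \<tau>
      using poly_T_at_pt[OF that i] descent.prems[OF that] descent.prems[OF osp_swap_closed[OF that i]]
      by simp
  qed (simp add: descent(5))
  then show ?case
    using lam_descent_of[OF descent(1,3)] descent(2) by simp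
qed

text \<open>
  By induction on the number of inversions, any descent \<open>j\<close> may be used in place of the chosen descent \<open>i\<close>.
  If \<open>i\<close> and \<open>j\<close> are not adjacent, both can be removed, in either order, and the
  operators commute. If they are adjacent, three consecutive elements are in reversed order, both ways of
  sorting them end in the same partition, and the braid relation applies. The second claim, for \<open>j\<close> and
  \<open>j + 1\<close> in the same block, has to be proved along with the first: it moves down along
  the chosen descent by the same two relations.
\<close>

lemma lam_swap_and_same:
  assumes "\<sigma> \<in> OP n k"
  shows "(\<forall>j f. descent n \<sigma> j \<longrightarrow> lam n k \<sigma> f = lam n k (osp_swap j \<sigma>) (poly_T j f)) \<and>
    (\<forall>j f. 1 \<le> j \<longrightarrow> j < n \<longrightarrow> blk \<sigma> j = blk \<sigma> (j + 1) \<longrightarrow> lam n k \<sigma> (poly_T j f) = qvar * lam n k \<sigma> f)"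
  using assms
proof (induction rule: lam_induct)
  case (sorted \<sigma>)
  then show ?case by (simp add: lam_sorted poly_T_at_pt_same)
next
  case (descent \<sigma> i)
  note \<sigma> = descent(1)
  have def: "lam n k \<sigma> f = lam n k (osp_swap i \<sigma>) (poly_T i f)" for f
    using lam_descent_of[OF descent(1,3)] descent(2) by simp
  have i: "1 \<le> i" "i < n" using descent(3) by (auto simp: descent_def)
  have blk_i: "blk (osp_swap j \<tau>) a = blk \<tau> (adj j a)"
    if "\<tau> \<in> OP n k" "1 \<le> j" "j < n" "1 \<le> a" "a \<le> n" for \<tau> j a
    using blk_swap[of \<tau> n k j a] that by auto
  have step: "lam n k \<tau> f = lam n k (osp_swap j \<tau>) (poly_T j f)" "osp_swap j \<tau> \<in> OP n k"
     "inv_num n (osp_swap j \<tau>) < inv_num n \<tau>"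
    if "\<tau> \<in> OP n k" "inv_num n \<tau> < inv_num n \<sigma>" "descent n \<tau> j" for \<tau> j f
    using descent.IH[OF that(1,2)] that osp_swap_closed[of \<tau> n k j] inv_num_swap_desc[of \<tau> n k j]
    by (auto simp: descent_def)
  have same: "lam n k \<tau> (poly_T j f) = qvar * lam n k \<tau> f"
    if "\<tau> \<in> OP n k" "inv_num n \<tau> < inv_num n \<sigma>" "1 \<le> j" "j < n" "blk \<tau> j = blk \<tau> (j + 1)" for \<tau> j f
    using descent.IH[OF that(1,2)] that by auto
  have first: "osp_swap j \<sigma> \<in> OP n k" "inv_num n (osp_swap j \<sigma>) < inv_num n \<sigma>" if "descent n \<sigma> j" for j
    using that osp_swap_closed[OF \<sigma>, of j] inv_num_swap_desc[OF \<sigma>, of j] by (auto simp: descent_def)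
  show ?case
  proof (intro conjI allI impI)
    fix j f
    assume j: "descent n \<sigma> j"
    then have jn: "1 \<le> j" "j < n" by (auto simp: descent_def)
    have far: "lam n k (osp_swap a \<sigma>) (poly_T a f) = lam n k (osp_swap b \<sigma>) (poly_T b f)"
      if a: "descent n \<sigma> a" and b: "descent n \<sigma> b" and ab: "a + 1 < b" for a b
    proof -
      have an: "1 \<le> a" "a < n" "1 \<le> b" "b < n" using a b by (auto simp: descent_def)
      have da: "descent n (osp_swap a \<sigma>) b" "descent n (osp_swap b \<sigma>) a"
        using a b ab an \<sigma> by (auto simp: descent_def blk_i transpose_def)
      show ?thesis
        using step(1)[OF first[OF a] da(1)] step(1)[OF first[OF b] da(2)]
          poly_T_commute[OF ab, of f] osp_swap_commute[OF ab, of \<sigma>] by (simp only:)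
    qed
    have near: "lam n k (osp_swap a \<sigma>) (poly_T a f) = lam n k (osp_swap (a + 1) \<sigma>) (poly_T (a + 1) f)"
      if a: "descent n \<sigma> a" and b: "descent n \<sigma> (a + 1)" for a
    proof -
      let ?b = "a + 1"
      have an: "1 \<le> a" "a + 1 < n" using a b by (auto simp: descent_def)
      have b2: "blk \<sigma> (a + 2) < blk \<sigma> (a + 1)" "blk \<sigma> (a + 1) < blk \<sigma> a"
        using a b by (auto simp: descent_def add.assoc)
      have da: "descent n (osp_swap a \<sigma>) ?b" "descent n (osp_swap ?b \<sigma>) a"
        using b2 an \<sigma> by (auto simp: descent_def blk_i transpose_def add.assoc)
      note sa = step[OF first[OF a] da(1)] and sb = step[OF first[OF b] da(2)]
      have da2: "descent n (osp_swap ?b (osp_swap a \<sigma>)) a" "descent n (osp_swap a (osp_swap ?b \<sigma>)) ?b"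
        using b2 an \<sigma> first(1)[OF a] first(1)[OF b]
        by (auto simp: descent_def blk_i transpose_def add.assoc)
      have "inv_num n (osp_swap ?b (osp_swap a \<sigma>)) < inv_num n \<sigma>"
        "inv_num n (osp_swap a (osp_swap ?b \<sigma>)) < inv_num n \<sigma>"
        using sa(3) sb(3) first(2)[OF a] first(2)[OF b] by auto
      then show ?thesis
        using sa(1) sb(1) step(1)[OF sa(2) _ da2(1)] step(1)[OF sb(2) _ da2(2)]
          poly_T_braid[of a f] osp_swap_braid[of a \<sigma>] by (simp only:)
    qed
    consider "i = j" | "i + 1 < j" | "j + 1 < i" | "j = i + 1" | "i = j + 1" by linarith
    then show "lam n k \<sigma> f = lam n k (osp_swap j \<sigma>) (poly_T j f)"
    proof cases
      case 1
      then show ?thesis using def by simp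
    next
      case 2
      then show ?thesis unfolding def by (rule far[OF descent(3) j])
    next
      case 3
      then show ?thesis unfolding def by (rule far[OF j descent(3), symmetric])
    next
      case 4
      then show ?thesis unfolding def using near[OF descent(3)] j by (simp only:)
    next
      case 5
      then show ?thesis unfolding def using near[OF j] descent(3) by (simp only:)
    qed
  next
    fix j f
    assume j: "1 \<le> j" "j < n" "blk \<sigma> j = blk \<sigma> (j + 1)"
    note f0 = first[OF descent(3)]
    have desc: "blk \<sigma> (i + 1) < blk \<sigma> i" using descent(3) by (simp add: descent_def)
    then have "i \<noteq> j" using j by auto
    then consider "i + 1 < j" | "j + 1 < i" | "j = i + 1" | "i = j + 1" by linarith
    then show "lam n k \<sigma> (poly_T j f) = qvar * lam n k \<sigma> f"
    proof cases
      case 1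
      then have "blk (osp_swap i \<sigma>) j = blk (osp_swap i \<sigma>) (j + 1)"
        using j i \<sigma> by (simp add: blk_i transpose_def)
      then show ?thesis
        unfolding def poly_T_commute[OF 1] using j by (intro same[OF f0])
    next
      case 2
      then have "blk (osp_swap i \<sigma>) j = blk (osp_swap i \<sigma>) (j + 1)"
        using j i \<sigma> by (simp add: blk_i transpose_def)
      then show ?thesis
        unfolding def poly_T_commute[OF 2, symmetric] using j by (intro same[OF f0])
    next
      case 3
      have b2: "blk \<sigma> (i + 2) = blk \<sigma> (i + 1)" using j 3 by (simp add: add.assoc)
      have n: "i + 1 < n" using j 3 by simp
      have d1: "descent n (osp_swap i \<sigma>) (i + 1)"
        using b2 desc i n \<sigma> by (auto simp: descent_def blk_i transpose_def add.assoc)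
      note s = step[OF f0 d1]
      have e: "blk (osp_swap (i + 1) (osp_swap i \<sigma>)) i = blk (osp_swap (i + 1) (osp_swap i \<sigma>)) (i + 1)"
        using b2 i n \<sigma> f0 by (simp add: blk_i transpose_def add.assoc)
      have l: "inv_num n (osp_swap (i + 1) (osp_swap i \<sigma>)) < inv_num n \<sigma>"
        using s(3) f0 by simp
      have "lam n k \<sigma> (poly_T j f) =
          lam n k (osp_swap (i + 1) (osp_swap i \<sigma>)) (poly_T (i + 1) (poly_T i (poly_T (i + 1) f)))"
        unfolding def s(1) 3 ..
      also have "\<dots> = qvar * lam n k (osp_swap (i + 1) (osp_swap i \<sigma>)) (poly_T (i + 1) (poly_T i f))"
        unfolding poly_T_braid[symmetric] by (rule same[OF s(2) l i e])
      also have "\<dots> = qvar * lam n k \<sigma> f"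
        unfolding def s(1) ..
      finally show ?thesis .
    next
      case 4
      have b2: "blk \<sigma> (j + 2) < blk \<sigma> (j + 1)" using desc 4 by (simp add: add.assoc)
      have n: "j + 1 < n" using i 4 by simp
      note f0 = f0[unfolded 4]
      have d1: "descent n (osp_swap (j + 1) \<sigma>) j"
        using b2 j n \<sigma> by (auto simp: descent_def blk_i transpose_def add.assoc)
      note s = step[OF f0 d1]
      have e: "blk (osp_swap j (osp_swap (j + 1) \<sigma>)) (j + 1) =
          blk (osp_swap j (osp_swap (j + 1) \<sigma>)) (j + 1 + 1)"
        using b2 j n \<sigma> f0 by (simp add: blk_i transpose_def add.assoc)
      have l: "inv_num n (osp_swap j (osp_swap (j + 1) \<sigma>)) < inv_num n \<sigma>"
        using s(3) f0 by simp
      have def': "lam n k \<sigma> g = lam n k (osp_swap j (osp_swap (j + 1) \<sigma>)) (poly_T j (poly_T (j + 1) g))" for g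
        using def[of g] s(1) 4 by simp
      have "lam n k \<sigma> (poly_T j f) =
          lam n k (osp_swap j (osp_swap (j + 1) \<sigma>)) (poly_T (j + 1) (poly_T j (poly_T (j + 1) f)))"
        using def'[of "poly_T j f"] poly_T_braid[of j f] by simp
      also have "\<dots> = qvar * lam n k (osp_swap j (osp_swap (j + 1) \<sigma>)) (poly_T j (poly_T (j + 1) f))"
        using n by (intro same[OF s(2) l _ n e]) simp
      also have "\<dots> = qvar * lam n k \<sigma> f"
        using def'[of f] by simp
      finally show ?thesis .
    qed
  qed
qed

lemma lam_poly_T_same:
  assumes "\<sigma> \<in> OP n k" "1 \<le> i" "i < n" "blk \<sigma> i = blk \<sigma> (i + 1)"
  shows "lam n k \<sigma> (poly_T i f) = qvar * lam n k \<sigma> f"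
  using lam_swap_and_same[OF assms(1)] assms by blast

lemma lam_poly_T_ascent:
  assumes "\<sigma> \<in> OP n k" "1 \<le> i" "i < n" "blk \<sigma> i < blk \<sigma> (i + 1)"
  shows "lam n k \<sigma> (poly_T i f) = lam n k (osp_swap i \<sigma>) f"
proof -
  have "descent n (osp_swap i \<sigma>) i"
    using assms blk_swap[OF assms(1-3), of i] blk_swap[OF assms(1-3), of "i + 1"] by (simp add: descent_def)
  then have "lam n k (osp_swap i \<sigma>) f = lam n k (osp_swap i (osp_swap i \<sigma>)) (poly_T i f)"
    using lam_swap_and_same[OF osp_swap_closed[OF assms(1-3)]] by blast
  then show ?thesis by simp
qed

lemma lam_poly_T_descent:
  assumes "\<sigma> \<in> OP n k" "1 \<le> i" "i < n" "blk \<sigma> (i + 1) < blk \<sigma> i"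
  shows "lam n k \<sigma> (poly_T i f) = (qvar - 1) * lam n k \<sigma> f + qvar * lam n k (osp_swap i \<sigma>) f"
proof -
  have "descent n \<sigma> i" using assms by (simp add: descent_def)
  then have *: "lam n k \<sigma> g = lam n k (osp_swap i \<sigma>) (poly_T i g)" for g
    using lam_swap_and_same[OF assms(1)] by blast
  show ?thesis
    unfolding *[of "poly_T i f"] *[of f] poly_T_quadratic
    using osp_swap_closed[OF assms(1-3)] by (simp add: lam_add lam_scale)
qed

text \<open>
  Modulo evaluations at points with fewer inversions, the functional of \<open>\<sigma>\<close> is a nonzero multiple of
  the evaluation at the point of \<open>\<sigma>\<close>: each removal of a descent contributes the coefficient of
  \<open>f(s\<^sub>i y)\<close> in the value of \<open>T\<^sub>i f\<close> at \<open>y\<close>.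
\<close>

lemma lam_triangular:
  assumes "\<sigma> \<in> OP n k"
  shows "\<exists>c. c \<noteq> 0 \<and> (\<forall>f. (\<forall>\<tau>\<in>OP n k. inv_num n \<tau> < inv_num n \<sigma> \<longrightarrow> eval_poly (pt n \<tau>) f = 0) \<longrightarrow>
    lam n k \<sigma> f = c * eval_poly (pt n \<sigma>) f)"
  using assms
proof (induction rule: lam_induct)
  case (sorted \<sigma>)
  then show ?case by (intro exI[of _ 1]) (simp add: lam_sorted)
next
  case (descent \<sigma> i)
  let ?\<rho> = "osp_swap i \<sigma>"
  have i: "1 \<le> i" "i < n" "blk \<sigma> (i + 1) < blk \<sigma> i" using descent(3) by (auto simp: descent_def)
  obtain c where c: "c \<noteq> 0" "\<And>f. (\<And>\<tau>. \<lbrakk>\<tau> \<in> OP n k; inv_num n \<tau> < inv_num n ?\<rho>\<rbrakk> \<Longrightarrow> eval_poly (pt n \<tau>) f = 0)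
     \<Longrightarrow> lam n k ?\<rho> f = c * eval_poly (pt n ?\<rho>) f"
    using descent.IH[OF descent(4)] descent(5) by auto
  define e where "e = (pt n ?\<rho> (i + 1) - qvar * pt n ?\<rho> i) / (pt n ?\<rho> i - pt n ?\<rho> (i + 1))"
  have ne: "blk ?\<rho> i \<noteq> blk ?\<rho> (i + 1)"
    using blk_swap[OF descent(1) i(1,2), of i] blk_swap[OF descent(1) i(1,2), of "i + 1"] i by simp
  have "pt n ?\<rho> i \<noteq> pt n ?\<rho> (i + 1)" using i by (intro pt_distinct) auto
  then have e: "e \<noteq> 0" using pt_diff_block[OF i(1,2) ne] by (simp add: e_def)
  have "lam n k \<sigma> f = - c * e * eval_poly (pt n \<sigma>) f"
    if f: "\<forall>\<tau>\<in>OP n k. inv_num n \<tau> < inv_num n \<sigma> \<longrightarrow> eval_poly (pt n \<tau>) f = 0" for f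
  proof -
    have "lam n k \<sigma> f = lam n k ?\<rho> (poly_T i f)"
      using lam_descent_of[OF descent(1,3)] descent(2) by simp
    also have "\<dots> = c * eval_poly (pt n ?\<rho>) (poly_T i f)"
    proof (rule c(2))
      fix \<tau> assume \<tau>: "\<tau> \<in> OP n k" "inv_num n \<tau> < inv_num n ?\<rho>"
      have "eval_poly (pt n \<tau>) f = 0" using f \<tau> descent(5) by auto
      moreover have "eval_poly (pt n (osp_swap i \<tau>)) f = 0"
        using f \<tau> descent(5) osp_swap_closed[OF \<tau>(1) i(1,2)] inv_num_swap_le[OF \<tau>(1) i(1,2)] by auto
      ultimately show "eval_poly (pt n \<tau>) (poly_T i f) = 0"
        using poly_T_at_pt[OF \<tau>(1) i(1,2), of f] by simp
    qed
    also have "eval_poly (pt n ?\<rho>) (poly_T i f) = - e * eval_poly (pt n \<sigma>) f"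
    proof -
      have "eval_poly (pt n ?\<rho>) f = 0" using f descent by auto
      then show ?thesis
        using poly_T_at_pt[OF descent(4) i(1,2), of f] by (simp add: e_def)
    qed
    finally show ?thesis by simp
  qed
  then show ?case using c(1) e by (intro exI[of _ "- c * e"]) auto
qed


section \<open>The equivariant map to ordered set partitions\<close>

text \<open>
  The functional of \<open>\<sigma>\<close> transforms like the pairing with \<open>\<sigma>\<close> under the invariant form introduced
  below, which is the coordinate at \<open>\<sigma>\<close> times \<open>q\<close> to the number of inversions.
\<close>

definition psi :: "nat \<Rightarrow> nat \<Rightarrow> mpoly \<Rightarrow> (nat set list \<Rightarrow>\<^sub>0 ratfun)" where
  "psi n k f = (\<Sum>\<sigma>\<in>OP n k. single \<sigma> (lam n k \<sigma> f / qvar ^ inv_num n \<sigma>))"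

definition osp_space :: "nat \<Rightarrow> nat \<Rightarrow> (nat set list \<Rightarrow>\<^sub>0 ratfun) set" where
  "osp_space n k = {v. keys v \<subseteq> OP n k}"

lemma lookup_psi:
  "lookup (psi n k f) \<sigma> = (if \<sigma> \<in> OP n k then lam n k \<sigma> f / qvar ^ inv_num n \<sigma> else 0)"
  by (simp add: psi_def lookup_sum lookup_single when_def finite_ordered_set_partitions)

lemma linmap_psi: "linmap (psi n k)"
  by (rule linmapI)
    (auto intro!: poly_mapping_eqI simp: lookup_psi lookup_add lam_add lam_scale add_divide_distrib)

lemma psi_in_osp_space: "psi n k f \<in> osp_space n k"
  by (auto simp: osp_space_def in_keys_iff lookup_psi split: if_splits)

lemma subspace_osp_space: "VS.subspace (osp_space n k)"
proof (rule VS.subspaceI)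
  fix u v assume "u \<in> osp_space n k" "v \<in> osp_space n k"
  then show "u + v \<in> osp_space n k" using keys_add[of u v] unfolding osp_space_def by blast
next
  fix c v assume "v \<in> osp_space n k"
  then show "scale c v \<in> osp_space n k" using keys_scale_subset[of c v] unfolding osp_space_def by blast
qed (simp add: osp_space_def)

lemma psi_cong:
  assumes "\<And>\<sigma>. \<sigma> \<in> OP n k \<Longrightarrow> eval_poly (pt n \<sigma>) f = eval_poly (pt n \<sigma>) g"
  shows "psi n k f = psi n k g"
  using lam_cong[of _ n k f g] assms by (auto intro!: poly_mapping_eqI simp: lookup_psi)

text \<open>
  The entries of the matrix of \<open>T\<^sub>i\<close> in the row of \<open>\<sigma>\<close>, in the columns of \<open>\<sigma>\<close> and of the swapped partition.
\<close>

definition diag_coeff :: "nat \<Rightarrow> nat set list \<Rightarrow> ratfun" where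
  "diag_coeff i \<sigma> =
    (if blk \<sigma> (i + 1) < blk \<sigma> i then qvar - 1 else if blk \<sigma> i < blk \<sigma> (i + 1) then 0 else qvar)"

definition swap_coeff :: "nat \<Rightarrow> nat set list \<Rightarrow> ratfun" where
  "swap_coeff i \<sigma> =
    (if blk \<sigma> (i + 1) < blk \<sigma> i then 1 else if blk \<sigma> i < blk \<sigma> (i + 1) then qvar else 0)"

lemma osp_T_eq_lin_ext: "osp_T i = lin_ext (osp_T_basis i)"
  by (rule ext) (simp add: osp_T_def lin_ext_def)

lemma linmap_osp_T: "linmap (osp_T i)"
  unfolding osp_T_eq_lin_ext by (rule linmap_lin_ext)

lemma lookup_osp_T:
  assumes v: "v \<in> osp_space n k" and \<sigma>: "\<sigma> \<in> OP n k" and i: "1 \<le> i" "i < n"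
  shows "lookup (osp_T i v) \<sigma> =
    diag_coeff i \<sigma> * lookup v \<sigma> + swap_coeff i \<sigma> * lookup v (osp_swap i \<sigma>)"
proof -
  let ?\<rho> = "osp_swap i \<sigma>"
  have \<rho>: "?\<rho> \<in> OP n k" by (rule osp_swap_closed[OF \<sigma> i])
  have basis: "lookup (osp_T_basis i \<tau>) \<sigma> =
      (if \<tau> = \<sigma> then diag_coeff i \<sigma> else 0) + (if \<tau> = ?\<rho> then swap_coeff i \<sigma> else 0)"
    if \<tau>: "\<tau> \<in> OP n k" for \<tau>
  proof -
    have left: "block_left_of \<tau> (i + 1) i \<longleftrightarrow> blk \<tau> (i + 1) < blk \<tau> i"
      "block_left_of \<tau> i (i + 1) \<longleftrightarrow> blk \<tau> i < blk \<tau> (i + 1)"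
      using block_left_of_iff[OF \<tau>] i by auto
    have eq: "osp_swap i \<tau> = \<sigma> \<longleftrightarrow> \<tau> = ?\<rho>" by (metis osp_swap_swap)
    have b: "blk ?\<rho> i = blk \<sigma> (i + 1)" "blk ?\<rho> (i + 1) = blk \<sigma> i"
      using blk_swap[OF \<sigma> i, of i] blk_swap[OF \<sigma> i, of "i + 1"] i by auto
    show ?thesis
    proof (cases "blk \<sigma> i = blk \<sigma> (i + 1)")
      case True
      then have "?\<rho> = \<sigma>" using osp_swap_same[OF \<sigma> i] by simp
      then show ?thesis
        using True eq left unfolding osp_T_basis_def diag_coeff_def swap_coeff_def
        by (auto simp: lookup_add lookup_single when_def)
    next
      case False
      then have "?\<rho> \<noteq> \<sigma>" using osp_swap_neq[OF \<sigma> i] by simp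
      then show ?thesis
        using False eq left b unfolding osp_T_basis_def diag_coeff_def swap_coeff_def
        by (auto simp: lookup_add lookup_single when_def)
    qed
  qed
  have "osp_T i v = (\<Sum>\<tau>\<in>OP n k. scale (lookup v \<tau>) (osp_T_basis i \<tau>))"
    unfolding osp_T_eq_lin_ext using v
    by (intro lin_ext_superset finite_ordered_set_partitions) (simp add: osp_space_def)
  then have "lookup (osp_T i v) \<sigma> =
      (\<Sum>\<tau>\<in>OP n k. lookup v \<tau> * ((if \<tau> = \<sigma> then diag_coeff i \<sigma> else 0)
        + (if \<tau> = ?\<rho> then swap_coeff i \<sigma> else 0)))"
    by (simp add: lookup_sum basis)
  also have "\<dots> = (\<Sum>\<tau>\<in>OP n k. if \<tau> = \<sigma> then diag_coeff i \<sigma> * lookup v \<tau> else 0)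
      + (\<Sum>\<tau>\<in>OP n k. if \<tau> = ?\<rho> then swap_coeff i \<sigma> * lookup v \<tau> else 0)"
    unfolding sum.distrib[symmetric] by (rule sum.cong) (auto simp: algebra_simps)
  also have "\<dots> = diag_coeff i \<sigma> * lookup v \<sigma> + swap_coeff i \<sigma> * lookup v ?\<rho>"
    using \<sigma> \<rho> by (simp add: finite_ordered_set_partitions)
  finally show ?thesis .
qed

lemma osp_T_closed:
  assumes v: "v \<in> osp_space n k" and i: "1 \<le> i" "i < n"
  shows "osp_T i v \<in> osp_space n k"
proof -
  have "osp_T_basis i \<sigma> \<in> osp_space n k" if "\<sigma> \<in> OP n k" for \<sigma>
    using that osp_swap_closed[OF that i] unfolding osp_T_basis_def
    by (auto intro!: VS.subspace_add[OF subspace_osp_space])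
      (auto simp: osp_space_def)
  then show ?thesis
    unfolding osp_T_def using v
    by (intro VS.subspace_sum[OF subspace_osp_space] VS.subspace_scale[OF subspace_osp_space])
      (auto simp: osp_space_def)
qed

lemma psi_poly_T:
  assumes i: "1 \<le> i" "i < n"
  shows "psi n k (poly_T i f) = osp_T i (psi n k f)"
proof (rule poly_mapping_eqI)
  fix \<sigma>
  show "lookup (psi n k (poly_T i f)) \<sigma> = lookup (osp_T i (psi n k f)) \<sigma>"
  proof (cases "\<sigma> \<in> OP n k")
    case False
    then show ?thesis
      using osp_T_closed[OF psi_in_osp_space i, of k f]
      by (auto simp: lookup_psi osp_space_def in_keys_iff)
  next
    case True
    note \<sigma> = True
    have \<rho>: "osp_swap i \<sigma> \<in> OP n k" by (rule osp_swap_closed[OF \<sigma> i])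
    note [simp] = lookup_osp_T[OF psi_in_osp_space \<sigma> i] lookup_psi diag_coeff_def swap_coeff_def
    show ?thesis
    proof (cases "blk \<sigma> i" "blk \<sigma> (i + 1)" rule: linorder_cases)
      case less
      then show ?thesis
        using \<sigma> \<rho> by (simp add: lam_poly_T_ascent[OF \<sigma> i] inv_num_swap[OF \<sigma> i])
    next
      case equal
      then show ?thesis using \<sigma> by (simp add: lam_poly_T_same[OF \<sigma> i])
    next
      case greater
      then show ?thesis
        using \<sigma> \<rho> by (simp add: lam_poly_T_descent[OF \<sigma> i]
            inv_num_swap_desc[OF \<sigma> i greater] field_simps)
    qed
  qed
qed


section \<open>An invariant positive definite form\<close>

definition form :: "nat \<Rightarrow> nat \<Rightarrow> (nat set list \<Rightarrow>\<^sub>0 ratfun) \<Rightarrow> (nat set list \<Rightarrow>\<^sub>0 ratfun) \<Rightarrow> ratfun" where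
  "form n k u v = (\<Sum>\<sigma>\<in>OP n k. lookup u \<sigma> * lookup v \<sigma> * qvar ^ inv_num n \<sigma>)"

lemma form_add_left: "form n k (u + u') v = form n k u v + form n k u' v"
  and form_diff_left: "form n k (u - u') v = form n k u v - form n k u' v"
  and form_scale_left: "form n k (scale c u) v = c * form n k u v"
  and form_0_left [simp]: "form n k 0 v = 0"
  by (simp_all add: form_def lookup_add lookup_minus distrib_right left_diff_distrib sum.distrib
      sum_subtractf sum_distrib_left mult.assoc)

lemma form_commute: "form n k u v = form n k v u"
  by (simp add: form_def mult.commute)

lemma form_self_eq_0:
  assumes "v \<in> osp_space n k" "form n k v v = 0"
  shows "v = 0"
proof (rule poly_mapping_eqI)
  fix \<sigma>
  have nonneg: "0 \<le> lookup v \<sigma> * lookup v \<sigma> * qvar ^ inv_num n \<sigma>" for \<sigma>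
    using qvar_pos by (intro mult_nonneg_nonneg zero_le_square) simp
  show "lookup v \<sigma> = lookup 0 \<sigma>"
  proof (cases "\<sigma> \<in> OP n k")
    case True
    then have "lookup v \<sigma> * lookup v \<sigma> * qvar ^ inv_num n \<sigma> = 0"
      using assms(2) nonneg finite_ordered_set_partitions unfolding form_def
      by (subst (asm) sum_nonneg_eq_0_iff) auto
    then show ?thesis by simp
  next
    case False
    then show ?thesis using assms(1) by (auto simp: osp_space_def in_keys_iff)
  qed
qed

text \<open>
  An ascent contributes \<open>q\<close> to one off-diagonal entry and \<open>1\<close> to the other, which is balanced by the
  additional inversion in the weight.
\<close>

lemma form_osp_T:
  assumes u: "u \<in> osp_space n k" and v: "v \<in> osp_space n k" and i: "1 \<le> i" "i < n"
  shows "form n k (osp_T i u) v = form n k u (osp_T i v)"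
proof -
  let ?s = "osp_swap i"
  let ?w = "\<lambda>\<sigma>. qvar ^ inv_num n \<sigma>"
  have bij: "bij_betw ?s (OP n k) (OP n k)"
    using osp_swap_closed i by (intro bij_betwI[where g = "?s"]) auto
  have w: "swap_coeff i \<sigma> * ?w \<sigma> = swap_coeff i (?s \<sigma>) * ?w (?s \<sigma>)" if \<sigma>: "\<sigma> \<in> OP n k" for \<sigma>
  proof -
    have b: "blk (?s \<sigma>) i = blk \<sigma> (i + 1)" "blk (?s \<sigma>) (i + 1) = blk \<sigma> i"
      using blk_swap[OF \<sigma> i, of i] blk_swap[OF \<sigma> i, of "i + 1"] i by auto
    show ?thesis
    proof (cases "blk \<sigma> i" "blk \<sigma> (i + 1)" rule: linorder_cases)
      case less
      then show ?thesis using inv_num_swap[OF \<sigma> i less] b by (simp add: swap_coeff_def)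
    next
      case equal
      then show ?thesis using b by (simp add: swap_coeff_def)
    next
      case greater
      then show ?thesis using inv_num_swap_desc[OF \<sigma> i greater] b by (simp add: swap_coeff_def)
    qed
  qed
  have expand: "form n k (osp_T i u) v =
      (\<Sum>\<sigma>\<in>OP n k. diag_coeff i \<sigma> * lookup u \<sigma> * lookup v \<sigma> * ?w \<sigma>) +
      (\<Sum>\<sigma>\<in>OP n k. swap_coeff i \<sigma> * ?w \<sigma> * lookup u (?s \<sigma>) * lookup v \<sigma>)"
    if "u \<in> osp_space n k" for u v
    unfolding form_def sum.distrib[symmetric] using that i
    by (intro sum.cong refl) (simp add: lookup_osp_T algebra_simps)
  have "(\<Sum>\<sigma>\<in>OP n k. swap_coeff i \<sigma> * ?w \<sigma> * lookup u (?s \<sigma>) * lookup v \<sigma>) =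
      (\<Sum>\<sigma>\<in>OP n k. swap_coeff i (?s \<sigma>) * ?w (?s \<sigma>) * lookup u (?s (?s \<sigma>)) * lookup v (?s \<sigma>))"
    by (rule sum.reindex_bij_betw[OF bij, symmetric])
  also have "\<dots> = (\<Sum>\<sigma>\<in>OP n k. swap_coeff i \<sigma> * ?w \<sigma> * lookup v (?s \<sigma>) * lookup u \<sigma>)"
    by (intro sum.cong refl) (simp add: w[symmetric] mult.commute mult.left_commute)
  finally have sw: "(\<Sum>\<sigma>\<in>OP n k. swap_coeff i \<sigma> * ?w \<sigma> * lookup u (?s \<sigma>) * lookup v \<sigma>) =
     (\<Sum>\<sigma>\<in>OP n k. swap_coeff i \<sigma> * ?w \<sigma> * lookup v (?s \<sigma>) * lookup u \<sigma>)" .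
  show ?thesis
    unfolding form_commute[of n k u] expand[OF u] expand[OF v] sw
    by (simp add: mult_ac)
qed


subsection \<open>Orthogonal projection\<close>

text \<open>
  Gram-Schmidt, one basis vector at a time. The new vector \<open>b\<close> is first made orthogonal to the span of \<open>B\<close>.
\<close>

lemma orthogonal_decomposition_span:
  assumes "finite B" "B \<subseteq> osp_space n k"
  shows "\<exists>u\<in>VS.span B. \<forall>b\<in>VS.span B. form n k b (v - u) = 0"
proof -
  have extend: "\<forall>b\<in>VS.span B. form n k b w = 0" if "\<And>b. b \<in> B \<Longrightarrow> form n k b w = 0" for B w
  proof
    fix b assume "b \<in> VS.span B"
    then show "form n k b w = 0"
      by (induction rule: VS.span_induct_alt) (simp_all add: that form_add_left form_scale_left)
  qed
  show ?thesis
    using assms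
  proof (induction B arbitrary: v)
    case empty
    show ?case by simp
  next
    case (insert b B)
    have mono: "VS.span B \<subseteq> VS.span (insert b B)" by (rule VS.span_mono) auto
    obtain p where p: "p \<in> VS.span B" "\<forall>c\<in>VS.span B. form n k c (b - p) = 0"
      using insert by blast
    define e where "e = b - p"
    have e_span: "e \<in> VS.span (insert b B)"
      unfolding e_def using p(1) mono by (intro VS.span_diff) (auto intro: VS.span_base)
    have e_osp: "e \<in> osp_space n k"
    proof -
      have "VS.span (insert b B) \<subseteq> osp_space n k"
        using insert.prems by (intro VS.span_minimal subspace_osp_space) auto
      then show ?thesis using e_span by blast
    qed
    obtain u where u: "u \<in> VS.span B" "\<forall>c\<in>VS.span B. form n k c (v - u) = 0"
      using insert by blast
    \<comment> \<open>if \<open>e = 0\<close>, the quotient is \<open>0\<close> and nothing is added\<close>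
    define t where "t = form n k e (v - u) / form n k e e"
    define u' where "u' = u + scale t e"
    have c: "form n k c (v - u') = form n k c (v - u) - t * form n k c e" for c
      unfolding u'_def form_commute[of n k c]
      by (simp add: form_diff_left form_add_left form_scale_left)
    have te: "form n k e (v - u) = t * form n k e e"
    proof (cases "form n k e e = 0")
      case True
      then have "e = 0" by (rule form_self_eq_0[OF e_osp])
      then show ?thesis by simp
    qed (simp add: t_def)
    have B: "form n k d (v - u') = 0" if "d \<in> VS.span B" for d
      using that p(2) u(2) by (simp add: c e_def)
    have "form n k b (v - u') = form n k (e + p) (v - u')" by (simp add: e_def)
    also have "\<dots> = 0" using B[OF p(1)] by (simp add: form_add_left c te)
    finally have "\<forall>d\<in>VS.span (insert b B). form n k d (v - u') = 0"
      using B by (intro extend) (auto intro: VS.span_base)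
    moreover have "u' \<in> VS.span (insert b B)"
      unfolding u'_def using u(1) mono e_span by (intro VS.span_add VS.span_scale) auto
    ultimately show ?case by blast
  qed
qed

lemma osp_space_span: "osp_space n k = VS.span ((\<lambda>\<sigma>. single \<sigma> 1) ` OP n k)"
proof (intro equalityI)
  show "VS.span ((\<lambda>\<sigma>. single \<sigma> 1) ` OP n k) \<subseteq> osp_space n k"
    by (rule VS.span_minimal[OF _ subspace_osp_space]) (auto simp: osp_space_def)
  show "osp_space n k \<subseteq> VS.span ((\<lambda>\<sigma>. single \<sigma> 1) ` OP n k)"
  proof
    fix v assume "v \<in> osp_space n k"
    then have "v = (\<Sum>\<sigma>\<in>OP n k. scale (lookup v \<sigma>) (single \<sigma> 1))"
      by (intro poly_mapping_expand finite_ordered_set_partitions) (simp add: osp_space_def)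
    also have "\<dots> \<in> VS.span ((\<lambda>\<sigma>. single \<sigma> 1) ` OP n k)"
      by (intro VS.span_sum VS.span_scale VS.span_base) auto
    finally show "v \<in> VS.span ((\<lambda>\<sigma>. single \<sigma> 1) ` OP n k)" .
  qed
qed

lemma orthogonal_decomposition:
  assumes U: "VS.subspace U" "U \<subseteq> osp_space n k"
  shows "\<exists>u\<in>U. \<forall>b\<in>U. form n k b (v - u) = 0"
proof -
  obtain B where B: "B \<subseteq> U" "VS.independent B" "U \<subseteq> VS.span B"
    using VS.maximal_independent_subset[of U] by blast
  have "finite B"
    using VS.independent_span_bound[of "(\<lambda>\<sigma>. single \<sigma> 1) ` OP n k" B] B U
      finite_ordered_set_partitions by (auto simp: osp_space_span)
  moreover have "VS.span B = U"
    using B U VS.span_minimal by blast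
  ultimately show ?thesis
    using orthogonal_decomposition_span[of B n k v] B U by auto
qed

text \<open>
  The component of a vector that is orthogonal to \<open>U\<close>.
\<close>

definition residual :: "nat \<Rightarrow> nat \<Rightarrow> (nat set list \<Rightarrow>\<^sub>0 ratfun) set \<Rightarrow> (nat set list \<Rightarrow>\<^sub>0 ratfun) \<Rightarrow> (nat set list \<Rightarrow>\<^sub>0 ratfun)" where
  "residual n k U v = (THE w. v - w \<in> U \<and> (\<forall>b\<in>U. form n k b w = 0))"

context
  fixes n k U
  assumes U: "VS.subspace U" "U \<subseteq> osp_space n k"
begin

lemma residual_eqI:
  assumes "v - w \<in> U" "\<And>b. b \<in> U \<Longrightarrow> form n k b w = 0"
  shows "residual n k U v = w"
  unfolding residual_def
proof (rule the_equality)
  fix w' assume w': "v - w' \<in> U \<and> (\<forall>b\<in>U. form n k b w' = 0)"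
  have "w - w' = (v - w') - (v - w)" by simp
  then have d: "w - w' \<in> U" using w' assms(1) U(1) by (metis VS.subspace_diff)
  then have "form n k (w - w') w = 0" "form n k (w - w') w' = 0" using w' assms(2) by auto
  then have "form n k (w - w') (w - w') = 0"
    by (simp add: form_commute[of n k _ "w - w'"] form_diff_left)
  then have "w - w' = 0" using d U(2) form_self_eq_0 by blast
  then show "w' = w" by simp
qed (use assms in auto)

lemma residual: "v - residual n k U v \<in> U" "b \<in> U \<Longrightarrow> form n k b (residual n k U v) = 0"
proof -
  obtain u where u: "u \<in> U" "\<forall>b\<in>U. form n k b (v - u) = 0"
    using orthogonal_decomposition[OF U, of v] by blast
  have "residual n k U v = v - u" by (rule residual_eqI) (use u in auto)
  then show "v - residual n k U v \<in> U" "b \<in> U \<Longrightarrow> form n k b (residual n k U v) = 0"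
    using u by auto
qed

lemma residual_0: "v \<in> U \<Longrightarrow> residual n k U v = 0"
  by (rule residual_eqI) (simp_all add: form_commute[of n k _ 0])

lemma linmap_residual: "linmap (residual n k U)"
proof (rule linmapI)
  fix u v c
  have "u - residual n k U u + (v - residual n k U v) \<in> U"
    using residual(1) U(1) by (intro VS.subspace_add)
  then show "residual n k U (u + v) = residual n k U u + residual n k U v"
    by (intro residual_eqI) (simp_all add: algebra_simps residual(2)
        form_commute[of n k _ "residual n k U u + residual n k U v"] form_add_left
        form_commute[of n k "residual n k U _"])
  have "scale c (v - residual n k U v) \<in> U"
    using residual(1) U(1) by (intro VS.subspace_scale)
  then show "residual n k U (scale c v) = scale c (residual n k U v)"
    by (intro residual_eqI) (simp_all add: VS.scale_right_diff_distrib residual(2)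
        form_commute[of n k _ "scale c (residual n k U v)"] form_scale_left
        form_commute[of n k "residual n k U _"])
qed

lemma residual_in_osp_space: "v \<in> osp_space n k \<Longrightarrow> residual n k U v \<in> osp_space n k"
  using VS.subspace_diff[OF subspace_osp_space, of v n k "v - residual n k U v"] residual(1)[of v] U(2)
  by auto

lemma residual_osp_T:
  assumes i: "1 \<le> i" "i < n" and v: "v \<in> osp_space n k" and stable: "\<And>u. u \<in> U \<Longrightarrow> osp_T i u \<in> U"
  shows "residual n k U (osp_T i v) = osp_T i (residual n k U v)"
proof (rule residual_eqI)
  show "osp_T i v - osp_T i (residual n k U v) \<in> U"
    using stable[OF residual(1)[of v]] by (simp add: linmap_simps[OF linmap_osp_T])
  fix b assume b: "b \<in> U"
  have "form n k b (osp_T i (residual n k U v)) = form n k (osp_T i b) (residual n k U v)"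
    using b U(2) residual_in_osp_space[OF v] i by (intro form_osp_T[symmetric]) auto
  then show "form n k b (osp_T i (residual n k U v)) = 0"
    using stable[OF b] residual(2) by simp
qed

end

subsection \<open>The equivariant map is surjective\<close>

text \<open>
  If the image were a proper subspace, some \<open>w \<noteq> 0\<close> would be orthogonal to it, which is a linear
  relation between the functionals. Choose \<open>\<sigma>\<close> in the support of \<open>w\<close> with the most inversions.
  By triangularity the interpolation polynomial of \<open>\<sigma>\<close> is annihilated by all functionals in the
  relation except that of \<open>\<sigma>\<close>.
\<close>

lemma psi_image: "psi n k ` polys {1..n} = osp_space n k"
proof
  show "psi n k ` polys {1..n} \<subseteq> osp_space n k" using psi_in_osp_space by auto
  have U: "VS.subspace (psi n k ` polys {1..n})" "psi n k ` polys {1..n} \<subseteq> osp_space n k"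
    using VSP.linear_subspace_image[OF linmap_psi subspace_polys] psi_in_osp_space by auto
  show "osp_space n k \<subseteq> psi n k ` polys {1..n}"
  proof
    fix v assume v: "v \<in> osp_space n k"
    define w where "w = residual n k (psi n k ` polys {1..n}) v"
    have w_osp: "w \<in> osp_space n k" unfolding w_def by (rule residual_in_osp_space[OF U v])
    have orth: "form n k (psi n k f) w = 0" if "f \<in> polys {1..n}" for f
      unfolding w_def using that by (intro residual(2)[OF U]) auto
    have "w = 0"
    proof (rule ccontr)
      assume "w \<noteq> 0"
      then have "inv_num n ` keys w \<noteq> {}" by simp
      then have "Max (inv_num n ` keys w) \<in> inv_num n ` keys w"
        by (intro Max_in) auto
      then obtain \<sigma> where \<sigma>: "\<sigma> \<in> keys w"
        "inv_num n \<sigma> = Max (inv_num n ` keys w)" by auto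
      have max: "inv_num n \<tau> \<le> inv_num n \<sigma>" if "\<tau> \<in> keys w" for \<tau>
        unfolding \<sigma>(2) using that by (intro Max_ge) auto
      have \<sigma>_osp: "\<sigma> \<in> OP n k" using \<sigma>(1) w_osp by (auto simp: osp_space_def)
      obtain f where f: "f \<in> polys {1..n}"
        "\<And>\<tau>. \<tau> \<in> OP n k \<Longrightarrow> eval_poly (pt n \<tau>) f = (if \<tau> = \<sigma> then 1 else 0)"
        by (rule interpolation[OF \<sigma>_osp]) blast
      have lam_f: "\<exists>c. c \<noteq> 0 \<and> lam n k \<tau> f = c * (if \<tau> = \<sigma> then 1 else 0)"
        if \<tau>: "\<tau> \<in> keys w" for \<tau>
      proof -
        have \<tau>_osp: "\<tau> \<in> OP n k" using \<tau> w_osp by (auto simp: osp_space_def)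
        obtain c where c: "c \<noteq> 0"
          "(\<forall>\<rho>\<in>OP n k. inv_num n \<rho> < inv_num n \<tau> \<longrightarrow> eval_poly (pt n \<rho>) f = 0) \<Longrightarrow>
            lam n k \<tau> f = c * eval_poly (pt n \<tau>) f"
          using lam_triangular[OF \<tau>_osp] by blast
        have "\<forall>\<rho>\<in>OP n k. inv_num n \<rho> < inv_num n \<tau> \<longrightarrow> eval_poly (pt n \<rho>) f = 0"
          using max[OF \<tau>] f(2) by auto
        then show ?thesis using c f(2)[OF \<tau>_osp] by auto
      qed
      have "form n k (psi n k f) w = (\<Sum>\<tau>\<in>OP n k. lam n k \<tau> f * lookup w \<tau>)"
        unfolding form_def by (intro sum.cong refl) (simp add: lookup_psi)
      also have "\<dots> = (\<Sum>\<tau>\<in>{\<sigma>}. lam n k \<tau> f * lookup w \<tau>)"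
      proof (rule sum.mono_neutral_right)
        show "\<forall>\<tau>\<in>OP n k - {\<sigma>}. lam n k \<tau> f * lookup w \<tau> = 0"
        proof
          fix \<tau> assume "\<tau> \<in> OP n k - {\<sigma>}"
          then show "lam n k \<tau> f * lookup w \<tau> = 0"
            using lam_f[of \<tau>] by (cases "\<tau> \<in> keys w") (auto simp: in_keys_iff)
        qed
      qed (use \<sigma>_osp finite_ordered_set_partitions in auto)
      finally have "lam n k \<sigma> f * lookup w \<sigma> = 0"
        using orth[OF f(1)] by simp
      then show False using lam_f[OF \<sigma>(1)] \<sigma>(1) by (auto simp: in_keys_iff)
    qed
    then show "v \<in> psi n k ` polys {1..n}"
      using residual(1)[OF U, of v] unfolding w_def by simp
  qed
qed


section \<open>Splitting the degree filtration\<close>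

definition filt :: "nat \<Rightarrow> nat \<Rightarrow> nat \<Rightarrow> (nat set list \<Rightarrow>\<^sub>0 ratfun) set" where
  "filt n k d = psi n k ` polys_lt n d"

text \<open>
  On a form of degree \<open>d\<close> this is the component of its image under \<open>psi\<close> that is orthogonal to the
  images of the polynomials of smaller degree. Defining it on monomials makes it linear.
\<close>

definition graded_map :: "nat \<Rightarrow> nat \<Rightarrow> mpoly \<Rightarrow> (nat set list \<Rightarrow>\<^sub>0 ratfun)" where
  "graded_map n k = lin_ext (\<lambda>m. residual n k (filt n k (mdeg m)) (psi n k (single m 1)))"

lemma filt: "VS.subspace (filt n k d)" "filt n k d \<subseteq> osp_space n k"
  unfolding filt_def
  using VSP.linear_subspace_image[OF linmap_psi subspace_polys_lt] psi_in_osp_space by auto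

lemma linmap_graded_map: "linmap (graded_map n k)"
  unfolding graded_map_def by (rule linmap_lin_ext)

lemma graded_map_homogeneous:
  assumes "homogeneous d f"
  shows "graded_map n k f = residual n k (filt n k d) (psi n k f)"
proof -
  have "residual n k (filt n k d) (psi n k f) = residual n k (filt n k d)
      (psi n k (\<Sum>m\<in>keys f. scale (lookup f m) (single m 1)))"
    using poly_mapping_expand[OF finite_keys order_refl, of f] by (rule arg_cong)
  also have "\<dots> = (\<Sum>m\<in>keys f. scale (lookup f m)
      (residual n k (filt n k d) (psi n k (single m 1))))"
    by (simp only: linmap_simps[OF linmap_psi] linmap_simps[OF linmap_residual[OF filt]])
  also have "\<dots> = graded_map n k f"
    unfolding graded_map_def lin_ext_def using assms
    by (intro sum.cong refl) (simp add: homogeneous_def)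
  finally show ?thesis ..
qed

lemma graded_map_in_osp_space: "graded_map n k f \<in> osp_space n k"
  unfolding graded_map_def lin_ext_def
  by (intro VS.subspace_sum[OF subspace_osp_space] VS.subspace_scale[OF subspace_osp_space]
      residual_in_osp_space[OF filt] psi_in_osp_space)

lemma poly_T_polys_lt:
  assumes "1 \<le> i" "i < n" "f \<in> polys_lt n d"
  shows "poly_T i f \<in> polys_lt n d"
proof -
  have "mdeg m < d" if m: "m \<in> keys (poly_T i f)" for m
  proof (rule ccontr)
    assume "\<not> mdeg m < d"
    then have "m' \<notin> keys f" if "mdeg m' = mdeg m" for m'
      using assms(3) that unfolding polys_lt_def by fastforce
    then have "hom_comp (mdeg m) f = 0"
      by (intro poly_mapping_eqI) (auto simp: lookup_hom_comp in_keys_iff)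
    then have "hom_comp (mdeg m) (poly_T i f) = 0"
      by (simp add: hom_comp_poly_T linmap_simps[OF linmap_poly_T])
    then have "lookup (hom_comp (mdeg m) (poly_T i f)) m = 0" by simp
    then show False using m by (simp add: lookup_hom_comp in_keys_iff)
  qed
  moreover have "poly_T i f \<in> polys {1..n}"
    using assms by (intro polys_poly_T) (auto simp: polys_lt_def)
  ultimately show ?thesis by (simp add: polys_lt_def)
qed

text \<open>
  The operators preserve degrees and the filtration, and they are self-adjoint, so they commute with
  the orthogonal projections.
\<close>

lemma graded_map_poly_T:
  assumes i: "1 \<le> i" "i < n"
  shows "graded_map n k (poly_T i f) = osp_T i (graded_map n k f)"
proof -
  have hom: "graded_map n k (poly_T i g) = osp_T i (graded_map n k g)" if g: "homogeneous d g" for d g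
  proof -
    have Tg: "homogeneous d (poly_T i g)"
      using g by (simp add: homogeneous_iff hom_comp_poly_T)
    have "osp_T i u \<in> filt n k d" if "u \<in> filt n k d" for u
      using that poly_T_polys_lt[OF i] unfolding filt_def
      by (auto simp: psi_poly_T[OF i, symmetric])
    then show ?thesis
      unfolding graded_map_homogeneous[OF g] graded_map_homogeneous[OF Tg] psi_poly_T[OF i]
      by (rule residual_osp_T[OF filt i psi_in_osp_space])
  qed
  let ?D = "mdeg ` keys f"
  have f: "(\<Sum>d\<in>?D. hom_comp d f) = f" by (rule sum_hom_comp) auto
  have "graded_map n k (poly_T i (\<Sum>d\<in>?D. hom_comp d f)) = osp_T i (graded_map n k (\<Sum>d\<in>?D. hom_comp d f))"
    by (simp only: linmap_simps[OF linmap_poly_T] linmap_simps[OF linmap_graded_map]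
        linmap_simps[OF linmap_osp_T] hom[OF homogeneous_hom_comp])
  then show ?thesis by (simp only: f)
qed

text \<open>
  By induction on \<open>d\<close>: the image of a form of degree \<open>d\<close> differs from its orthogonal component by an
  element of the previous step.
\<close>

lemma graded_map_surj: "osp_space n k \<subseteq> graded_map n k ` polys {1..n}"
proof -
  let ?G = "graded_map n k ` polys {1..n}"
  have G: "VS.subspace ?G"
    by (rule VSP.linear_subspace_image[OF linmap_graded_map subspace_polys])
  have filt_G: "filt n k d \<subseteq> ?G" for d
  proof (induction d)
    case 0
    have "polys_lt n 0 \<subseteq> {0}" by (auto simp: polys_lt_def keys_eq_empty)
    then show ?case
      using VS.subspace_0[OF G] by (auto simp: filt_def linmap_simps[OF linmap_psi])
  next
    case (Suc d)
    show ?case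
    proof
      fix v assume "v \<in> filt n k (Suc d)"
      then obtain f where f: "f \<in> polys_lt n (Suc d)" "v = psi n k f" by (auto simp: filt_def)
      define g where "g = hom_comp d f"
      have g: "homogeneous d g" "g \<in> polys {1..n}"
        using f(1) by (auto simp: g_def homogeneous_hom_comp polys_hom_comp polys_lt_def)
      have "f - g \<in> polys_lt n d"
      proof -
        have "mdeg m < d" if "m \<in> keys (f - g)" for m
        proof -
          have "m \<in> keys f" "mdeg m \<noteq> d"
            using that by (auto simp: in_keys_iff g_def lookup_minus lookup_hom_comp split: if_splits)
          then show ?thesis using f(1) by (auto simp: polys_lt_def)
        qed
        then show ?thesis using f(1) g(2) by (simp add: polys_lt_def polys_diff)
      qed
      then have "psi n k (f - g) \<in> ?G" using Suc by (auto simp: filt_def)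
      moreover have "psi n k g - graded_map n k g \<in> ?G"
        unfolding graded_map_homogeneous[OF g(1)]
        using residual(1)[OF filt] Suc by blast
      moreover have "graded_map n k g \<in> ?G" using g(2) by blast
      ultimately have "psi n k (f - g) + (psi n k g - graded_map n k g) + graded_map n k g \<in> ?G"
        by (intro VS.subspace_add[OF G])
      then show "v \<in> ?G" by (simp add: f(2) linmap_simps[OF linmap_psi])
    qed
  qed
  show ?thesis
  proof
    fix v assume "v \<in> osp_space n k"
    then obtain f where f: "f \<in> polys {1..n}" "v = psi n k f" using psi_image[of n k] by blast
    define d where "d = Suc (\<Sum>m\<in>keys f. mdeg m)"
    have "mdeg m < d" if "m \<in> keys f" for m
      unfolding d_def less_Suc_eq_le using that by (intro member_le_sum) auto
    then have "f \<in> polys_lt n d" using f by (simp add: polys_lt_def)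
    then show "v \<in> ?G" using filt_G[of d] f(2) by (auto simp: filt_def)
  qed
qed

text \<open>
  If \<open>g\<close> agrees on the points with a polynomial of smaller degree, the image of \<open>h g\<close> for a form \<open>h\<close> lies in
  a lower step of the filtration.
\<close>

lemma graded_map_generator:
  assumes g: "homogeneous e g" "g \<in> polys {1..n}" and h: "h \<in> polys {1..n}"
    and g': "g' \<in> polys_lt n e" "\<And>\<sigma>. \<sigma> \<in> OP n k \<Longrightarrow> eval_poly (pt n \<sigma>) g = eval_poly (pt n \<sigma>) g'"
  shows "graded_map n k (h * g) = 0"
proof -
  have zero: "graded_map n k (hom_comp d h * g) = 0" for d
  proof -
    have hg: "homogeneous (d + e) (hom_comp d h * g)"
      by (intro homogeneous_mult homogeneous_hom_comp g)
    have "psi n k (hom_comp d h * g) = psi n k (hom_comp d h * g')"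
      by (rule psi_cong) (simp add: eval_mult g'(2))
    moreover have "hom_comp d h * g' \<in> polys_lt n (d + e)"
      by (intro polys_lt_mult_homogeneous homogeneous_hom_comp polys_hom_comp h g'(1))
    ultimately have "psi n k (hom_comp d h * g) \<in> filt n k (d + e)"
      by (simp add: filt_def)
    then show ?thesis
      unfolding graded_map_homogeneous[OF hg] by (rule residual_0[OF filt])
  qed
  let ?D = "mdeg ` keys h"
  have "h * g = (\<Sum>d\<in>?D. hom_comp d h * g)"
    unfolding sum_distrib_right[symmetric] by (subst sum_hom_comp) auto
  then have "graded_map n k (h * g) = (\<Sum>d\<in>?D. graded_map n k (hom_comp d h * g))"
    by (simp only: linmap_simps[OF linmap_graded_map])
  then show ?thesis by (simp add: zero)
qed

lemma graded_map_ideal: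
  assumes "1 \<le> k" "f \<in> ideal_nks n k k"
  shows "graded_map n k f = 0"
  using assms(2) unfolding ideal_nks_def
proof induction
  case zero
  show ?case by (simp add: linmap_simps[OF linmap_graded_map])
next
  case (add f f')
  then show ?case by (simp add: linmap_simps[OF linmap_graded_map])
next
  case (gen h g)
  from gen(2) consider i where "g = hall_littlewood k i" "1 \<le> i" "i \<le> n"
    | d where "g = elem_sym d n" "n < d + k" unfolding ideal_gens_def by blast
  then show ?case
  proof cases
    case 1
    obtain g' where "g' \<in> polys_lt n k"
      "\<And>\<sigma>. \<sigma> \<in> OP n k \<Longrightarrow> eval_poly (pt n \<sigma>) (hall_littlewood k i) = eval_poly (pt n \<sigma>) g'"
      by (rule hall_littlewood_at_points[OF assms(1) 1(3)]) blast
    then show ?thesis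
      unfolding 1(1) using gen(1) polys_hall_littlewood[OF 1(3)]
      by (intro graded_map_generator[of k])
        (auto simp: hall_littlewood_eq homogeneous_scale homogeneous_HL_series)
  next
    case 2
    obtain g' where "g' \<in> polys_lt n d"
      "\<And>\<sigma>. \<sigma> \<in> OP n k \<Longrightarrow> eval_poly (pt n \<sigma>) (elem_sym d n) = eval_poly (pt n \<sigma>) g'"
      by (rule elem_sym_at_points[OF 2(2)]) blast
    then show ?thesis
      unfolding 2(1) using gen(1)
      by (intro graded_map_generator[of d] homogeneous_elem_sym polys_elem_sym)
  qed
qed

lemma card_basis_osp: 
  "VS.independent ((\<lambda>\<sigma>. single \<sigma> 1) ` OP n k)"
  "card ((\<lambda>\<sigma>. single \<sigma> (1::ratfun)) ` OP n k) = card (OP n k)"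
proof -
  have inj: "inj_on (\<lambda>\<sigma>. single \<sigma> (1::ratfun)) (OP n k)"
    by (rule inj_onI) (metis lookup_single_eq lookup_single_not_eq zero_neq_one)
  then show "card ((\<lambda>\<sigma>. single \<sigma> (1::ratfun)) ` OP n k) = card (OP n k)"
    by (rule card_image)
  show "VS.independent ((\<lambda>\<sigma>. single \<sigma> 1) ` OP n k)"
  proof (rule VS.independent_if_scalars_zero)
    show "finite ((\<lambda>\<sigma>. single \<sigma> 1) ` OP n k)" by (simp add: finite_ordered_set_partitions)
    fix c and x :: "nat set list \<Rightarrow>\<^sub>0 ratfun"
    assume sum: "(\<Sum>x\<in>(\<lambda>\<sigma>. single \<sigma> 1) ` OP n k. scale (c x) x) = 0"
      and  "x \<in> (\<lambda>\<sigma>. single \<sigma> 1) ` OP n k"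
    then obtain \<sigma> where \<sigma>: "\<sigma> \<in> OP n k" "x = single \<sigma> 1" by blast
    have "(\<Sum>\<tau>\<in>OP n k. single \<tau> (c (single \<tau> 1))) = 0"
      using sum by (simp add: sum.reindex[OF inj])
    then have "lookup (\<Sum>\<tau>\<in>OP n k. single \<tau> (c (single \<tau> 1))) \<sigma> = 0"
      by simp
    then show "c x = 0"
      using \<sigma> by (simp add: lookup_sum lookup_single when_def finite_ordered_set_partitions)
  qed
qed

text \<open>
  The images of the \<open>B\<close> that spans the quotient by the ideal also span the target, and
  \<open>B\<close> has at most as many elements as a basis of the target. So they are
  linearly independent, and no nonzero combination of \<open>B\<close> is in the kernel.
\<close>

lemma graded_map_kernel:
  assumes "1 \<le> k" "f \<in> polys {1..n}" "graded_map n k f = 0"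
  shows "f \<in> ideal_nks n k k"
proof -
  let ?\<Phi> = "graded_map n k"
  let ?I = "ideal_nks n k k"
  let ?E = "(\<lambda>\<sigma>. single \<sigma> 1) ` OP n k :: (nat set list \<Rightarrow>\<^sub>0 ratfun) set"
  obtain B where B: "finite B" "card B \<le> cover_count n k k" "polys {1..n} \<subseteq> VS.span (B \<union> ?I)"
    using polys_span_bound[OF assms(1) order_refl, of n] by blast
  have decomp: "\<exists>b\<in>VS.span B. \<exists>g\<in>?I. p = b + g" if "p \<in> polys {1..n}" for p
  proof -
    have "VS.span ?I = ?I" by (simp add: VS.span_eq_iff subspace_ideal_nks)
    then show ?thesis using that B(3) unfolding VS.span_Un by blast
  qed
  have \<Phi>_decomp: "?\<Phi> (b + g) = ?\<Phi> b" if "g \<in> ?I" for b g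
    using graded_map_ideal[OF assms(1) that] by (simp add: linmap_simps[OF linmap_graded_map])
  have span: "osp_space n k \<subseteq> VS.span (?\<Phi> ` B)"
  proof
    fix v assume "v \<in> osp_space n k"
    then obtain p where p: "p \<in> polys {1..n}" "v = ?\<Phi> p" using graded_map_surj by blast
    then obtain b g where "b \<in> VS.span B" "g \<in> ?I" "p = b + g" using decomp by blast
    then have "v \<in> ?\<Phi> ` VS.span B" using p(2) \<Phi>_decomp by auto
    then show "v \<in> VS.span (?\<Phi> ` B)" by (simp only: VSP.linear_span_image[OF linmap_graded_map])
  qed
  have E_span: "?E \<subseteq> VS.span (?\<Phi> ` B)"
    using span VS.span_superset[of ?E] unfolding osp_space_span by (rule order_trans[rotated])
  then have "card ?E \<le> card (?\<Phi> ` B)"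
    using VS.independent_span_bound[OF finite_imageI[OF B(1)] card_basis_osp(1)] by blast
  then have cards: "card (?\<Phi> ` B) = card B" "card (?\<Phi> ` B) \<le> card ?E"
    using B(1,2) cover_count_le_card_osp[of n k] card_image_le[OF B(1), of ?\<Phi>]
    unfolding card_basis_osp(2) by linarith+
  have "inj_on ?\<Phi> B" using cards(1) B(1) by (simp add: inj_on_iff_eq_card)
  moreover have "VS.independent (?\<Phi> ` B)"
  proof -
    obtain C where C: "C \<subseteq> ?\<Phi> ` B" "VS.independent C" "?\<Phi> ` B \<subseteq> VS.span C"
      using VS.maximal_independent_subset by blast
    have fin: "finite C" using C(1) B(1) finite_subset by blast
    have "?E \<subseteq> VS.span C"
      using E_span VS.span_minimal[OF C(3) VS.subspace_span] by blast
    then have "card ?E \<le> card C"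
      using VS.independent_span_bound[OF fin card_basis_osp(1)] by blast
    then have "C = ?\<Phi> ` B"
      using cards(2) C(1) B(1) card_mono[OF _ C(1)] by (intro card_subset_eq) auto
    then show ?thesis using C(2) by simp
  qed
  ultimately have inj: "inj_on ?\<Phi> (VS.span B)"
    by (intro VSP.linear_inj_on_span_independent_image linmap_graded_map)
  obtain b g where bg: "b \<in> VS.span B" "g \<in> ?I" "f = b + g" using decomp[OF assms(2)] by blast
  then have "?\<Phi> b = ?\<Phi> 0"
    using assms(3) \<Phi>_decomp by (simp add: linmap_simps[OF linmap_graded_map])
  then have "b = 0" using inj bg(1) VS.span_zero by (auto dest: inj_onD)
  then show ?thesis using bg by simp
qed

section \<open>The isomorphism\<close>

theorem corollary2p7:
  fixes n k :: nat
  assumes "1 \<le> k" and "k \<le> n"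
  shows "left_module_isomorphic (hecke_algebra n) (R_module n k) (osp_module n k)"
proof -
  interpret poly: hecke_rep n poly_T "polys {1..n}"
    by (intro hecke_rep.intro linmap_poly_T subspace_polys poly_T_quadratic poly_T_commute
        poly_T_braid polys_poly_T) auto
  \<comment> \<open>the relations on ordered set partitions are inherited from the polynomials along \<open>psi\<close>\<close>
  have lift: "\<exists>f\<in>polys {1..n}. v = psi n k f" if "v \<in> osp_space n k" for v
    using that psi_image[of n k] by blast
  interpret osp: hecke_rep n osp_T "osp_space n k"
  proof (rule hecke_rep.intro)
    show "osp_T i v \<in> osp_space n k" if "1 \<le> i" "i < n" "v \<in> osp_space n k" for i v
      by (rule osp_T_closed[OF that(3,1,2)])
  next
    fix i v assume i: "1 \<le> i" "i < n" and v: "v \<in> osp_space n k"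
    obtain f where f: "v = psi n k f" using lift[OF v] by blast
    show "osp_T i (osp_T i v) = scale (qvar - 1) (osp_T i v) + scale qvar v"
      unfolding f psi_poly_T[OF i, symmetric] poly_T_quadratic by (simp add: linmap_simps[OF linmap_psi])
  next
    fix i j v assume i: "1 \<le> i" "i + 1 < j" "j < n" and v: "v \<in> osp_space n k"
    obtain f where f: "v = psi n k f" using lift[OF v] by blast
    show "osp_T i (osp_T j v) = osp_T j (osp_T i v)"
      using i poly_T_commute[OF i(2), of f] by (simp add: f psi_poly_T[symmetric])
  next
    fix i v assume i: "1 \<le> i" "i + 1 < n" and v: "v \<in> osp_space n k"
    obtain f where f: "v = psi n k f" using lift[OF v] by blast
    show "osp_T i (osp_T (i + 1) (osp_T i v)) = osp_T (i + 1) (osp_T i (osp_T (i + 1) v))"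
      using i poly_T_braid[of i f] by (simp add: f psi_poly_T[symmetric])
  qed (rule linmap_osp_T subspace_osp_space)+
  have poly_module: "left_module (hecke_algebra n) (poly_module n)"
    by (rule poly.left_module) (simp_all add: poly_module_def)
  have osp_module: "left_module (hecke_algebra n) (osp_module n k)"
    by (rule osp.left_module) (simp_all add: osp_module_def osp_space_def)
  have "f \<in> ideal_nks n k k \<longleftrightarrow> f \<in> polys {1..n} \<and> graded_map n k f = 0" for f
    using graded_map_ideal[OF assms(1), of f n] graded_map_kernel[OF assms(1), of f n]
      ideal_nks_subset[of n k k] by blast
  then have kernel: "ideal_nk n k =
      {f \<in> carrier (poly_module n). graded_map n k f = \<zero>\<^bsub>osp_module n k\<^esub>}"
    unfolding ideal_nk_eq[OF assms(2)] by (simp add: poly_module_def osp_module_def set_eq_iff)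
  show ?thesis
    unfolding R_module_def
  proof (rule left_module_isomorphic_quotient_kernel[OF poly_module osp_module _ _ _ _ kernel])
    show "graded_map n k x \<in> carrier (osp_module n k)" for x
      using graded_map_in_osp_space[of n k x] by (simp add: osp_module_def osp_space_def)
    show "graded_map n k (x \<oplus>\<^bsub>poly_module n\<^esub> y) =
        graded_map n k x \<oplus>\<^bsub>osp_module n k\<^esub> graded_map n k y" for x y
      by (simp add: poly_module_def osp_module_def linmap_simps[OF linmap_graded_map])
    show "graded_map n k (a \<odot>\<^bsub>poly_module n\<^esub> x) = a \<odot>\<^bsub>osp_module n k\<^esub> graded_map n k x"
      if "a \<in> carrier (hecke_algebra n)" "x \<in> carrier (poly_module n)" for a x
    proof -
      have "x \<in> polys {1..n}" using that(2) by (simp add: poly_module_def)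
      then have "graded_map n k (hecke_act poly_T a x) = hecke_act osp_T a (graded_map n k x)"
        using that(1) graded_map_in_osp_space graded_map_poly_T
        by (intro hecke_act_intertwine[OF poly.hecke_rep_axioms osp.hecke_rep_axioms linmap_graded_map])
      then show ?thesis by (simp add: poly_module_def osp_module_def)
    qed
    show "\<exists>x\<in>carrier (poly_module n). graded_map n k x = y" if "y \<in> carrier (osp_module n k)" for y
    proof -
      have "y \<in> osp_space n k" using that by (simp add: osp_module_def osp_space_def)
      then have "y \<in> graded_map n k ` polys {1..n}" using graded_map_surj[of n k] by blast
      then show ?thesis by (auto simp: poly_module_def)
    qed
  qed
qed


end
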